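(* There exists $\varepsilon>0$ such that the following holds for every sufficiently large $n$. If $G$ is an $n$-vertex graph whose smallest adjacency eigenvalue $\lambda_n$ satisfies $|\lambda_n|\leq n^{\varepsilon}$, then $G$ is $n^{-\varepsilon}$-close to the disjoint union of cliques.
   Context: Graphs are finite and simple. $\lambda_n$ denotes the smallest eigenvalue of the adjacency matrix of $G$. An $n$-vertex graph $G$ is $\mu$-close to a family of graphs $\mathcal{F}$ if it is possible to add or remove at most $\mu n^2$ edges of $G$ (on the same vertex set) to get a member of $\mathcal{F}$. "$\mu$-close to the disjoint union of cliques" means $\mu$-close to the family of all graphs that are vertex-disjoint unions of cliques (any number of cliques, of any sizes, single vertices allowed, with no edges between different cliques). *)

theory Defs
  imports
    "HOL-Library.Disjoint_Sets"
    "HOL-Library.Ramsey"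
    "Jordan_Normal_Form.Spectral_Radius"
begin

text \<open>
  A graph is a pair of a vertex set \<open>V\<close> and an edge set \<open>E\<close>. An edge is a two-element set of vertices,
  so loops and multiple edges cannot occur; \<open>[V]\<^bsup>2\<^esup>\<close> is the set of two-element subsets of \<open>V\<close>.
\<close>

type_synonym 'a graph = "'a set \<times> 'a set set"

definition simple_graph :: "'a graph \<Rightarrow> bool" where
  "simple_graph G \<longleftrightarrow> finite (fst G) \<and> snd G \<subseteq> [fst G]\<^bsup>2\<^esup>"

text \<open>
  The blocks of the partition are the vertex sets of the cliques; a one-element block is an isolated
  vertex.
\<close>

definition disjoint_unions_of_cliques :: "'a graph set" where
  "disjoint_unions_of_cliques =
     {(V, E). finite V \<and> (\<exists>P. partition_on V P \<and> E = (\<Union>C\<in>P. [C]\<^bsup>2\<^esup>))}"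

text \<open>The edges to be added or removed in order to turn \<open>E\<close> into \<open>F\<close> form the symmetric difference.\<close>

definition close_to_family :: "real \<Rightarrow> 'a graph \<Rightarrow> 'a graph set \<Rightarrow> bool" where
  "close_to_family \<mu> G \<F> \<longleftrightarrow>
     (\<exists>F. simple_graph (fst G, F) \<and> (fst G, F) \<in> \<F> \<and>
          real (card (sym_diff (snd G) F)) \<le> \<mu> * (real (card (fst G)))\<^sup>2)"

text \<open>
  Matrices are indexed by \<open>{..<n}\<close>, so the adjacency matrix is only meant for graphs with this
  vertex set. Every \<open>n\<close>-vertex graph is isomorphic to one of these.
\<close>

definition adjacency_matrix :: "nat graph \<Rightarrow> real mat" where
  "adjacency_matrix G =
     (let n = card (fst G) in mat n n (\<lambda>(i, j). if {i, j} \<in> snd G then 1 else 0))"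

text \<open>
  The adjacency matrix is real symmetric, so all its eigenvalues are real and its spectrum over the
  reals is the whole spectrum, a finite set that is nonempty if there is a vertex.
\<close>

definition smallest_eigenvalue :: "nat graph \<Rightarrow> real" where
  "smallest_eigenvalue G = Min (spectrum (adjacency_matrix G))"

end

theory Submission
  imports Defs "HOL-Analysis.Analysis" "HOL-Real_Asymp.Real_Asymp"
begin

text \<open>
  Let \<open>M = A + l I\<close> be positive semidefinite, where \<open>l = n\<^sup>\<epsilon>\<close>. The heart of the matter is that a vertex
  set \<open>S\<close> which maximises \<open>e(S) / |S|\<^bsup>3/2\<^esup>\<close> has density close to \<open>1\<close>, even if all densities in the graph
  are as small as a power of \<open>1/n\<close>. Let \<open>N = |S|\<close> and let \<open>B\<close> be the sum of the first \<open>r\<close> spectral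
  components of \<open>A\<close> on \<open>S\<close>. The entrywise power \<open>B\<^sup>k\<close> has rank at most \<open>r\<^sup>k\<close> and, since \<open>A\<close> is idempotent
  under the entrywise product, is dominated by \<open>M\<close> up to a diagonal. Comparing traces, nearly all
  diagonal entries of \<open>B\<close> are at most a tiny power of \<open>r\<close>. Hence the \<open>i\<close>-th eigenvalue is at most about
  \<open>N i\<^bsup>-3/4\<^esup>\<close>, and \<open>B\<close> approximates \<open>A\<close> in the Frobenius norm already for \<open>r\<close> polynomial in the inverse
  density. By the Cauchy-Schwarz inequality the inner product of \<open>A\<close> and \<open>B\<close> is at most the sum over \<open>v\<close>
  of \<open>sqrt (B v v) * sqrt (e(N(v)) + l deg(v))\<close>. Extremality of \<open>S\<close> bounds \<open>e(N(v))\<close>, and the outcome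
  contradicts \<open>\<langle>A, B\<rangle> \<approx> e(S)\<close> unless the density is almost \<open>1\<close>.

  A set of density at least \<open>99/100\<close> contains a large subset in which every vertex has only \<open>O(l\<^sup>3)\<close>
  non-neighbours. Every other vertex is adjacent to nearly all or to nearly none of this subset. The
  vertices of the first kind almost form a clique and have few edges to the outside, so removing them
  costs \<open>O(l\<^sup>2 n)\<close> pairs. After at most \<open>O(n\<^bsup>1/2\<^esup>)\<close> such removals few edges are left.
\<close>

section \<open>Positive semidefinite kernels\<close>

text \<open>Kernels are functions and the index set is a parameter, so that passing to a principal
  submatrix changes only \<open>S\<close>.\<close>

definition bil :: "'a set \<Rightarrow> ('a \<Rightarrow> 'a \<Rightarrow> real) \<Rightarrow> ('a \<Rightarrow> real) \<Rightarrow> ('a \<Rightarrow> real) \<Rightarrow> real" where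
  "bil S K x y = (\<Sum>u\<in>S. \<Sum>v\<in>S. x u * K u v * y v)"

definition psd :: "'a set \<Rightarrow> ('a \<Rightarrow> 'a \<Rightarrow> real) \<Rightarrow> bool" where
  "psd S K \<longleftrightarrow> (\<forall>u\<in>S. \<forall>v\<in>S. K u v = K v u) \<and> (\<forall>x. 0 \<le> bil S K x x)"

lemma psdI:
  "\<lbrakk>\<And>u v. u \<in> S \<Longrightarrow> v \<in> S \<Longrightarrow> K u v = K v u; \<And>x. 0 \<le> bil S K x x\<rbrakk> \<Longrightarrow> psd S K"
  by (simp add: psd_def)

lemma psd_sym: "psd S K \<Longrightarrow> u \<in> S \<Longrightarrow> v \<in> S \<Longrightarrow> K u v = K v u"
  by (simp add: psd_def)

lemma psd_nonneg: "psd S K \<Longrightarrow> 0 \<le> bil S K x x"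
  by (simp add: psd_def)

lemma bil_cong:
  "\<lbrakk>\<And>u v. u \<in> S \<Longrightarrow> v \<in> S \<Longrightarrow> K u v = L u v; \<And>u. u \<in> S \<Longrightarrow> x u = x' u; \<And>u. u \<in> S \<Longrightarrow> y u = y' u\<rbrakk>
    \<Longrightarrow> bil S K x y = bil S L x' y'"
  unfolding bil_def by (intro sum.cong) auto

lemma psd_cong:
  assumes "\<And>u v. u \<in> S \<Longrightarrow> v \<in> S \<Longrightarrow> K u v = L u v"
  shows "psd S K \<longleftrightarrow> psd S L"
proof -
  have "bil S K x x = bil S L x x" for x by (rule bil_cong) (auto simp: assms)
  then show ?thesis by (auto simp: psd_def assms)
qed

lemma bil_add_kernel: "bil S (\<lambda>u v. K u v + L u v) x y = bil S K x y + bil S L x y"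
  by (simp add: bil_def sum.distrib algebra_simps)

lemma bil_diff_kernel: "bil S (\<lambda>u v. K u v - L u v) x y = bil S K x y - bil S L x y"
  by (simp add: bil_def sum_subtractf algebra_simps)

lemma bil_scale_kernel: "bil S (\<lambda>u v. c * K u v) x y = c * bil S K x y"
  by (simp add: bil_def sum_distrib_left mult_ac)

lemma bil_add_left: "bil S K (\<lambda>u. x u + x' u) y = bil S K x y + bil S K x' y"
  by (simp add: bil_def sum.distrib algebra_simps)

lemma bil_add_right: "bil S K x (\<lambda>u. y u + y' u) = bil S K x y + bil S K x y'"
  by (simp add: bil_def sum.distrib algebra_simps)

lemma bil_diff_left: "bil S K (\<lambda>u. x u - x' u) y = bil S K x y - bil S K x' y"
  by (simp add: bil_def sum_subtractf algebra_simps)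

lemma bil_diff_right: "bil S K x (\<lambda>u. y u - y' u) = bil S K x y - bil S K x y'"
  by (simp add: bil_def sum_subtractf algebra_simps)

lemma bil_scale_left: "bil S K (\<lambda>u. c * x u) y = c * bil S K x y"
  by (simp add: bil_def sum_distrib_left mult_ac)

lemma bil_scale_right: "bil S K x (\<lambda>u. c * y u) = c * bil S K x y"
  by (simp add: bil_def sum_distrib_left mult_ac)

lemmas bil_linear = bil_add_left bil_add_right bil_diff_left bil_diff_right
  bil_scale_left bil_scale_right

lemma bil_sym:
  assumes "\<And>u v. u \<in> S \<Longrightarrow> v \<in> S \<Longrightarrow> K u v = K v u"
  shows "bil S K x y = bil S K y x"
proof -
  have "bil S K x y = (\<Sum>v\<in>S. \<Sum>u\<in>S. x u * K u v * y v)"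
    unfolding bil_def by (rule sum.swap)
  also have "\<dots> = bil S K y x"
    unfolding bil_def using assms by (intro sum.cong refl) (simp add: mult_ac)
  finally show ?thesis .
qed

lemma bil_rank_one: "bil S (\<lambda>u v. f u * g v) x y = (\<Sum>u\<in>S. x u * f u) * (\<Sum>v\<in>S. g v * y v)"
  by (simp add: bil_def sum_product mult_ac)

lemma bil_diag:
  "finite S \<Longrightarrow> bil S (\<lambda>u v. if u = v then d u else 0) x y = (\<Sum>u\<in>S. d u * x u * y u)"
  by (simp add: bil_def if_distrib if_distribR sum.delta cong: if_cong) (simp add: mult_ac)

lemma bil_rowsum: "bil S K x y = (\<Sum>u\<in>S. x u * (\<Sum>v\<in>S. K u v * y v))"
  by (simp add: bil_def sum_distrib_left mult_ac)

lemma psd_add: "psd S K \<Longrightarrow> psd S L \<Longrightarrow> psd S (\<lambda>u v. K u v + L u v)"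
  by (simp add: psd_def bil_add_kernel)

lemma psd_scale: "psd S K \<Longrightarrow> 0 \<le> c \<Longrightarrow> psd S (\<lambda>u v. c * K u v)"
  by (simp add: psd_def bil_scale_kernel)

lemma psd_rank_one: "psd S (\<lambda>u v. f u * f v)"
  by (rule psdI) (auto simp: bil_rank_one mult_ac)

lemma psd_diag:
  assumes "finite S" "\<And>u. u \<in> S \<Longrightarrow> 0 \<le> d u"
  shows "psd S (\<lambda>u v. if u = v then d u else 0)"
  using assms by (intro psdI) (auto simp: bil_diag mult.assoc intro!: sum_nonneg)

lemma psd_sum: "(\<And>i. i \<in> I \<Longrightarrow> psd S (K i)) \<Longrightarrow> psd S (\<lambda>u v. \<Sum>i\<in>I. K i u v)"
proof (induction I rule: infinite_finite_induct)
  case (insert i I)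
  then show ?case using psd_add[of S "K i" "\<lambda>u v. \<Sum>i\<in>I. K i u v"] by simp
qed (auto simp: psd_def bil_def)

lemma bil_weight: "bil S (\<lambda>u v. f u * K u v * g v) x y = bil S K (\<lambda>u. f u * x u) (\<lambda>u. g u * y u)"
  by (simp add: bil_def mult_ac)

lemma psd_conj: "psd S K \<Longrightarrow> psd S (\<lambda>u v. f u * K u v * f v)"
  by (rule psdI) (simp_all add: psd_sym bil_weight psd_nonneg)

lemma bil_support:
  assumes "finite S" "T \<subseteq> S"
  shows "bil S K (\<lambda>u. if u \<in> T then x u else 0) (\<lambda>u. if u \<in> T then y u else 0) = bil T K x y"
proof -
  have "bil T K x y = (\<Sum>u\<in>T. \<Sum>v\<in>S. x u * K u v * (if v \<in> T then y v else 0))"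
    unfolding bil_def using assms by (intro sum.cong sum.mono_neutral_cong_left) auto
  also have "\<dots> = (\<Sum>u\<in>S. \<Sum>v\<in>S. (if u \<in> T then x u else 0) * K u v * (if v \<in> T then y v else 0))"
    using assms by (intro sum.mono_neutral_cong_left) auto
  finally show ?thesis by (simp add: bil_def)
qed

lemma psd_subset:
  assumes "psd S K" "finite S" "T \<subseteq> S"
  shows "psd T K"
proof (rule psdI)
  show "K u v = K v u" if "u \<in> T" "v \<in> T" for u v
    using that assms psd_sym[of S K u v] by blast
  show "0 \<le> bil T K x x" for x
    using psd_nonneg[OF assms(1)] bil_support[OF assms(2,3), of K x x] by metis
qed

section \<open>Cauchy-Schwarz inequality, Schur complements and Hadamard products\<close>

text \<open>For \<open>c > 0\<close> the claim is nonnegativity at the minimiser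
  \<open>t = -b/c\<close>. For \<open>c = 0\<close> an affine function bounded below has slope zero:
  otherwise \<open>t = -(a+1)/(2*b)\<close> gives the value -1.\<close>

lemma quadratic_nonneg_discriminant:
  fixes a b c :: real
  assumes "\<And>t. 0 \<le> a + 2 * t * b + t\<^sup>2 * c" "0 \<le> a" "0 \<le> c"
  shows "b\<^sup>2 \<le> a * c"
proof (cases "c = 0")
  case True
  have "b = 0"
  proof (rule ccontr)
    assume "b \<noteq> 0"
    have "2 * (-(a+1)/(2*b)) * b = -(a+1)" using \<open>b \<noteq> 0\<close> by (simp add: field_simps)
    then show False using assms(1)[of "-(a+1)/(2*b)"] True by simp
  qed
  then show ?thesis using True by simp
next
  case False
  have "0 \<le> c * (a + 2 * (-b/c) * b + (-b/c)\<^sup>2 * c)"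
    by (intro mult_nonneg_nonneg assms)
  also have "\<dots> = a * c - b\<^sup>2" using False by (simp add: field_simps power2_eq_square)
  finally show ?thesis by simp
qed

lemma psd_Cauchy_Schwarz:
  assumes "psd S K"
  shows "(bil S K x y)\<^sup>2 \<le> bil S K x x * bil S K y y"
proof (rule quadratic_nonneg_discriminant)
  fix t
  have "0 \<le> bil S K (\<lambda>u. x u + t * y u) (\<lambda>u. x u + t * y u)"
    using psd_nonneg[OF assms] .
  also have "\<dots> = bil S K x x + t * bil S K x y + t * bil S K y x + t * t * bil S K y y"
    by (simp add: bil_linear algebra_simps)
  also have "bil S K y x = bil S K x y"
    using psd_sym[OF assms] by (intro bil_sym) auto
  finally show "0 \<le> bil S K x x + 2 * t * bil S K x y + t\<^sup>2 * bil S K y y"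
    by (simp add: power2_eq_square)
qed (auto intro: psd_nonneg assms)

text \<open>Subtracting this kernel lowers the form at \<open>x\<close> by
  \<open>(bil S K x z)\<^sup>2 / bil S K z z\<close>, which Cauchy-Schwarz bounds by
  \<open>bil S K x x\<close>. If \<open>bil S K z z = 0\<close>, division by zero makes the
  subtracted kernel vanish.\<close>

lemma psd_diff_rank_one:
  assumes "psd S K"
  shows "psd S (\<lambda>u v. K u v - (\<Sum>w\<in>S. K u w * z w) * (\<Sum>w\<in>S. K v w * z w) / bil S K z z)"
    (is "psd S (\<lambda>u v. K u v - ?D u * ?D v / ?T)")
proof (rule psdI)
  fix x
  have eq: "bil S (\<lambda>u v. K u v - ?D u * ?D v / ?T) x x = bil S K x x - (bil S K x z)\<^sup>2 / ?T"
  proof -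
    have "bil S (\<lambda>u v. ?D u * ?D v / ?T) x x = bil S (\<lambda>u v. (1 / ?T) * (?D u * ?D v)) x x"
      by (rule bil_cong) auto
    also have "\<dots> = (1 / ?T) * ((\<Sum>u\<in>S. x u * ?D u) * (\<Sum>v\<in>S. ?D v * x v))"
      by (simp only: bil_scale_kernel bil_rank_one)
    also have "(\<Sum>v\<in>S. ?D v * x v) = bil S K x z" unfolding bil_rowsum by (simp add: mult.commute)
    also have "(\<Sum>u\<in>S. x u * ?D u) = bil S K x z" unfolding bil_rowsum by simp
    finally show ?thesis by (simp add: bil_diff_kernel power2_eq_square)
  qed
  show "0 \<le> bil S (\<lambda>u v. K u v - ?D u * ?D v / ?T) x x"
  proof (cases "?T = 0")
    case False
    then have "?T > 0" using psd_nonneg[OF assms, of z] by simp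
    then have "(bil S K x z)\<^sup>2 / ?T \<le> bil S K x x"
      using psd_Cauchy_Schwarz[OF assms, of x z] by (simp add: pos_divide_le_eq)
    then show ?thesis by (simp add: eq)
  qed (use psd_nonneg[OF assms, of x] in \<open>simp add: eq\<close>)
qed (use psd_sym[OF assms] in \<open>auto simp: mult_ac\<close>)

lemma bil_unit:
  assumes "finite S" "a \<in> S"
  shows "bil S K x (\<lambda>u. if u = a then 1 else 0) = (\<Sum>u\<in>S. x u * K u a)"
  using assms by (simp add: bil_def if_distrib sum.delta cong: if_cong)

lemma bil_unit_unit:
  assumes "finite S" "a \<in> S"
  shows "bil S K (\<lambda>u. if u = a then 1 else 0) (\<lambda>u. if u = a then 1 else 0) = K a a"
  using assms by (simp add: bil_unit if_distribR if_distrib sum.delta cong: if_cong)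

lemma psd_diag_nonneg: "psd S K \<Longrightarrow> finite S \<Longrightarrow> a \<in> S \<Longrightarrow> 0 \<le> K a a"
  using psd_nonneg bil_unit_unit by metis

lemma psd_entry_sq:
  assumes "psd S K" "finite S" "a \<in> S" "b \<in> S"
  shows "(K b a)\<^sup>2 \<le> K b b * K a a"
proof -
  have "bil S K (\<lambda>u. if u = b then 1 else 0) (\<lambda>u. if u = a then 1 else 0) = K b a"
    using assms by (simp add: bil_unit if_distribR if_distrib sum.delta cong: if_cong)
  then show ?thesis
    using psd_Cauchy_Schwarz[OF assms(1), of "\<lambda>u. if u = b then 1 else 0" "\<lambda>u. if u = a then 1 else 0"]
    by (simp add: bil_unit_unit assms)
qed

lemma psd_insert_zero:
  assumes "psd F K" "finite F" "\<And>v. v \<in> insert a F \<Longrightarrow> K a v = 0 \<and> K v a = 0"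
  shows "psd (insert a F) K"
proof (cases "a \<in> F")
  case False
  have "bil (insert a F) K x x = bil F K x x" for x
    using assms(2,3) False by (simp add: bil_def)
  then show ?thesis using assms by (auto simp: psd_def)
qed (use assms in \<open>simp add: insert_absorb\<close>)

text \<open>Eliminating one row at a time, as in a Cholesky decomposition, reduces the first factor to
  kernels of rank one.\<close>

theorem Schur_product:
  assumes "finite S" "psd S K" "psd S L"
  shows "psd S (\<lambda>u v. K u v * L u v)"
  using assms
proof (induction S arbitrary: K rule: finite_induct)
  case empty
  then show ?case by (simp add: psd_def bil_def)
next
  case (insert a F)
  let ?S = "insert a F"
  \<comment> \<open>The Schur complement of the entry \<open>K a a\<close>. Its row and column
    \<open>a\<close> vanish: for \<open>K a a = 0\<close> division by zero leaves
    \<open>K' = K\<close>, and then \<open>K v a = 0\<close> by \<open>psd_entry_sq\<close>.\<close>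
  define K' where "K' = (\<lambda>u v. K u v - K u a * K v a / K a a)"
  have fin: "finite ?S" and a: "a \<in> ?S" using insert by auto
  have "psd ?S (\<lambda>u v. K u v - (\<Sum>w\<in>?S. K u w * (if w = a then 1 else 0)) *
      (\<Sum>w\<in>?S. K v w * (if w = a then 1 else 0)) /
      bil ?S K (\<lambda>u. if u = a then 1 else 0) (\<lambda>u. if u = a then 1 else 0))"
    by (rule psd_diff_rank_one) (rule insert.prems)
  moreover have "(\<Sum>w\<in>?S. K u w * (if w = a then 1 else 0)) = K u a" for u
    using insert.hyps by (simp add: if_distrib sum.delta cong: if_cong)
  ultimately have K': "psd ?S K'"
    by (simp add: bil_unit_unit[OF fin a] K'_def)
  have z: "K' a v = 0 \<and> K' v a = 0" if v: "v \<in> ?S" for v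
  proof (cases "K a a = 0")
    case True
    then have "K v a = 0"
      using psd_entry_sq[OF insert.prems(1) fin a v] by simp
    then show ?thesis using psd_sym[OF insert.prems(1) a v] by (simp add: K'_def)
  next
    case False
    then show ?thesis using psd_sym[OF insert.prems(1) a v] by (simp add: K'_def)
  qed
  have "psd F (\<lambda>u v. K' u v * L u v)"
    using K' insert.prems(2) fin by (intro insert.IH) (auto intro: psd_subset)
  then have 1: "psd ?S (\<lambda>u v. K' u v * L u v)"
    by (rule psd_insert_zero) (use insert.hyps z in auto)
  have 2: "psd ?S (\<lambda>u v. (1 / K a a) * (K u a * L u v * K v a))"
    using psd_diag_nonneg[OF insert.prems(1) fin a]
    by (intro psd_scale psd_conj insert.prems) auto
  have "psd ?S (\<lambda>u v. K' u v * L u v + (1 / K a a) * (K u a * L u v * K v a))"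
    by (rule psd_add[OF 1 2])
  then show ?case
    by (rule psd_cong[THEN iffD1, rotated]) (simp add: K'_def algebra_simps)
qed

lemma psd_power:
  assumes "finite S" "psd S K"
  shows "psd S (\<lambda>u v. K u v ^ k)"
proof (induction k)
  case 0
  show ?case using psd_rank_one[of S "\<lambda>_. 1"] by simp
next
  case (Suc k)
  then show ?case using Schur_product[OF assms Suc] by simp
qed

lemma psd_sum_nonneg: "psd S K \<Longrightarrow> 0 \<le> (\<Sum>u\<in>S. \<Sum>v\<in>S. K u v)"
  using psd_nonneg[of S K "\<lambda>_. 1"] by (simp add: bil_def)

section \<open>Eigenvectors and deflation\<close>

definition nsq :: "'a set \<Rightarrow> ('a \<Rightarrow> real) \<Rightarrow> real" where
  "nsq S x = (\<Sum>u\<in>S. (x u)\<^sup>2)"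

lemma nsq_nonneg: "0 \<le> nsq S x"
  by (simp add: nsq_def sum_nonneg)

lemma bil_scalar: "finite S \<Longrightarrow> bil S (\<lambda>u v. if u = v then c else 0) x x = c * nsq S x"
  by (simp add: bil_diag nsq_def power2_eq_square sum_distrib_left mult_ac)

text \<open>Vectors on \<open>S\<close> are represented by functions vanishing off \<open>S\<close>;
  the ball is then a closed subset of a product of intervals, compact by Tychonoff's
  theorem.\<close>

lemma compact_unit_ball_fun:
  assumes "finite S"
  shows "compact {x :: 'a \<Rightarrow> real. (\<forall>u. u \<notin> S \<longrightarrow> x u = 0) \<and> nsq S x \<le> 1}"
proof -
  define C where "C = (\<lambda>u. if u \<in> S then {-1..1::real} else {0})"
  have "compactin (product_topology (\<lambda>_::'a. euclidean) UNIV) (PiE UNIV C)"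
    by (subst compactin_PiE) (auto simp: C_def)
  then have comp: "compact (PiE UNIV C)"
    by (simp add: euclidean_product_topology)
  have cl: "closed {x :: 'a \<Rightarrow> real. nsq S x \<le> 1}"
    unfolding nsq_def by (intro closed_Collect_le continuous_intros continuous_on_product_coordinates)
  have "{x :: 'a \<Rightarrow> real. (\<forall>u. u \<notin> S \<longrightarrow> x u = 0) \<and> nsq S x \<le> 1} = PiE UNIV C \<inter> {x. nsq S x \<le> 1}"
  proof (intro equalityI subsetI)
    fix x :: "'a \<Rightarrow> real"
    assume "x \<in> {x. (\<forall>u. u \<notin> S \<longrightarrow> x u = 0) \<and> nsq S x \<le> 1}"
    then have x: "\<And>u. u \<notin> S \<Longrightarrow> x u = 0" "nsq S x \<le> 1" by auto
    have "x u \<in> {-1..1}" if "u \<in> S" for u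
    proof -
      have "(x u)\<^sup>2 \<le> nsq S x"
        unfolding nsq_def using assms that by (intro member_le_sum) auto
      then show ?thesis using x(2) abs_square_le_1[of "x u"] by auto
    qed
    then show "x \<in> PiE UNIV C \<inter> {x. nsq S x \<le> 1}" using x by (auto simp: C_def)
  qed (auto simp: C_def PiE_def Pi_def split: if_splits)
  then show ?thesis using compact_Int_closed[OF comp cl] by simp
qed

text \<open>The form attains a maximum \<open>\<mu>\<close> on the unit ball. Taking the ball
  instead of the sphere makes \<open>\<mu>\<close> the positive part of the largest eigenvalue;
  \<open>\<mu> * nsq S w = \<mu>\<close> says that \<open>w\<close> is a unit vector unless
  \<open>\<mu> = 0\<close>.\<close>

lemma top_eigenvector:
  assumes "finite S" and sym: "\<And>u v. u \<in> S \<Longrightarrow> v \<in> S \<Longrightarrow> K u v = K v u"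
  obtains \<mu> w where "0 \<le> \<mu>" "\<And>u. u \<in> S \<Longrightarrow> (\<Sum>v\<in>S. K u v * w v) = \<mu> * w u"
    "\<mu> * nsq S w = \<mu>" "\<And>x. bil S K x x \<le> \<mu> * nsq S x"
proof -
  define D where "D = {x :: 'a \<Rightarrow> real. (\<forall>u. u \<notin> S \<longrightarrow> x u = 0) \<and> nsq S x \<le> 1}"
  have "compact D" unfolding D_def by (rule compact_unit_ball_fun[OF assms(1)])
  moreover have "(\<lambda>_. 0) \<in> D" by (simp add: D_def nsq_def)
  moreover have "continuous_on D (\<lambda>x. bil S K x x)"
    unfolding bil_def
    by (intro continuous_intros continuous_on_subset[OF continuous_on_product_coordinates]) auto
  ultimately obtain w where w: "w \<in> D" and max: "\<And>x. x \<in> D \<Longrightarrow> bil S K x x \<le> bil S K w w"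
    using continuous_attains_sup[of D "\<lambda>x. bil S K x x"] by blast
  define \<mu> where "\<mu> = bil S K w w"
  have \<mu>0: "0 \<le> \<mu>" using max[OF \<open>(\<lambda>_. 0) \<in> D\<close>] by (simp add: \<mu>_def bil_def)
  have ray: "bil S K x x \<le> \<mu> * nsq S x" for x
  proof (cases "nsq S x = 0")
    case True
    then have "x u = 0" if "u \<in> S" for u
      using that assms(1) by (simp add: nsq_def sum_nonneg_eq_0_iff)
    then show ?thesis by (simp add: bil_def nsq_def)
  next
    case False
    then have pos: "nsq S x > 0" using nsq_nonneg[of S x] by simp
    define c where "c = 1 / sqrt (nsq S x)"
    have c: "c * c * nsq S x = 1" using pos by (simp add: c_def)
    have "bil S K (\<lambda>u. if u \<in> S then c * x u else 0) (\<lambda>u. if u \<in> S then c * x u else 0) \<le> \<mu>"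
    proof -
      have "nsq S (\<lambda>u. if u \<in> S then c * x u else 0) = c * c * nsq S x"
        by (simp add: nsq_def sum_distrib_left power_mult_distrib power2_eq_square mult_ac)
      then have "(\<lambda>u. if u \<in> S then c * x u else 0) \<in> D" using c by (simp add: D_def)
      then show ?thesis unfolding \<mu>_def by (rule max)
    qed
    then have "c * c * bil S K x x \<le> \<mu>"
      by (subst (asm) bil_support[OF assms(1) order.refl]) (simp add: bil_linear mult_ac)
    then have "nsq S x * (c * c * bil S K x x) \<le> nsq S x * \<mu>"
      by (intro mult_left_mono) (auto simp: nsq_nonneg)
    also have "nsq S x * (c * c * bil S K x x) = (c * c * nsq S x) * bil S K x x"
      by (simp add: mult_ac)
    finally show ?thesis using c by (simp add: mult.commute)
  qed
  show thesis
  proof (cases "\<mu> = 0")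
    case True
    show thesis by (rule that[of 0 "\<lambda>_. 0"]) (use ray True in auto)
  next
    case False
    then have "\<mu> > 0" using \<mu>0 by simp
    have "nsq S w \<le> 1" using w by (simp add: D_def)
    moreover have "\<mu> \<le> \<mu> * nsq S w" using ray[of w] by (simp add: \<mu>_def)
    then have "1 \<le> nsq S w" using \<open>\<mu> > 0\<close> by simp
    ultimately have nw: "nsq S w = 1" by simp
    \<comment> \<open>\<open>P\<close> is positive semidefinite and its form vanishes at the
      maximiser \<open>w\<close>, so by Cauchy-Schwarz \<open>P\<close> annihilates
      \<open>w\<close>; that is, \<open>w\<close> is an eigenvector of \<open>K\<close>.\<close>
    define P where "P = (\<lambda>u v. (if u = v then \<mu> else 0) - K u v)"
    have P: "psd S P"
    proof (rule psdI)
      show "0 \<le> bil S P x x" for x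
        using ray[of x] by (simp add: P_def bil_diff_kernel bil_scalar[OF assms(1)])
    qed (use sym in \<open>auto simp: P_def\<close>)
    have "bil S P w w = 0"
      by (simp add: P_def bil_diff_kernel bil_scalar[OF assms(1)] nw) (simp add: \<mu>_def)
    then have zero: "bil S P x w = 0" for x
      using psd_Cauchy_Schwarz[OF P, of x w] by simp
    have "(\<Sum>v\<in>S. K u v * w v) = \<mu> * w u" if u: "u \<in> S" for u
    proof -
      have "0 = bil S P (\<lambda>v. if v = u then 1 else 0) w" using zero by simp
      also have "\<dots> = (\<Sum>v\<in>S. P u v * w v)"
        unfolding bil_rowsum using u assms(1)
        by (simp add: if_distribR if_distrib sum.delta cong: if_cong)
      also have "\<dots> = \<mu> * w u - (\<Sum>v\<in>S. K u v * w v)"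
        unfolding P_def left_diff_distrib sum_subtractf using u assms(1)
        by (simp add: if_distribR if_distrib sum.delta' cong: if_cong)
      finally show ?thesis by simp
    qed
    then show thesis using that[of \<mu> w] \<mu>0 nw ray by simp
  qed
qed

lemma bil_gram:
  fixes f :: "nat \<Rightarrow> 'a \<Rightarrow> real"
  shows "bil S (\<lambda>u v. \<Sum>i<m. f i u * f i v) y y = (\<Sum>i<m. (\<Sum>u\<in>S. y u * f i u)\<^sup>2)"
proof (induction m)
  case (Suc m)
  have "bil S (\<lambda>u v. \<Sum>i<Suc m. f i u * f i v) y y =
      bil S (\<lambda>u v. \<Sum>i<m. f i u * f i v) y y + bil S (\<lambda>u v. f m u * f m v) y y"
    by (simp add: bil_add_kernel)
  then show ?case using Suc by (simp add: bil_rank_one power2_eq_square mult.commute)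
qed (simp add: bil_def)

definition frob :: "'a set \<Rightarrow> ('a \<Rightarrow> 'a \<Rightarrow> real) \<Rightarrow> real" where
  "frob S K = (\<Sum>u\<in>S. \<Sum>v\<in>S. (K u v)\<^sup>2)"

text \<open>For a unit vector \<open>w\<close>, the form of \<open>K'\<close> at \<open>x\<close> is
  that of \<open>K\<close> at the projection of \<open>x\<close> orthogonal to \<open>w\<close>.
  Projecting does not increase the norm, so the lower bound survives. In \<open>frob\<close> the
  cross term loses \<open>2 * \<mu>\<^sup>2\<close> and the square regains
  \<open>\<mu>\<^sup>2\<close>.\<close>

lemma deflation_step:
  assumes "finite S" and sym: "\<And>u v. u \<in> S \<Longrightarrow> v \<in> S \<Longrightarrow> K u v = K v u"
    and eig: "\<And>u. u \<in> S \<Longrightarrow> (\<Sum>v\<in>S. K u v * w v) = \<mu> * w u"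
    and nrm: "\<mu> * nsq S w = \<mu>" and "0 \<le> \<mu>" "0 \<le> l"
    and low: "\<And>x. - l * nsq S x \<le> bil S K x x"
  defines "K' \<equiv> (\<lambda>u v. K u v - \<mu> * (w u * w v))"
  shows "- l * nsq S x \<le> bil S K' x x" and "frob S K' = frob S K - \<mu>\<^sup>2"
proof -
  have nw: "\<mu> = 0 \<or> nsq S w = 1" using nrm by auto
  define t where "t = (\<Sum>u\<in>S. w u * x u)"
  have Kw: "bil S K y w = (\<Sum>u\<in>S. y u * (\<mu> * w u))" for y
    unfolding bil_rowsum by (intro sum.cong refl) (simp add: eig)
  have Kxw: "bil S K x w = \<mu> * t"
    unfolding Kw by (simp add: t_def sum_distrib_left mult_ac)
  have Kww: "bil S K w w = \<mu>"
    using nrm unfolding Kw by (simp add: nsq_def sum_distrib_left power2_eq_square mult_ac)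
  have Kwx: "bil S K w x = \<mu> * t" using Kxw bil_sym[of S K w x] sym by simp
  have K'x: "bil S K' x x = bil S K x x - \<mu> * t\<^sup>2"
    unfolding K'_def by (simp add: bil_diff_kernel bil_scale_kernel bil_rank_one t_def power2_eq_square mult_ac)
  have y1: "bil S K (\<lambda>u. x u - t * w u) (\<lambda>u. x u - t * w u) = bil S K' x x"
    by (simp add: bil_linear Kxw Kwx Kww K'x power2_eq_square algebra_simps)
  show "- l * nsq S x \<le> bil S K' x x"
  proof (cases "\<mu> = 0")
    case True
    then show ?thesis using low[of x] K'x by simp
  next
    case False
    then have "nsq S w = 1" using nw by simp
    then have "nsq S (\<lambda>u. x u - t * w u) = nsq S x - t\<^sup>2"
      by (simp add: nsq_def power2_eq_square algebra_simps sum.distrib sum_subtractf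
          flip: sum_distrib_left) (simp add: t_def mult_ac sum_distrib_left)
    then have "l * nsq S (\<lambda>u. x u - t * w u) \<le> l * nsq S x" using \<open>0 \<le> l\<close>
      by (intro mult_left_mono) auto
    then show ?thesis using low[of "\<lambda>u. x u - t * w u"] y1 by simp
  qed
  have "frob S K' = frob S K - 2 * \<mu> * bil S K w w + \<mu>\<^sup>2 * (nsq S w)\<^sup>2"
  proof -
    have "frob S K' = (\<Sum>u\<in>S. \<Sum>v\<in>S. (K u v)\<^sup>2 - 2 * \<mu> * (w u * K u v * w v) + \<mu>\<^sup>2 * ((w u)\<^sup>2 * (w v)\<^sup>2))"
      unfolding frob_def K'_def by (intro sum.cong refl) (simp add: power2_eq_square algebra_simps)
    also have "\<dots> = frob S K - 2 * \<mu> * bil S K w w + \<mu>\<^sup>2 * ((\<Sum>u\<in>S. (w u)\<^sup>2) * (\<Sum>v\<in>S. (w v)\<^sup>2))"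
      unfolding frob_def bil_def sum_product
      by (simp add: sum.distrib sum_subtractf sum_distrib_left)
    finally show ?thesis by (simp add: nsq_def power2_eq_square)
  qed
  also have "\<dots> = frob S K - \<mu>\<^sup>2" using nw Kww by (auto simp: power2_eq_square)
  finally show "frob S K' = frob S K - \<mu>\<^sup>2" .
qed

text \<open>Top eigenvectors are peeled off one after another; they are described only through the
  bounds on the remainders and the loss in \<open>frob\<close>. Once a remainder has no positive
  eigenvalue, all further \<open>\<mu> i\<close> are zero.\<close>

lemma spectral_deflation:
  assumes "finite S" and sym: "\<And>u v. u \<in> S \<Longrightarrow> v \<in> S \<Longrightarrow> A u v = A v u"
    and "0 \<le> l" and low: "\<And>x. - l * nsq S x \<le> bil S A x x"
  obtains \<mu> :: "nat \<Rightarrow> real" and w :: "nat \<Rightarrow> 'a \<Rightarrow> real"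
  where "\<And>i. 0 \<le> \<mu> i" "decseq \<mu>" "\<And>i. \<mu> i * nsq S (w i) = \<mu> i"
    "\<And>r x. - l * nsq S x \<le> bil S (\<lambda>u v. A u v - (\<Sum>i<r. \<mu> i * (w i u * w i v))) x x"
    "\<And>r x. bil S (\<lambda>u v. A u v - (\<Sum>i<r. \<mu> i * (w i u * w i v))) x x \<le> \<mu> r * nsq S x"
    "\<And>r. frob S (\<lambda>u v. A u v - (\<Sum>i<r. \<mu> i * (w i u * w i v))) = frob S A - (\<Sum>i<r. (\<mu> i)\<^sup>2)"
proof -
  define good where "good = (\<lambda>K p. 0 \<le> fst p \<and> (\<forall>u\<in>S. (\<Sum>v\<in>S. K u v * snd p v) = fst p * snd p u) \<and>
      fst p * nsq S (snd p) = fst p \<and> (\<forall>x. bil S K x x \<le> fst p * nsq S x))"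
  define pick where "pick = (\<lambda>K. SOME p. good K p)"
  have pick: "good K (pick K)" if symK: "\<And>u v. u \<in> S \<Longrightarrow> v \<in> S \<Longrightarrow> K u v = K v u" for K
  proof -
    have "\<exists>p. good K p"
    proof (rule top_eigenvector[OF assms(1) symK])
      fix \<mu> w
      assume "0 \<le> \<mu>" "\<And>u. u \<in> S \<Longrightarrow> (\<Sum>v\<in>S. K u v * w v) = \<mu> * w u"
        "\<mu> * nsq S w = \<mu>" "\<And>x. bil S K x x \<le> \<mu> * nsq S x"
      then have "good K (\<mu>, w)" unfolding good_def fst_conv snd_conv by blast
      then show ?thesis by blast
    qed
    then show ?thesis unfolding pick_def by (rule someI_ex)
  qed
  define Ks where "Ks = rec_nat A (\<lambda>_ K. (\<lambda>u v. K u v - fst (pick K) * (snd (pick K) u * snd (pick K) v)))"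
  define \<mu> where "\<mu> = (\<lambda>i. fst (pick (Ks i)))"
  define w where "w = (\<lambda>i. snd (pick (Ks i)))"
  have Ks: "Ks r = (\<lambda>u v. A u v - (\<Sum>i<r. \<mu> i * (w i u * w i v)))" for r
    by (induction r) (auto simp: Ks_def \<mu>_def w_def algebra_simps)
  have symK: "Ks r u v = Ks r v u" if "u \<in> S" "v \<in> S" for r u v
    using sym[OF that] by (simp add: Ks mult_ac)
  have g: "0 \<le> \<mu> i" "\<And>u. u \<in> S \<Longrightarrow> (\<Sum>v\<in>S. Ks i u v * w i v) = \<mu> i * w i u"
    "\<mu> i * nsq S (w i) = \<mu> i" "\<And>x. bil S (Ks i) x x \<le> \<mu> i * nsq S x" for i
    using pick[of "Ks i", OF symK] unfolding good_def \<mu>_def w_def by auto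
  have KSuc: "Ks (Suc r) = (\<lambda>u v. Ks r u v - \<mu> r * (w r u * w r v))" for r
    by (simp add: Ks_def \<mu>_def w_def)
  have lowK: "- l * nsq S x \<le> bil S (Ks r) x x" for r x
  proof (induction r arbitrary: x)
    case 0
    then show ?case using low by (simp add: Ks)
  next
    case (Suc r)
    show ?case unfolding KSuc
      by (rule deflation_step(1)[OF assms(1) symK g(2) g(3) g(1) assms(3) Suc])
  qed
  have frobK: "frob S (Ks r) = frob S A - (\<Sum>i<r. (\<mu> i)\<^sup>2)" for r
  proof (induction r)
    case 0
    then show ?case by (simp add: Ks)
  next
    case (Suc r)
    have "frob S (Ks (Suc r)) = frob S (Ks r) - (\<mu> r)\<^sup>2" unfolding KSuc
      by (rule deflation_step(2)[OF assms(1) symK g(2) g(3) g(1) assms(3) lowK])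
    then show ?case using Suc by simp
  qed
  have dec: "\<mu> (Suc r) \<le> \<mu> r" for r
  proof (cases "\<mu> (Suc r) = 0")
    case False
    then have n1: "nsq S (w (Suc r)) = 1" using g(3)[of "Suc r"] by simp
    have "bil S (Ks (Suc r)) (w (Suc r)) (w (Suc r)) = (\<Sum>u\<in>S. w (Suc r) u * (\<mu> (Suc r) * w (Suc r) u))"
      unfolding bil_rowsum by (intro sum.cong refl) (simp add: g(2))
    also have "\<dots> = \<mu> (Suc r)"
      using g(3)[of "Suc r"] by (simp add: nsq_def sum_distrib_left power2_eq_square mult_ac)
    finally have "\<mu> (Suc r) = bil S (Ks (Suc r)) (w (Suc r)) (w (Suc r))" by simp
    also have "\<dots> = bil S (Ks r) (w (Suc r)) (w (Suc r)) - \<mu> r * (\<Sum>u\<in>S. w (Suc r) u * w r u)\<^sup>2"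
      unfolding KSuc by (simp add: bil_diff_kernel bil_scale_kernel bil_rank_one power2_eq_square mult.commute)
    also have "\<dots> \<le> \<mu> r * nsq S (w (Suc r))" using g(1)[of r] g(4)[of r "w (Suc r)"]
      by (smt (verit) mult_nonneg_nonneg zero_le_power2)
    finally show ?thesis using n1 by simp
  qed (use g(1) in simp)
  have "decseq \<mu>" using dec by (rule decseq_SucI)
  then show thesis
    by (rule that[of \<mu> w, rotated]) (use g lowK frobK in \<open>auto simp flip: Ks\<close>)
qed

section \<open>Frobenius and trace estimates\<close>

text \<open>The eigenvalues \<open>x\<close> of \<open>K\<close> satisfy
  \<open>(x + l) * (m - x) \<ge> 0\<close>, and summing these products gives the claim. The sum, a
  trace of a matrix product, is obtained as the sum of all entries of a Hadamard product of two
  positive semidefinite kernels; the trace of \<open>K\<close> enters with the factor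
  \<open>m - l \<ge> 0\<close> and is dropped.\<close>

lemma frob_bounded_kernel:
  assumes "finite S" and sym: "\<And>u v. u \<in> S \<Longrightarrow> v \<in> S \<Longrightarrow> K u v = K v u"
    and low: "\<And>x. - l * nsq S x \<le> bil S K x x" and up: "\<And>x. bil S K x x \<le> m * nsq S x"
    and "l \<le> m" and tr: "(\<Sum>u\<in>S. K u u) \<le> 0"
  shows "frob S K \<le> l * m * card S"
proof -
  let ?I = "\<lambda>c u v. (if u = v then c else (0::real))"
  have "psd S (\<lambda>u v. ?I l u v + K u v)"
  proof (intro psdI)
    show "0 \<le> bil S (\<lambda>u v. ?I l u v + K u v) x x" for x
      using low[of x] by (simp add: bil_add_kernel bil_scalar[OF assms(1)])
  qed (simp add: sym)
  moreover have "psd S (\<lambda>u v. ?I m u v - K u v)"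
    using up by (intro psdI) (auto simp: bil_diff_kernel bil_scalar[OF assms(1)] sym)
  ultimately have "0 \<le> (\<Sum>u\<in>S. \<Sum>v\<in>S. (?I l u v + K u v) * (?I m u v - K u v))"
    by (intro psd_sum_nonneg Schur_product assms(1))
  also have "\<dots> = (\<Sum>u\<in>S. \<Sum>v\<in>S. ?I (l * m) u v + ?I ((m - l) * K u u) u v - (K u v)\<^sup>2)"
    by (intro sum.cong refl) (auto simp: algebra_simps power2_eq_square)
  also have "\<dots> = l * m * card S + (m - l) * (\<Sum>u\<in>S. K u u) - frob S K"
    using assms(1) by (simp add: sum.distrib sum_subtractf frob_def sum_distrib_left)
  also have "(m - l) * (\<Sum>u\<in>S. K u u) \<le> 0"
    using \<open>l \<le> m\<close> tr by (simp add: mult_nonneg_nonpos)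
  finally show ?thesis by simp
qed

text \<open>Projecting out one of the \<open>R\<close> vectors lowers the rank by one and the two traces by the values
  of the quadratic forms at the corresponding unit vector.\<close>

lemma trace_low_rank_le:
  assumes "finite S" and "psd S Y" and "0 \<le> c"
    and "psd S (\<lambda>u v. Y u v + (if u = v then c else 0) - (\<Sum>i<R. \<phi> i u * \<phi> i v))"
  shows "(\<Sum>u\<in>S. \<Sum>i<R. (\<phi> i u)\<^sup>2) \<le> (\<Sum>u\<in>S. Y u u) + c * real R"
  using assms(2,4)
proof (induction R arbitrary: Y \<phi>)
  case 0
  then show ?case using psd_diag_nonneg[OF 0(1) assms(1)] by (simp add: sum_nonneg)
next
  case (Suc R)
  define n where "n = sqrt (nsq S (\<phi> R))"
  define e where "e = (\<lambda>u. \<phi> R u / n)"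
  define pr where "pr = (\<lambda>x u. x u - (\<Sum>v\<in>S. e v * x v) * e u)"
  have n2: "n * n = nsq S (\<phi> R)" by (simp add: n_def nsq_nonneg)
  \<comment> \<open>If \<open>\<phi> R\<close> is zero on \<open>S\<close>, division by zero makes
    \<open>e\<close> vanish and \<open>pr\<close> is the identity. The factor
    \<open>2 - nsq S e\<close> in the trace and norm formulas covers both cases.\<close>
  have ne: "nsq S e = (if n = 0 then 0 else 1)"
  proof -
    have "nsq S e = nsq S (\<phi> R) / (n * n)"
      by (simp add: nsq_def e_def power_divide sum_divide_distrib power2_eq_square)
    then show ?thesis using n2 by (auto split: if_splits)
  qed
  have \<phi>R: "\<phi> R u = n * e u" if "u \<in> S" for u
  proof (cases "n = 0")
    case True
    then have "nsq S (\<phi> R) = 0" using n2 by simp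
    then show ?thesis using that assms(1) True by (simp add: nsq_def sum_nonneg_eq_0_iff)
  qed (simp add: e_def)
  have ee: "(\<Sum>u\<in>S. e u * e u) = nsq S e" by (simp add: nsq_def power2_eq_square)
  define proj where "proj = (\<lambda>K u v. K u v - e u * (\<Sum>a\<in>S. e a * K a v) - (\<Sum>b\<in>S. K u b * e b) * e v
      + bil S K e e * (e u * e v))"
  have bil_proj: "bil S (proj K) x x = bil S K (pr x) (pr x)" for K x
  proof -
    define t where "t = (\<Sum>v\<in>S. e v * x v)"
    have "bil S (proj K) x x = bil S K x x - t * bil S K e x - bil S K x e * t + bil S K e e * (t * t)"
    proof -
      have 1: "bil S (\<lambda>u v. e u * (\<Sum>a\<in>S. e a * K a v)) x x = t * bil S K e x"
      proof -
        have "(\<Sum>v\<in>S. (\<Sum>a\<in>S. e a * K a v) * x v) = bil S K e x"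
          unfolding bil_def by (simp add: sum_distrib_right) (rule sum.swap)
        then show ?thesis by (simp add: bil_rank_one t_def mult.commute)
      qed
      have 2: "bil S (\<lambda>u v. (\<Sum>b\<in>S. K u b * e b) * e v) x x = bil S K x e * t"
        by (simp add: bil_rank_one t_def bil_rowsum[of S K x e])
      have 3: "bil S (\<lambda>u v. bil S K e e * (e u * e v)) x x = bil S K e e * (t * t)"
        unfolding bil_scale_kernel bil_rank_one t_def by (simp add: mult.commute)
      show ?thesis unfolding proj_def by (simp only: bil_add_kernel bil_diff_kernel 1 2 3)
    qed
    moreover have "pr x = (\<lambda>u. x u - t * e u)" by (simp add: pr_def t_def)
    ultimately show ?thesis by (simp add: bil_linear)
  qed
  have proj_sym: "proj K u v = proj K v u"
    if "\<And>u v. u \<in> S \<Longrightarrow> v \<in> S \<Longrightarrow> K u v = K v u" "u \<in> S" "v \<in> S" for K u v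
  proof -
    have "(\<Sum>a\<in>S. e a * K a v) = (\<Sum>b\<in>S. K v b * e b)" if "v \<in> S" for v
      by (intro sum.cong refl) (simp add: mult.commute \<open>\<And>u v. u \<in> S \<Longrightarrow> v \<in> S \<Longrightarrow> K u v = K v u\<close> that)
    then show ?thesis using that by (simp add: proj_def algebra_simps)
  qed
  have trace_proj: "(\<Sum>u\<in>S. proj K u u) = (\<Sum>u\<in>S. K u u) - (2 - nsq S e) * bil S K e e" for K
  proof -
    have "(\<Sum>u\<in>S. e u * (\<Sum>a\<in>S. e a * K a u)) = bil S K e e"
      unfolding bil_def by (subst sum.swap) (simp add: sum_distrib_left mult_ac)
    moreover have "(\<Sum>u\<in>S. (\<Sum>b\<in>S. K u b * e b) * e u) = bil S K e e"
      by (simp add: bil_rowsum mult.commute)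
    moreover have "(\<Sum>u\<in>S. bil S K e e * (e u * e u)) = bil S K e e * nsq S e"
      unfolding ee[symmetric] sum_distrib_left ..
    ultimately show ?thesis
      unfolding proj_def by (simp add: sum.distrib sum_subtractf algebra_simps)
  qed
  define X where "X = (\<lambda>u v. \<Sum>i<Suc R. \<phi> i u * \<phi> i v)"
  define \<psi> where "\<psi> = (\<lambda>i. pr (\<phi> i))"
  have sq: "bil S (\<lambda>u v. \<Sum>i<m. f i u * f i v) y y = (\<Sum>i<m. (\<Sum>u\<in>S. y u * f i u)\<^sup>2)"
    for m and f :: "nat \<Rightarrow> 'a \<Rightarrow> real" and y
    by (rule bil_gram)
  have projX: "bil S (\<lambda>u v. \<Sum>i<R. \<psi> i u * \<psi> i v) x x = bil S X (pr x) (pr x)" for x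
  proof -
    have pr_adj: "(\<Sum>u\<in>S. x u * pr f u) = (\<Sum>u\<in>S. pr x u * f u)" for f
    proof -
      have "(\<Sum>u\<in>S. x u * pr f u) = (\<Sum>u\<in>S. x u * f u - (\<Sum>v\<in>S. e v * f v) * (e u * x u))"
        by (intro sum.cong refl) (simp add: pr_def algebra_simps)
      also have "\<dots> = (\<Sum>u\<in>S. x u * f u) - (\<Sum>v\<in>S. e v * f v) * (\<Sum>u\<in>S. e u * x u)"
        by (simp only: sum_subtractf sum_distrib_left)
      also have "\<dots> = (\<Sum>u\<in>S. x u * f u) - (\<Sum>v\<in>S. e v * x v) * (\<Sum>u\<in>S. e u * f u)" by simp
      also have "\<dots> = (\<Sum>u\<in>S. x u * f u - (\<Sum>v\<in>S. e v * x v) * (e u * f u))"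
        by (simp only: sum_subtractf sum_distrib_left)
      also have "\<dots> = (\<Sum>u\<in>S. pr x u * f u)"
        by (intro sum.cong refl) (simp add: pr_def algebra_simps)
      finally show ?thesis .
    qed
    \<comment> \<open>\<open>\<phi> R\<close> is a multiple of \<open>e\<close>, so the projected
      Gram kernel is built from \<open>R\<close> vectors instead of \<open>Suc R\<close>.\<close>
    have last: "(\<Sum>u\<in>S. pr x u * \<phi> R u) = 0"
    proof -
      have "(\<Sum>u\<in>S. pr x u * \<phi> R u) = n * (\<Sum>u\<in>S. pr x u * e u)"
        by (simp add: \<phi>R sum_distrib_left mult_ac)
      also have "(\<Sum>u\<in>S. pr x u * e u) = (\<Sum>v\<in>S. e v * x v) * (1 - nsq S e)"
        by (simp add: pr_def left_diff_distrib right_diff_distrib sum_subtractf mult.assoc ee mult.commute[of "x _"]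
          flip: sum_distrib_left)
      finally show ?thesis using ne by (auto split: if_splits)
    qed
    show ?thesis unfolding X_def sq \<psi>_def pr_adj using last by simp
  qed
  have nsq_pr: "nsq S (pr x) = nsq S x - (2 - nsq S e) * (\<Sum>u\<in>S. e u * x u)\<^sup>2" for x
  proof -
    define t where "t = (\<Sum>u\<in>S. e u * x u)"
    have "nsq S (pr x) = (\<Sum>u\<in>S. (x u)\<^sup>2 - 2 * t * (e u * x u) + t\<^sup>2 * (e u * e u))"
      unfolding nsq_def pr_def t_def by (intro sum.cong refl) (simp add: power2_eq_square algebra_simps)
    also have "\<dots> = nsq S x - 2 * t * t + t\<^sup>2 * nsq S e"
      unfolding sum.distrib sum_subtractf sum_distrib_left[symmetric] ee t_def[symmetric]
      by (simp add: nsq_def)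
    finally show ?thesis by (simp add: t_def power2_eq_square algebra_simps)
  qed
  have trX: "(\<Sum>i<Suc R. nsq S (\<phi> i)) = (\<Sum>i<R. nsq S (\<psi> i)) + (2 - nsq S e) * bil S X e e"
  proof -
    have "bil S X e e = (\<Sum>i<Suc R. (\<Sum>u\<in>S. e u * \<phi> i u)\<^sup>2)"
      unfolding X_def by (rule sq)
    moreover have "nsq S (\<phi> R) = (2 - nsq S e) * (\<Sum>u\<in>S. e u * \<phi> R u)\<^sup>2"
    proof -
      have "(\<Sum>u\<in>S. e u * \<phi> R u) = (\<Sum>u\<in>S. n * (e u * e u))"
        by (intro sum.cong refl) (simp add: \<phi>R)
      also have "\<dots> = n * nsq S e" by (simp only: ee flip: sum_distrib_left)
      finally show ?thesis using ne n2 by (auto simp: power2_eq_square split: if_splits)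
    qed
    ultimately show ?thesis
      by (simp add: \<psi>_def nsq_pr sum_subtractf sum_distrib_left distrib_left)
  qed
  have ee01: "0 \<le> 2 - nsq S e" "(2 - nsq S e) * nsq S e \<le> 1" using ne by (auto split: if_splits)
  have psdZ: "0 \<le> bil S Y x x + c * nsq S x - bil S X x x" for x
    using psd_nonneg[OF Suc.prems(2), of x]
    by (simp only: X_def bil_diff_kernel bil_add_kernel bil_scalar[OF assms(1)])
  have psd_projY: "psd S (proj Y)"
    using psd_nonneg[OF Suc.prems(1)] proj_sym[of Y] psd_sym[OF Suc.prems(1)]
    by (intro psdI) (auto simp: bil_proj)
  have "psd S (\<lambda>u v. proj Y u v + (if u = v then c else 0) - (\<Sum>i<R. \<psi> i u * \<psi> i v))"
  proof (rule psdI)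
    fix x
    have "0 \<le> bil S Y (pr x) (pr x) + c * nsq S (pr x) - bil S X (pr x) (pr x)" by (rule psdZ)
    also have "\<dots> \<le> bil S Y (pr x) (pr x) + c * nsq S x - bil S X (pr x) (pr x)"
      using assms(3) ee01(1) by (simp add: nsq_pr mult_left_mono)
    finally show "0 \<le> bil S (\<lambda>u v. proj Y u v + (if u = v then c else 0) - (\<Sum>i<R. \<psi> i u * \<psi> i v)) x x"
      by (simp only: bil_diff_kernel bil_add_kernel bil_scalar[OF assms(1)] bil_proj projX)
  qed (use psd_sym[OF psd_projY] in \<open>auto simp: mult.commute\<close>)
  from Suc.IH[OF psd_projY this]
  have "(\<Sum>i<R. nsq S (\<psi> i)) \<le> (\<Sum>u\<in>S. Y u u) - (2 - nsq S e) * bil S Y e e + c * real R"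
    unfolding trace_proj nsq_def by (subst sum.swap)
  moreover have "(2 - nsq S e) * bil S X e e \<le> (2 - nsq S e) * (bil S Y e e + c * nsq S e)"
    using psdZ[of e] ee01(1) by (intro mult_left_mono) auto
  moreover have "(2 - nsq S e) * (c * nsq S e) \<le> c"
    using mult_left_mono[OF ee01(2) assms(3)] by (simp add: mult_ac)
  ultimately have "(\<Sum>i<Suc R. nsq S (\<phi> i)) \<le> (\<Sum>u\<in>S. Y u u) + c * real (Suc R)"
    unfolding trX by (simp add: algebra_simps)
  then show ?case unfolding nsq_def by (subst sum.swap)
qed

section \<open>Low-rank kernels below the shifted adjacency matrix\<close>

text \<open>The pointwise products of the vectors \<open>f i\<close> and \<open>g j\<close> generate
  the Hadamard product, so ranks multiply. A bijection flattens the pairs \<open>(i, j)\<close> to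
  keep the vectors indexed by an initial segment of the naturals.\<close>

lemma gram_mult:
  fixes f g :: "nat \<Rightarrow> 'a \<Rightarrow> real"
  obtains h :: "nat \<Rightarrow> 'a \<Rightarrow> real"
  where "\<And>u v. (\<Sum>i<a. f i u * f i v) * (\<Sum>j<b. g j u * g j v) = (\<Sum>m<a * b. h m u * h m v)"
proof -
  let ?M = "{..<a} \<times> {..<b}"
  obtain p where p: "bij_betw p {0..<card ?M} ?M"
    using ex_bij_betw_nat_finite[of ?M] by auto
  then have p: "bij_betw p {..<a * b} ?M"
    by (simp add: card_cartesian_product lessThan_atLeast0)
  show thesis
  proof (rule that[of "\<lambda>m u. f (fst (p m)) u * g (snd (p m)) u"])
    fix u v
    have "(\<Sum>i<a. f i u * f i v) * (\<Sum>j<b. g j u * g j v) =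
        (\<Sum>q\<in>?M. (f (fst q) u * g (snd q) u) * (f (fst q) v * g (snd q) v))"
      by (simp add: sum_product sum.cartesian_product mult_ac split_def)
    also have "\<dots> = (\<Sum>m<a * b. (f (fst (p m)) u * g (snd (p m)) u) * (f (fst (p m)) v * g (snd (p m)) v))"
      by (rule sum.reindex_bij_betw[OF p, symmetric])
    finally show "(\<Sum>i<a. f i u * f i v) * (\<Sum>j<b. g j u * g j v) =
      (\<Sum>m<a * b. (f (fst (p m)) u * g (snd (p m)) u) * (f (fst (p m)) v * g (snd (p m)) v))" .
  qed
qed

lemma gram_power:
  fixes f :: "nat \<Rightarrow> 'a \<Rightarrow> real"
  obtains h :: "nat \<Rightarrow> 'a \<Rightarrow> real"
  where "\<And>u v. (\<Sum>i<r. f i u * f i v) ^ k = (\<Sum>m<r ^ k. h m u * h m v)"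
proof -
  have "\<exists>h :: nat \<Rightarrow> 'a \<Rightarrow> real. \<forall>u v. (\<Sum>i<r. f i u * f i v) ^ k = (\<Sum>m<r ^ k. h m u * h m v)"
  proof (induction k)
    case 0
    show ?case by (rule exI[of _ "\<lambda>_ _. 1"]) simp
  next
    case (Suc k)
    then obtain h :: "nat \<Rightarrow> 'a \<Rightarrow> real"
      where h: "\<And>u v. (\<Sum>i<r. f i u * f i v) ^ k = (\<Sum>m<r ^ k. h m u * h m v)" by blast
    obtain h' :: "nat \<Rightarrow> 'a \<Rightarrow> real" where
      "\<And>u v. (\<Sum>i<r. f i u * f i v) * (\<Sum>m<r ^ k. h m u * h m v) = (\<Sum>m<r * r ^ k. h' m u * h' m v)"
      using gram_mult[where f = f and g = h and a = r and b = "r ^ k"] by blast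
    then show ?case by (intro exI[of _ h']) (simp add: h)
  qed
  then show thesis using that by blast
qed

section \<open>Hadamard powers and large diagonal entries\<close>

text \<open>The smallest eigenvalue enters only through \<open>psd_shift\<close>. The bound
  \<open>l_ge_1\<close> lets lower powers of \<open>l\<close> be absorbed into higher ones.\<close>

locale graph_with_shift =
  fixes V :: "'a set" and adj :: "'a \<Rightarrow> 'a \<Rightarrow> bool" and l :: real
  assumes finite_V: "finite V"
    and adj_sym: "adj u v \<Longrightarrow> adj v u"
    and adj_irrefl: "\<not> adj u u"
    and l_ge_1: "1 \<le> l"
    and psd_shift: "psd V (\<lambda>u v. of_bool (adj u v) + (if u = v then l else 0))"
begin

definition A :: "'a \<Rightarrow> 'a \<Rightarrow> real" where "A u v = of_bool (adj u v)"

definition M :: "'a \<Rightarrow> 'a \<Rightarrow> real" where "M u v = A u v + (if u = v then l else 0)"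

lemma finite_subset_V: "S \<subseteq> V \<Longrightarrow> finite S"
  using finite_V finite_subset by blast

lemma adj_commute: "adj u v \<longleftrightarrow> adj v u"
  using adj_sym by blast

lemma A_commute: "A u v = A v u"
  by (simp add: A_def adj_commute)

lemma M_commute: "M u v = M v u"
  by (simp add: M_def A_commute)

lemma A_diag [simp]: "A u u = 0"
  by (simp add: A_def adj_irrefl)

lemma A_nonneg [simp]: "0 \<le> A u v" and A_le_1 [simp]: "A u v \<le> 1"
  by (simp_all add: A_def)

lemma A_idem [simp]: "A u v * A u v = A u v"
  by (simp add: A_def)

lemma psd_M: "S \<subseteq> V \<Longrightarrow> psd S M"
  using psd_subset[OF psd_shift finite_V] unfolding M_def A_def .

lemma low_A: "S \<subseteq> V \<Longrightarrow> - l * nsq S x \<le> bil S A x x"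
proof -
  assume S: "S \<subseteq> V"
  have "0 \<le> bil S M x x" using psd_M[OF S] psd_nonneg by blast
  also have "bil S M x x = bil S A x x + l * nsq S x"
    unfolding M_def by (simp add: bil_add_kernel bil_scalar finite_subset_V[OF S])
  finally show ?thesis by simp
qed

text \<open>Off the diagonal \<open>M\<close> is idempotent under the entrywise product. Positivity
  of the Hadamard product of \<open>B^k\<close>, \<open>M\<close> and \<open>M - B\<close> therefore
  says that \<open>B^(k+1) * A\<close> is dominated by \<open>B^k * A\<close> up to a diagonal, and
  iteration leads down to \<open>A\<close>. Since the diagonal of \<open>B\<close> is at least 1,
  the diagonal errors can be collected in one term linear in the exponent.\<close>

lemma Hadamard_power_le:
  assumes U: "U \<subseteq> V" and B: "psd U B" and le: "psd U (\<lambda>u v. M u v - B u v)"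
    and b1: "\<And>u. u \<in> U \<Longrightarrow> 1 \<le> B u u"
  shows "psd U (\<lambda>u v. M u v + (if u = v then real (Suc m) * l\<^sup>2 * B u u ^ m else 0) - B u v ^ Suc m)"
proof -
  have fin: "finite U" using U finite_subset_V by blast
  let ?d = "\<lambda>f u v. (if u = v then f u else (0::real))"
  note psdM = psd_M[OF U]
  have step: "psd U (\<lambda>u v. A u v + ?d (\<lambda>u. real k * l\<^sup>2 * B u u ^ k) u v - B u v ^ k * A u v)" for k
  proof (induction k)
    case 0
    then show ?case by (simp add: psd_def bil_def cong: if_cong)
  next
    case (Suc k)
    have 1: "psd U (\<lambda>u v. B u v ^ k * (M u v * (M u v - B u v)))"
      by (intro Schur_product fin psd_power B psdM le)
    \<comment> \<open>The Schur product contributes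
      \<open>l\<^sup>2 * B u u ^ k - l * B u u ^ Suc k\<close> on the diagonal; this nonnegative
      kernel fills the sum up to \<open>Suc k * l\<^sup>2 * B u u ^ Suc k\<close>.\<close>
    have 2: "psd U (\<lambda>u v. ?d (\<lambda>u. l * B u u ^ Suc k + real (Suc k) * l\<^sup>2 * (B u u ^ Suc k - B u u ^ k)) u v)"
    proof (intro psd_diag fin add_nonneg_nonneg mult_nonneg_nonneg)
      fix u assume u: "u \<in> U"
      show "0 \<le> B u u ^ Suc k" using b1[OF u] by simp
      show "0 \<le> B u u ^ Suc k - B u u ^ k"
        using power_increasing[of k "Suc k" "B u u"] b1[OF u] by simp
    qed (use l_ge_1 in auto)
    have "psd U (\<lambda>u v. (A u v + ?d (\<lambda>u. real k * l\<^sup>2 * B u u ^ k) u v - B u v ^ k * A u v) +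
        (B u v ^ k * (M u v * (M u v - B u v)) +
         ?d (\<lambda>u. l * B u u ^ Suc k + real (Suc k) * l\<^sup>2 * (B u u ^ Suc k - B u u ^ k)) u v))"
      by (intro psd_add Suc 1 2)
    then show ?case
    proof (rule psd_cong[THEN iffD1, rotated])
      fix u v assume "u \<in> U" "v \<in> U"
      show "A u v + ?d (\<lambda>u. real k * l\<^sup>2 * B u u ^ k) u v - B u v ^ k * A u v +
        (B u v ^ k * (M u v * (M u v - B u v)) +
         ?d (\<lambda>u. l * B u u ^ Suc k + real (Suc k) * l\<^sup>2 * (B u u ^ Suc k - B u u ^ k)) u v) =
        A u v + ?d (\<lambda>u. real (Suc k) * l\<^sup>2 * B u u ^ Suc k) u v - B u v ^ Suc k * A u v"
        by (cases "u = v"; cases "adj u v")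
           (simp_all add: M_def A_def adj_irrefl algebra_simps power2_eq_square)
    qed
  qed
  have 1: "psd U (\<lambda>u v. B u v ^ m * (M u v - B u v))"
    by (intro Schur_product fin psd_power B le)
  have 2: "psd U (\<lambda>u v. ?d (\<lambda>u. l + (l\<^sup>2 - l) * B u u ^ m) u v)"
  proof (intro psd_diag fin add_nonneg_nonneg mult_nonneg_nonneg)
    fix u assume u: "u \<in> U"
    show "0 \<le> B u u ^ m" using b1[OF u] by simp
    show "0 \<le> l\<^sup>2 - l" using l_ge_1 by (simp add: power2_eq_square)
  qed (use l_ge_1 in auto)
  have "psd U (\<lambda>u v. (A u v + ?d (\<lambda>u. real m * l\<^sup>2 * B u u ^ m) u v - B u v ^ m * A u v) +
      (B u v ^ m * (M u v - B u v) + ?d (\<lambda>u. l + (l\<^sup>2 - l) * B u u ^ m) u v))"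
    by (intro psd_add step 1 2)
  then show ?thesis
    by (rule psd_cong[THEN iffD1, rotated]) (simp add: M_def algebra_simps)
qed

text \<open>The Hadamard power \<open>B\<^sup>k\<close>, of rank at most \<open>r\<^sup>k\<close>, is dominated by \<open>M\<close> up to a diagonal; after
  normalising this diagonal the trace on the left is the sum of the large diagonal entries.\<close>

lemma large_diagonal_sum_le:
  fixes \<phi> :: "nat \<Rightarrow> 'a \<Rightarrow> real"
  assumes S: "S \<subseteq> V"
    and le: "psd S (\<lambda>u v. M u v - (\<Sum>i<r. \<phi> i u * \<phi> i v))"
    and s: "1 \<le> s" and k: "1 \<le> k" and sk: "2 * l \<le> s ^ k"
  defines "b \<equiv> \<lambda>u. \<Sum>i<r. (\<phi> i u)\<^sup>2"
  shows "(\<Sum>u | u \<in> S \<and> s < b u. b u) \<le> 2 * real k * l\<^sup>2 * real r ^ k"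
proof -
  define U where "U = {u \<in> S. s < b u}"
  define B where "B = (\<lambda>u v. \<Sum>i<r. \<phi> i u * \<phi> i v)"
  have bB: "B u u = b u" for u by (simp add: B_def b_def power2_eq_square)
  have US: "U \<subseteq> S" and UV: "U \<subseteq> V" using S by (auto simp: U_def)
  have fin: "finite U" using UV finite_subset_V by blast
  have bU: "s < b u" if "u \<in> U" for u using that by (simp add: U_def)
  obtain m where m: "k = Suc m" using k by (cases k) auto
  have psdB: "psd U B" unfolding B_def by (intro psd_sum psd_rank_one)
  have leU: "psd U (\<lambda>u v. M u v - B u v)"
    using psd_subset[OF le finite_subset_V[OF S] US] by (simp add: B_def)
  have main: "psd U (\<lambda>u v. M u v + (if u = v then real (Suc m) * l\<^sup>2 * B u u ^ m else 0) - B u v ^ Suc m)"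
    by (rule Hadamard_power_le[OF UV psdB leU]) (use bU s in \<open>force simp: bB\<close>)
  \<comment> \<open>Conjugation by \<open>f\<close>, the power \<open>-m/2\<close> of
    \<open>b\<close>, turns the diagonal correction into the constant \<open>k * l\<^sup>2\<close>,
    as \<open>trace_low_rank_le\<close> demands, and the diagonal of the Hadamard power into
    \<open>b\<close>.\<close>
  define f where "f = (\<lambda>u. (1 / sqrt (b u)) ^ m)"
  have ff: "f u * f u = 1 / b u ^ m" if "u \<in> U" for u
  proof -
    have "(1 / sqrt (b u)) * (1 / sqrt (b u)) = 1 / b u" using bU[OF that] s by simp
    then show ?thesis unfolding f_def by (metis power_mult_distrib power_one_over)
  qed
  obtain h :: "nat \<Rightarrow> 'a \<Rightarrow> real" where h: "\<And>u v. B u v ^ k = (\<Sum>i<r ^ k. h i u * h i v)"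
    using gram_power[where f = \<phi> and r = r and k = k] unfolding B_def by blast
  have "psd U (\<lambda>u v. f u * (M u v + (if u = v then real (Suc m) * l\<^sup>2 * B u u ^ m else 0) - B u v ^ Suc m) * f v)"
    by (rule psd_conj[OF main])
  then have psd2: "psd U (\<lambda>u v. f u * M u v * f v + (if u = v then real k * l\<^sup>2 else 0)
      - (\<Sum>i<r ^ k. (f u * h i u) * (f v * h i v)))"
  proof (rule psd_cong[THEN iffD1, rotated])
    fix u v assume u: "u \<in> U"
    have 1: "(\<Sum>i<r ^ k. (f u * h i u) * (f v * h i v)) = f u * B u v ^ k * f v"
      by (simp add: h sum_distrib_left sum_distrib_right mult_ac)
    have 2: "f u * B u u ^ m * f u = 1"
    proof -
      have "f u * B u u ^ m * f u = (f u * f u) * b u ^ m" by (simp add: bB mult_ac)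
      also have "\<dots> = 1" using bU[OF u] s by (simp add: ff[OF u])
      finally show ?thesis .
    qed
    have "f u * (real (Suc m) * l\<^sup>2 * B u u ^ m) * f u = real (Suc m) * l\<^sup>2 * (f u * B u u ^ m * f u)"
      by (simp only: mult_ac)
    then have "f u * (real (Suc m) * l\<^sup>2 * B u u ^ m) * f u = real k * l\<^sup>2"
      by (simp add: 2 m)
    then show "f u * (M u v + (if u = v then real (Suc m) * l\<^sup>2 * B u u ^ m else 0) - B u v ^ Suc m) * f v =
      f u * M u v * f v + (if u = v then real k * l\<^sup>2 else 0) - (\<Sum>i<r ^ k. (f u * h i u) * (f v * h i v))"
      unfolding 1 m[symmetric] by (cases "u = v") (simp_all add: distrib_left distrib_right left_diff_distrib right_diff_distrib)
  qed
  have "(\<Sum>u\<in>U. \<Sum>i<r ^ k. (f u * h i u)\<^sup>2) \<le> (\<Sum>u\<in>U. f u * M u u * f u) + real k * l\<^sup>2 * real (r ^ k)"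
    by (rule trace_low_rank_le[OF fin psd_conj[OF psd_M[OF UV]] _ psd2]) simp
  moreover have "(\<Sum>i<r ^ k. (f u * h i u)\<^sup>2) = b u" if u: "u \<in> U" for u
  proof -
    have "(\<Sum>i<r ^ k. (f u * h i u)\<^sup>2) = f u * f u * B u u ^ k"
      by (simp add: h sum_distrib_left power2_eq_square mult_ac)
    also have "\<dots> = b u" using bU[OF u] s by (simp add: ff[OF u] m bB)
    finally show ?thesis .
  qed
  \<comment> \<open>Here \<open>2 * l \<le> s ^ k\<close> makes the trace of the rescaled
    \<open>M\<close> at most half of the left-hand side, into which it is absorbed.\<close>
  moreover have "f u * M u u * f u \<le> b u / 2" if u: "u \<in> U" for u
  proof -
    have b0: "0 < b u" using bU[OF u] s by simp
    have "s ^ k \<le> b u ^ k" using bU[OF u] s by (intro power_mono) auto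
    then have "2 * l \<le> b u ^ k" using sk by simp
    then have "2 * l \<le> b u * b u ^ m" by (simp add: m)
    then have "l / b u ^ m \<le> b u / 2" using b0 by (simp add: field_simps)
    moreover have "f u * M u u * f u = (f u * f u) * l" by (simp add: M_def mult_ac)
    ultimately show ?thesis by (simp add: ff[OF u])
  qed
  then have "(\<Sum>u\<in>U. f u * M u u * f u) \<le> (\<Sum>u\<in>U. b u / 2)" by (rule sum_mono)
  ultimately have "(\<Sum>u\<in>U. b u) \<le> (\<Sum>u\<in>U. b u) / 2 + real k * l\<^sup>2 * real (r ^ k)"
    by (simp add: sum_divide_distrib)
  then show ?thesis by (simp add: U_def)
qed

end

section \<open>Eigenvalue decay and low-rank approximation\<close>

text \<open>Comparison with the integral of \<open>x^(-3/2)\<close>, whose antiderivative is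
  \<open>-2 / sqrt x\<close>, in telescoping form. The step rests on
  \<open>(y - x) * (y + x) = 1\<close> for consecutive square roots.\<close>

lemma sum_inverse_three_halves_le:
  fixes m n :: nat
  assumes "1 \<le> m" "m \<le> n"
  shows "(\<Sum>i=m..<n. 1 / (real (Suc i) * sqrt (real (Suc i)))) \<le> 2 / sqrt (real m) - 2 / sqrt (real n)"
  using assms(2)
proof (induction n rule: dec_induct)
  case base
  then show ?case by simp
next
  case (step n)
  define x y where "x = sqrt (real n)" and "y = sqrt (real (Suc n))"
  have pos: "0 < x" "x \<le> y" using step assms by (auto simp: x_def y_def)
  have y2: "real (Suc n) = y * y" by (simp add: y_def)
  have yx: "(y - x) * (y + x) = 1" by (simp add: x_def y_def algebra_simps)
  have "1 / (y * y * y) \<le> 2 / x - 2 / y"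
  proof -
    have "x \<le> 2 * (y - x) * y * y"
    proof -
      have "1 \<le> (y - x) * (2 * y)" 
        using yx pos mult_left_mono[of "y + x" "2 * y" "y - x"] by simp
      then have "y * 1 \<le> y * ((y - x) * (2 * y))" using pos by (intro mult_left_mono) auto
      then have "x \<le> y * ((y - x) * (2 * y))" using pos by linarith
      also have "\<dots> = 2 * (y - x) * y * y" by (simp only: mult_ac)
      finally show ?thesis .
    qed
    then show ?thesis using pos by (simp add: field_simps)
  qed
  then show ?case using step by (simp add: y2 x_def y_def)
qed

context graph_with_shift
begin

text \<open>Ordered pairs are summed, so this is twice the number of edges, and dividing by the
  square of the cardinality gives the density.\<close>

definition ec :: "'a set \<Rightarrow> real" where "ec X = (\<Sum>u\<in>X. \<Sum>v\<in>X. A u v)"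

definition deg :: "'a set \<Rightarrow> 'a \<Rightarrow> real" where "deg S v = (\<Sum>w\<in>S. A v w)"

lemma deg_nonneg: "0 \<le> deg S v"
  by (simp add: deg_def sum_nonneg)

lemma deg_le_card: "deg S v \<le> card S"
proof -
  have "deg S v \<le> (\<Sum>w\<in>S. 1)" unfolding deg_def by (rule sum_mono) simp
  then show ?thesis by simp
qed

lemma ec_eq_sum_deg: "ec S = (\<Sum>v\<in>S. deg S v)"
  by (simp add: ec_def deg_def)

lemma ec_nonneg: "0 \<le> ec S"
  by (simp add: ec_eq_sum_deg sum_nonneg deg_nonneg)

lemma ec_le_card_sq: "ec S \<le> (real (card S))\<^sup>2"
proof -
  have "ec S \<le> (\<Sum>v\<in>S. real (card S))" unfolding ec_eq_sum_deg by (rule sum_mono) (rule deg_le_card)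
  then show ?thesis by (simp add: power2_eq_square)
qed

lemma deg_eq_card: "finite S \<Longrightarrow> deg S v = card {w \<in> S. adj v w}"
  by (simp add: deg_def A_def of_bool_def sum.If_cases Int_def)

text \<open>The exponent \<open>k\<close> is about \<open>ln N / (2 * ln r)\<close>: then
  \<open>r ^ k \<le> N powr (1/2)\<close>, while
  \<open>(r powr t) ^ k \<ge> N powr (t/4) \<ge> 2 * l\<close>.\<close>

lemma large_diagonal_sum_le_powr:
  fixes \<phi> :: "nat \<Rightarrow> 'a \<Rightarrow> real"
  assumes S: "S \<subseteq> V"
    and le: "psd S (\<lambda>u v. M u v - (\<Sum>i<r. \<phi> i u * \<phi> i v))"
    and r: "2 \<le> r" "real r \<le> N powr (1/4)" and "0 < t"
    and N1: "1 \<le> N" and l1: "2 * l \<le> N powr (t/4)"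
    and l2: "2 * ln N * l\<^sup>2 * N powr (1/2) \<le> N powr (3/4)"
  defines "b \<equiv> \<lambda>u. \<Sum>i<r. (\<phi> i u)\<^sup>2"
  shows "(\<Sum>u | u \<in> S \<and> real r powr t < b u. b u) \<le> N powr (3/4)"
proof -
  have Npos: "0 < N" using N1 by simp
  have lnr: "ln (real r) \<ge> 1/2" 
  proof -
    have "ln (2::real) \<le> ln (real r)" using r by simp
    then show ?thesis using ln2_ge_two_thirds by simp
  qed
  have "ln (real r) \<le> ln (N powr (1/4))" using r Npos by (intro ln_mono) auto
  moreover have "ln (N powr (1/4)) = ln N / 4" using Npos by (simp add: ln_powr)
  ultimately have lnN: "4 * ln (real r) \<le> ln N" by linarith
  define q where "q = ln N / (2 * ln (real r))"
  define k where "k = nat \<lfloor>q\<rfloor>"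
  have q2: "2 \<le> q" using lnN lnr by (simp add: q_def field_simps)
  then have kq: "real k \<le> q" "q - 1 \<le> real k" by (auto simp: k_def)
  have k1: "1 \<le> k" using kq q2 by linarith
  have qr: "q * ln (real r) = ln N / 2" using lnr by (simp add: q_def)
  have kr1: "real k * ln (real r) \<le> ln N / 2"
    using mult_right_mono[OF kq(1), of "ln (real r)"] lnr qr by simp
  have kr2: "ln N / 4 \<le> real k * ln (real r)"
  proof -
    have "q / 2 \<le> real k" using kq q2 by linarith
    from mult_right_mono[OF this, of "ln (real r)"] show ?thesis using lnr qr by simp
  qed
  have "N powr (t/4) = exp (t * (ln N / 4))" using Npos by (simp add: powr_def)
  also have "\<dots> \<le> exp (t * (real k * ln (real r)))" using kr2 \<open>0 < t\<close> by simp
  also have "\<dots> = (real r powr t) ^ k" using r by (simp add: powr_def exp_of_nat_mult[symmetric] mult_ac)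
  finally have sk: "2 * l \<le> (real r powr t) ^ k" using l1 by simp
  have rk: "real r ^ k \<le> N powr (1/2)"
  proof -
    have "real r ^ k = exp (real k * ln (real r))" using r by (simp add: exp_of_nat_mult)
    also have "\<dots> \<le> exp (ln N / 2)" using kr1 by simp
    also have "\<dots> = N powr (1/2)" using Npos by (simp add: powr_def)
    finally show ?thesis .
  qed
  have kln: "real k \<le> ln N"
  proof -
    have "real k * (1/2) \<le> real k * ln (real r)" using lnr by (intro mult_left_mono) auto
    then show ?thesis using kr1 by simp
  qed
  have "1 \<le> real r powr t" using r \<open>0 < t\<close> by (intro ge_one_powr_ge_zero) auto
  then have "(\<Sum>u | u \<in> S \<and> real r powr t < b u. b u) \<le> 2 * real k * l\<^sup>2 * real r ^ k"
    unfolding b_def by (intro large_diagonal_sum_le[OF S le _ k1 sk]) simp_all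
  also have "\<dots> \<le> 2 * ln N * l\<^sup>2 * N powr (1/2)"
    using kln rk by (intro mult_mono) auto
  finally show ?thesis using l2 by simp
qed

text \<open>With \<open>m\<close> spectral terms most diagonal entries of \<open>B\<close> are at
  most \<open>m powr t\<close>, so the trace, which is the sum of the first \<open>m\<close>
  eigenvalues, is at most \<open>2 * N * m powr (1/4)\<close>. Hence the eigenvalues decay like
  \<open>i powr (-3/4)\<close>, fast enough for their squares to be summable. This controls the
  indices from \<open>r\<close> up to \<open>N powr (1/4)\<close>;
  \<open>frob_bounded_kernel\<close> takes care of the remainder.\<close>

lemma low_rank_approximation:
  assumes S: "S \<subseteq> V" and N: "N = real (card S)"
    and t: "0 < t" "t \<le> 1/4"
    and N1: "16 \<le> N" and l1: "2 * l \<le> N powr (t/4)"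
    and l2: "2 * ln N * l\<^sup>2 * N powr (1/2) \<le> N powr (3/4)"
    and l3: "l \<le> N powr (13/16)"
    and r: "2 \<le> r" "real r \<le> N powr (1/4)"
  obtains \<phi> :: "nat \<Rightarrow> 'a \<Rightarrow> real"
  where "psd S (\<lambda>u v. M u v - (\<Sum>i<r. \<phi> i u * \<phi> i v))"
    "frob S (\<lambda>u v. A u v - (\<Sum>i<r. \<phi> i u * \<phi> i v)) \<le> 4 * l * N powr (29/16) + 8 * N\<^sup>2 / sqrt (real r)"
    "(\<Sum>u | u \<in> S \<and> real r powr t < (\<Sum>i<r. (\<phi> i u)\<^sup>2). \<Sum>i<r. (\<phi> i u)\<^sup>2) \<le> N powr (3/4)"
proof -
  have fin: "finite S" by (rule finite_subset_V[OF S])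
  have Npos: "0 < N" using N1 by simp
  have l0: "0 \<le> l" using l_ge_1 by simp
  obtain \<mu> w where \<mu>0: "\<And>i. 0 \<le> \<mu> i" and dec: "decseq \<mu>"
    and nw: "\<And>i. \<mu> i * nsq S (w i) = \<mu> i"
    and low: "\<And>m x. - l * nsq S x \<le> bil S (\<lambda>u v. A u v - (\<Sum>i<m. \<mu> i * (w i u * w i v))) x x"
    and up: "\<And>m x. bil S (\<lambda>u v. A u v - (\<Sum>i<m. \<mu> i * (w i u * w i v))) x x \<le> \<mu> m * nsq S x"
    and fr: "\<And>m. frob S (\<lambda>u v. A u v - (\<Sum>i<m. \<mu> i * (w i u * w i v))) = frob S A - (\<Sum>i<m. (\<mu> i)\<^sup>2)"
    using spectral_deflation[OF fin A_commute l0 low_A[OF S]] by blast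
  define \<phi> where "\<phi> = (\<lambda>i u. sqrt (\<mu> i) * w i u)"
  have \<phi>2: "\<phi> i u * \<phi> i v = \<mu> i * (w i u * w i v)" for i u v
  proof -
    have "\<phi> i u * \<phi> i v = (sqrt (\<mu> i) * sqrt (\<mu> i)) * (w i u * w i v)"
      by (simp only: \<phi>_def mult_ac)
    then show ?thesis using \<mu>0[of i] by simp
  qed
  have psdK: "psd S (\<lambda>u v. M u v - (\<Sum>i<m. \<phi> i u * \<phi> i v))" for m
  proof (rule psdI)
    fix x
    have "bil S (\<lambda>u v. M u v - (\<Sum>i<m. \<phi> i u * \<phi> i v)) x x =
        bil S (\<lambda>u v. A u v - (\<Sum>i<m. \<mu> i * (w i u * w i v))) x x + l * nsq S x"
      unfolding M_def \<phi>2 by (simp add: bil_add_kernel bil_diff_kernel bil_scalar fin)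
    then show "0 \<le> bil S (\<lambda>u v. M u v - (\<Sum>i<m. \<phi> i u * \<phi> i v)) x x" using low[of x m] by simp
  qed (auto simp: M_def A_commute mult.commute)
  define b where "b = (\<lambda>m u. \<Sum>i<m. (\<phi> i u)\<^sup>2)"
  have sum_b: "(\<Sum>u\<in>S. b m u) = (\<Sum>i<m. \<mu> i)" for m
  proof -
    have "(\<Sum>u\<in>S. b m u) = (\<Sum>i<m. \<mu> i * nsq S (w i))"
      unfolding b_def power2_eq_square \<phi>2
      by (subst sum.swap) (simp add: nsq_def sum_distrib_left power2_eq_square)
    then show ?thesis by (simp add: nw)
  qed
  have bsmall: "(\<Sum>u | u \<in> S \<and> real m powr t < b m u. b m u) \<le> N powr (3/4)"
    if "2 \<le> m" "real m \<le> N powr (1/4)" for m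
    unfolding b_def using that N1 by (intro large_diagonal_sum_le_powr[OF S psdK _ _ t(1) _ l1 l2]) auto
  have b0: "0 \<le> b m u" for m u by (simp add: b_def sum_nonneg)
  have \<mu>bound: "\<mu> i \<le> 2 * N / (real (Suc i)) powr (3/4)" if i: "1 \<le> i" "real (Suc i) \<le> N powr (1/4)" for i
  proof -
    let ?m = "Suc i"
    have "real ?m * \<mu> i = (\<Sum>j<?m. \<mu> i)" by simp
    also have "\<dots> \<le> (\<Sum>j<?m. \<mu> j)" using dec by (intro sum_mono) (auto simp: decseq_def)
    also have "\<dots> = (\<Sum>u\<in>S. b ?m u)" by (simp only: sum_b)
    also have "\<dots> \<le> (\<Sum>u\<in>S. real ?m powr t + (if real ?m powr t < b ?m u then b ?m u else 0))"
      by (intro sum_mono) auto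
    also have "\<dots> = N * real ?m powr t + (\<Sum>u | u \<in> S \<and> real ?m powr t < b ?m u. b ?m u)"
      using fin by (simp add: sum.distrib N sum.inter_filter)
    also have "\<dots> \<le> N * real ?m powr (1/4) + N * real ?m powr (1/4)"
    proof (intro add_mono mult_left_mono)
      show "real ?m powr t \<le> real ?m powr (1/4)" using t by (intro powr_mono) auto
      have "N powr (3/4) \<le> N powr 1" using N1 by (intro powr_mono) auto
      also have "\<dots> \<le> N * real ?m powr (1/4)"
        using Npos ge_one_powr_ge_zero[of "real ?m" "1/4"] by simp
      finally show "(\<Sum>u | u \<in> S \<and> real ?m powr t < b ?m u. b ?m u) \<le> N * real ?m powr (1/4)"
        using bsmall[of ?m] i by simp
    qed (use Npos in auto)
    finally have "real ?m * \<mu> i \<le> 2 * N * real ?m powr (1/4)" by simp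
    then have "\<mu> i \<le> 2 * N * (real ?m powr (1/4) / real ?m)" by (simp add: field_simps)
    also have "real ?m powr (1/4) / real ?m = 1 / real ?m powr (3/4)"
    proof -
      have "real ?m = real ?m powr (1/4) * real ?m powr (3/4)"
        by (simp only: powr_add[symmetric]) simp
      then show ?thesis by (metis nonzero_divide_mult_cancel_left powr_eq_0_iff nat.distinct(1) of_nat_eq_0_iff)
    qed
    finally show ?thesis by simp
  qed
  \<comment> \<open>The largest rank to which the diagonal bound applies; there
    \<open>\<mu> r1\<close> is of order
    \<open>N / (N powr (1/4)) powr (3/4) = N powr (13/16)\<close>.\<close>
  define r1 where "r1 = nat \<lfloor>N powr (1/4)\<rfloor>"
  have N4: "2 \<le> N powr (1/4)"
  proof -
    have "(16::real) powr (1/4) \<le> N powr (1/4)" using N1 by (intro powr_mono2) auto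
    moreover have "(16::real) = 2 powr 4" by simp
    then have "(16::real) powr (1/4) = 2" by (simp only: powr_powr) simp
    ultimately show ?thesis by simp
  qed
  have r1: "real r1 \<le> N powr (1/4)" "N powr (1/4) \<le> 2 * real r1" "2 \<le> r1"
    unfolding r1_def using N4 by linarith+
  have "r \<le> r1" unfolding r1_def using r(2) by linarith
  have \<mu>r1: "\<mu> r1 \<le> 4 * N powr (13/16)"
  proof -
    \<comment> \<open>The bound on \<open>\<mu> i\<close> refers to rank \<open>Suc i\<close>, so
      \<open>r1 - 1\<close> is the last index it reaches.\<close>
    have "\<mu> r1 \<le> \<mu> (r1 - 1)" using dec by (auto simp: decseq_def)
    also have "\<dots> \<le> 2 * N / (real r1) powr (3/4)" using \<mu>bound[of "r1 - 1"] r1 by simp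
    also have "\<dots> \<le> 2 * N / (N powr (1/4) / 2) powr (3/4)"
      using r1 N4 Npos by (intro divide_left_mono powr_mono2 mult_pos_pos) auto
    also have "\<dots> = 2 * 2 powr (3/4) * (N powr 1 / N powr (3/16))"
      using Npos by (simp add: powr_divide powr_powr)
    also have "N powr 1 / N powr (3/16) = N powr (13/16)" by (simp only: powr_diff[symmetric]) simp
    also have "2 * 2 powr (3/4) * N powr (13/16) \<le> 4 * N powr (13/16)"
      using powr_mono[of "3/4" 1 "2::real"] by (intro mult_right_mono) auto
    finally show ?thesis .
  qed
  let ?K = "\<lambda>m u v. A u v - (\<Sum>i<m. \<mu> i * (w i u * w i v))"
  have fK1: "frob S (?K r1) \<le> 4 * l * N powr (29/16)"
  proof -
    have "frob S (?K r1) \<le> l * (4 * N powr (13/16)) * card S"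
    proof (rule frob_bounded_kernel[OF fin])
      show "bil S (?K r1) x x \<le> (4 * N powr (13/16)) * nsq S x" for x
        using up[of r1 x] mult_right_mono[OF \<mu>r1 nsq_nonneg[of S x]] by linarith
      show "l \<le> 4 * N powr (13/16)" using l3 powr_ge_zero[of N "13/16"] by linarith
      have "(\<Sum>u\<in>S. ?K r1 u u) = - (\<Sum>u\<in>S. b r1 u)"
        by (simp add: b_def power2_eq_square \<phi>2 sum_negf)
      then show "(\<Sum>u\<in>S. ?K r1 u u) \<le> 0" using b0 by (simp add: sum_nonneg)
    qed (use low in \<open>auto simp: A_commute mult.commute\<close>)
    also have "\<dots> = 4 * l * (N powr (13/16) * N powr 1)" using Npos by (simp add: N)
    also have "N powr (13/16) * N powr 1 = N powr (29/16)" by (simp only: powr_add[symmetric]) simp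
    finally show ?thesis .
  qed
  have tail: "(\<Sum>i=r..<r1. (\<mu> i)\<^sup>2) \<le> 8 * N\<^sup>2 / sqrt (real r)"
  proof -
    have "(\<Sum>i=r..<r1. (\<mu> i)\<^sup>2) \<le> (\<Sum>i=r..<r1. 4 * N\<^sup>2 * (1 / (real (Suc i) * sqrt (real (Suc i)))))"
    proof (intro sum_mono)
      fix i assume i: "i \<in> {r..<r1}"
      then have "real (Suc i) \<le> N powr (1/4)" using r1(1) by simp
      then have "\<mu> i \<le> 2 * N / (real (Suc i)) powr (3/4)" using i r by (intro \<mu>bound) auto
      then have "(\<mu> i)\<^sup>2 \<le> (2 * N / (real (Suc i)) powr (3/4))\<^sup>2" using \<mu>0 by (intro power_mono) auto
      also have "\<dots> = 4 * N\<^sup>2 * (1 / (real (Suc i) powr (3/4) * real (Suc i) powr (3/4)))"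
        by (simp add: power2_eq_square)
      also have "real (Suc i) powr (3/4) * real (Suc i) powr (3/4) = real (Suc i) powr 1 * real (Suc i) powr (1/2)"
        by (simp only: powr_add[symmetric]) simp
      also have "\<dots> = real (Suc i) * sqrt (real (Suc i))" by (simp add: powr_half_sqrt)
      finally show "(\<mu> i)\<^sup>2 \<le> 4 * N\<^sup>2 * (1 / (real (Suc i) * sqrt (real (Suc i))))" .
    qed
    also have "\<dots> = 4 * N\<^sup>2 * (\<Sum>i=r..<r1. 1 / (real (Suc i) * sqrt (real (Suc i))))"
      by (simp only: sum_distrib_left)
    also have "\<dots> \<le> 4 * N\<^sup>2 * (2 / sqrt (real r) - 2 / sqrt (real r1))"
      using \<open>r \<le> r1\<close> r by (intro mult_left_mono sum_inverse_three_halves_le) auto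
    also have "\<dots> \<le> 4 * N\<^sup>2 * (2 / sqrt (real r))" by (intro mult_left_mono) auto
    finally show ?thesis by simp
  qed
  have "frob S (?K r) = frob S (?K r1) + (\<Sum>i=r..<r1. (\<mu> i)\<^sup>2)"
    unfolding fr using sum.atLeastLessThan_concat[of 0 r r1 "\<lambda>i. (\<mu> i)\<^sup>2"] \<open>r \<le> r1\<close>
    by (simp add: lessThan_atLeast0)
  then have "frob S (?K r) \<le> 4 * l * N powr (29/16) + 8 * N\<^sup>2 / sqrt (real r)"
    using fK1 tail by linarith
  then show thesis
    using that[of \<phi>] psdK[of r] bsmall[OF r] by (simp add: \<phi>2 b_def)
qed

end

section \<open>Extremal sets are dense\<close>

text \<open>With \<open>z = (x / m) powr (1/4)\<close> concavity reduces to
  \<open>3*z^4 - 4*z^3 + 1 \<ge> 0\<close>, where the left side is a square times a nonnegative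
  quadratic.\<close>

lemma powr_three_quarters_tangent:
  fixes x m :: real
  assumes "0 \<le> x" "0 < m"
  shows "x powr (3/4) \<le> m powr (3/4) * (1/4 + 3/4 * (x / m))"
proof -
  define z where "z = (x / m) powr (1/4)"
  have z3: "z ^ 3 = (x / m) powr (3/4)" and z4: "z ^ 4 = x / m"
    using assms by (cases "x = 0"; simp add: z_def powr_power)+
  have "0 \<le> (z - 1)\<^sup>2 * (2 * z\<^sup>2 + (z + 1)\<^sup>2)" by simp
  also have "\<dots> = 3 * z ^ 4 - 4 * z ^ 3 + 1" by (simp add: power2_eq_square eval_nat_numeral algebra_simps)
  finally have "z ^ 3 \<le> 1/4 + 3/4 * z ^ 4" by simp
  then have "m powr (3/4) * (x / m) powr (3/4) \<le> m powr (3/4) * (1/4 + 3/4 * (x / m))"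
    unfolding z3 z4 by (rule mult_left_mono) simp
  then show ?thesis using assms by (simp add: powr_divide)
qed

lemma sum_powr_three_quarters_le:
  fixes d :: "'a \<Rightarrow> real"
  assumes "\<And>v. v \<in> S \<Longrightarrow> 0 \<le> d v" "(\<Sum>v\<in>S. d v) = m * real (card S)" "0 < m"
  shows "(\<Sum>v\<in>S. d v powr (3/4)) \<le> real (card S) * m powr (3/4)"
proof -
  have "(\<Sum>v\<in>S. d v powr (3/4)) \<le> (\<Sum>v\<in>S. m powr (3/4) * (1/4 + 3/4 * (d v / m)))"
    using assms by (intro sum_mono powr_three_quarters_tangent) auto
  also have "\<dots> = m powr (3/4) * (real (card S) * (1/4) + 3/4 * ((\<Sum>v\<in>S. d v) / m))"
    by (simp only: sum_distrib_left[symmetric] sum.distrib sum_divide_distrib[symmetric] sum_constant) simp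
  also have "\<dots> = real (card S) * m powr (3/4)" using assms(2,3) by simp
  finally show ?thesis .
qed

context graph_with_shift
begin

text \<open>Cauchy-Schwarz for \<open>B\<close> between the unit vector at \<open>v\<close> and the
  indicator of its neighbourhood. At the indicator \<open>B\<close> is dominated by
  \<open>M\<close>, whose form there counts the adjacent pairs inside the neighbourhood plus
  \<open>l\<close> times the degree.\<close>

lemma row_inner_product_le:
  fixes \<phi> :: "nat \<Rightarrow> 'a \<Rightarrow> real"
  assumes S: "S \<subseteq> V" and v: "v \<in> S"
    and le: "psd S (\<lambda>u v. M u v - (\<Sum>i<r. \<phi> i u * \<phi> i v))"
  shows "(\<Sum>w\<in>S. A v w * (\<Sum>i<r. \<phi> i v * \<phi> i w)) \<le>
    sqrt (\<Sum>i<r. (\<phi> i v)\<^sup>2) * sqrt (ec {w \<in> S. adj v w} + l * deg S v)"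
proof -
  have fin: "finite S" by (rule finite_subset_V[OF S])
  define B where "B = (\<lambda>u v. \<Sum>i<r. \<phi> i u * \<phi> i v)"
  let ?x = "\<lambda>u. if u = v then 1 else (0::real)"
  have psdB: "psd S B" unfolding B_def by (intro psd_sum psd_rank_one)
  have "bil S B ?x (A v) = (\<Sum>w\<in>S. A v w * B v w)"
    unfolding bil_rowsum using v fin
    by (simp add: if_distribR if_distrib sum.delta mult.commute cong: if_cong)
  moreover have "bil S B ?x ?x = B v v" by (rule bil_unit_unit[OF fin v])
  moreover have "bil S B (A v) (A v) \<le> ec {w \<in> S. adj v w} + l * deg S v"
  proof -
    have "0 \<le> bil S (\<lambda>u v. M u v - B u v) (A v) (A v)"
      using psd_nonneg[OF le] by (simp add: B_def)
    also have "\<dots> = bil S M (A v) (A v) - bil S B (A v) (A v)" by (rule bil_diff_kernel)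
    also have "bil S M (A v) (A v) = bil S A (A v) (A v) + l * nsq S (A v)"
      unfolding M_def by (simp add: bil_add_kernel bil_scalar fin)
    also have "nsq S (A v) = deg S v" by (simp add: nsq_def deg_def power2_eq_square)
    also have "bil S A (A v) (A v) = ec {w \<in> S. adj v w}"
    proof -
      have "bil S A (A v) (A v) = bil S A (\<lambda>u. if u \<in> {w \<in> S. adj v w} then 1 else 0)
          (\<lambda>u. if u \<in> {w \<in> S. adj v w} then 1 else 0)"
        by (rule bil_cong) (auto simp: A_def)
      also have "\<dots> = bil {w \<in> S. adj v w} A (\<lambda>_. 1) (\<lambda>_. 1)"
        by (rule bil_support[OF fin]) auto
      finally show ?thesis by (simp add: bil_def ec_def)
    qed
    finally show ?thesis by simp
  qed
  moreover have "0 \<le> B v v" by (rule psd_diag_nonneg[OF psdB fin v])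
  ultimately have "B v v * bil S B (A v) (A v) \<le> B v v * (ec {w \<in> S. adj v w} + l * deg S v)"
    and "(\<Sum>w\<in>S. A v w * B v w)\<^sup>2 \<le> B v v * bil S B (A v) (A v)"
    using psd_Cauchy_Schwarz[OF psdB, of ?x "A v"] by (auto intro: mult_left_mono)
  then have "(\<Sum>w\<in>S. A v w * B v w)\<^sup>2 \<le> B v v * (ec {w \<in> S. adj v w} + l * deg S v)"
    by linarith
  then have "(\<Sum>w\<in>S. A v w * B v w) \<le> sqrt (B v v * (ec {w \<in> S. adj v w} + l * deg S v))"
    by (rule real_le_rsqrt)
  moreover have "B v v = (\<Sum>i<r. (\<phi> i v)\<^sup>2)" by (simp add: B_def power2_eq_square)
  ultimately show ?thesis by (simp add: B_def real_sqrt_mult)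
qed

text \<open>Rows with \<open>b v \<le> s\<close> gain from extremality, which bounds
  \<open>ec\<close> of the neighbourhood by a power of the degree; Jensen's inequality then replaces
  the degrees by their mean \<open>p * N\<close>. Rows with \<open>b v > s\<close> are estimated
  trivially by \<open>2 * N * b v\<close>, and \<open>large\<close> bounds their sum.\<close>

lemma extremal_inner_product_le:
  fixes \<phi> :: "nat \<Rightarrow> 'a \<Rightarrow> real"
  assumes S: "S \<subseteq> V" and N: "N = real (card S)" "1 \<le> N" and lN: "l \<le> N"
    and p: "ec S = p * N\<^sup>2" "0 < p"
    and ext: "\<And>T. T \<subseteq> S \<Longrightarrow> ec T \<le> p * sqrt N * real (card T) powr (3/2)"
    and le: "psd S (\<lambda>u v. M u v - (\<Sum>i<r. \<phi> i u * \<phi> i v))"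
    and s: "1 \<le> s"
    and large: "(\<Sum>u | u \<in> S \<and> s < (\<Sum>i<r. (\<phi> i u)\<^sup>2). \<Sum>i<r. (\<phi> i u)\<^sup>2) \<le> N powr (3/4)"
  shows "(\<Sum>v\<in>S. \<Sum>w\<in>S. A v w * (\<Sum>i<r. \<phi> i v * \<phi> i w)) \<le>
    sqrt s * (p powr (5/4) * N\<^sup>2 + N * sqrt (l * N)) + 2 * N powr (7/4)"
proof -
  have fin: "finite S" by (rule finite_subset_V[OF S])
  define b where "b = (\<lambda>u. \<Sum>i<r. (\<phi> i u)\<^sup>2)"
  have b0: "0 \<le> b u" for u by (simp add: b_def sum_nonneg)
  define nb where "nb = (\<lambda>v. {w \<in> S. adj v w})"
  have card_nb: "real (card (nb v)) = deg S v" for v by (simp add: deg_eq_card[OF fin] nb_def)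
  have degN: "deg S v \<le> N" for v using deg_le_card N by simp
  have row_bound: "(\<Sum>w\<in>S. A v w * (\<Sum>i<r. \<phi> i v * \<phi> i w)) \<le>
      sqrt s * (sqrt p * N powr (1/4) * deg S v powr (3/4) + sqrt (l * N))
        + (if s < b v then 2 * N * b v else 0)" if v: "v \<in> S" for v
  proof -
    have row: "(\<Sum>w\<in>S. A v w * (\<Sum>i<r. \<phi> i v * \<phi> i w)) \<le>
        sqrt (b v) * sqrt (ec (nb v) + l * deg S v)"
      using row_inner_product_le[OF S v le] by (simp add: b_def nb_def)
    show ?thesis
    proof (cases "s < b v")
      case True
      have "ec (nb v) + l * deg S v \<le> N\<^sup>2 + N * N"
      proof (rule add_mono)
        have "ec (nb v) \<le> (deg S v)\<^sup>2" using ec_le_card_sq[of "nb v"] by (simp add: card_nb)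
        also have "\<dots> \<le> N\<^sup>2" using degN deg_nonneg by (intro power_mono) auto
        finally show "ec (nb v) \<le> N\<^sup>2" .
        show "l * deg S v \<le> N * N" using lN degN deg_nonneg l_ge_1 N by (intro mult_mono) auto
      qed
      also have "\<dots> \<le> (2 * N)\<^sup>2" by (simp add: power2_eq_square)
      finally have 1: "sqrt (ec (nb v) + l * deg S v) \<le> 2 * N" using N by (intro real_le_lsqrt) auto
      have "1 \<le> b v" using True s by simp
      then have "b v * 1 \<le> b v * b v" by (intro mult_left_mono) auto
      then have 2: "sqrt (b v) \<le> b v" using b0 by (intro real_le_lsqrt) (auto simp: power2_eq_square)
      have "sqrt (b v) * sqrt (ec (nb v) + l * deg S v) \<le> b v * (2 * N)"
        using 1 2 b0 ec_nonneg deg_nonneg l_ge_1 by (intro mult_mono) auto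
      moreover have "0 \<le> sqrt s * (sqrt p * N powr (1/4) * deg S v powr (3/4) + sqrt (l * N))"
        using s p l_ge_1 N by (intro mult_nonneg_nonneg add_nonneg_nonneg) auto
      ultimately show ?thesis using row True by (simp add: mult_ac)
    next
      case False
      have "sqrt (ec (nb v) + l * deg S v) \<le> sqrt (ec (nb v)) + sqrt (l * deg S v)"
        using ec_nonneg deg_nonneg l_ge_1 by (intro sqrt_add_le_add_sqrt) auto
      also have "\<dots> \<le> sqrt (p * sqrt N * deg S v powr (3/2)) + sqrt (l * N)"
        using ext[of "nb v"] degN[of v] l_ge_1 unfolding card_nb
        by (intro add_mono real_sqrt_le_mono mult_left_mono) (auto simp: nb_def)
      also have "sqrt (p * sqrt N * deg S v powr (3/2)) = sqrt p * N powr (1/4) * deg S v powr (3/4)"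
        using N by (simp add: real_sqrt_mult powr_half_sqrt[symmetric] powr_powr)
      finally have "sqrt (b v) * sqrt (ec (nb v) + l * deg S v) \<le>
          sqrt s * (sqrt p * N powr (1/4) * deg S v powr (3/4) + sqrt (l * N))"
        using False b0 s p l_ge_1 N ec_nonneg deg_nonneg by (intro mult_mono) auto
      then show ?thesis using row False by simp
    qed
  qed
  have "(\<Sum>v\<in>S. \<Sum>w\<in>S. A v w * (\<Sum>i<r. \<phi> i v * \<phi> i w)) \<le>
      (\<Sum>v\<in>S. sqrt s * (sqrt p * N powr (1/4) * deg S v powr (3/4) + sqrt (l * N))
        + (if s < b v then 2 * N * b v else 0))"
    by (rule sum_mono) (rule row_bound)
  also have "\<dots> = sqrt s * (sqrt p * N powr (1/4) * (\<Sum>v\<in>S. deg S v powr (3/4)) + N * sqrt (l * N))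
      + 2 * N * (\<Sum>v | v \<in> S \<and> s < b v. b v)"
    using fin by (simp add: sum.distrib sum_distrib_left N distrib_left mult_ac flip: sum.inter_filter)
  also have "\<dots> \<le> sqrt s * (sqrt p * N powr (1/4) * (N * (p * N) powr (3/4)) + N * sqrt (l * N))
      + 2 * N * N powr (3/4)"
  proof (intro add_mono mult_left_mono order.refl)
    show "(\<Sum>v\<in>S. deg S v powr (3/4)) \<le> N * (p * N) powr (3/4)"
      unfolding N(1) using p N deg_nonneg
      by (intro sum_powr_three_quarters_le) (auto simp: ec_eq_sum_deg power2_eq_square)
    show "(\<Sum>v | v \<in> S \<and> s < b v. b v) \<le> N powr (3/4)" using large by (simp add: b_def)
  qed (use s p N in auto)
  also have "sqrt p * N powr (1/4) * (N * (p * N) powr (3/4)) = p powr (5/4) * N\<^sup>2"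
  proof -
    have "sqrt p * N powr (1/4) * (N * (p * N) powr (3/4)) =
        (p powr (1/2) * p powr (3/4)) * (N powr (1/4) * N powr (3/4)) * N"
      using p N by (simp add: powr_half_sqrt[symmetric] powr_mult)
    also have "p powr (1/2) * p powr (3/4) = p powr (5/4)" by (simp only: powr_add[symmetric]) simp
    also have "N powr (1/4) * N powr (3/4) = N" using N by (simp only: powr_add[symmetric]) simp
    finally show ?thesis by (simp add: power2_eq_square)
  qed
  also have "2 * N * N powr (3/4) = 2 * N powr (7/4)"
  proof -
    have "N powr 1 * N powr (3/4) = N powr (7/4)" by (simp only: powr_add[symmetric]) simp
    then show ?thesis using N by simp
  qed
  finally show ?thesis .
qed

text \<open>Since \<open>B\<close> is close to \<open>A\<close> in the Frobenius norm, the inner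
  product of \<open>A\<close> and \<open>B\<close> is nearly \<open>ec S\<close>; this is played off
  against the upper bound of \<open>extremal_inner_product_le\<close>.\<close>

lemma extremal_density_inequality:
  assumes S: "S \<subseteq> V" and N: "N = real (card S)" "16 \<le> N"
    and p: "ec S = p * N\<^sup>2" "0 < p"
    and ext: "\<And>T. T \<subseteq> S \<Longrightarrow> ec T \<le> p * sqrt N * real (card T) powr (3/2)"
    and t: "0 < t" "t \<le> 1/4" and l1: "2 * l \<le> N powr (t/4)"
    and l2: "2 * ln N * l\<^sup>2 * N powr (1/2) \<le> N powr (3/4)"
    and l3: "l \<le> N powr (13/16)"
    and r: "2 \<le> r" "real r \<le> N powr (1/4)" and \<delta>: "0 < \<delta>"
  shows "(1 - \<delta>/2) * (p * N\<^sup>2) - (4 * l * N powr (29/16) + 8 * N\<^sup>2 / sqrt (real r)) / (2 * \<delta>) \<le>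
    sqrt (real r powr t) * (p powr (5/4) * N\<^sup>2 + N * sqrt (l * N)) + 2 * N powr (7/4)"
proof -
  obtain \<phi> :: "nat \<Rightarrow> 'a \<Rightarrow> real" where
    le: "psd S (\<lambda>u v. M u v - (\<Sum>i<r. \<phi> i u * \<phi> i v))" and
    fr: "frob S (\<lambda>u v. A u v - (\<Sum>i<r. \<phi> i u * \<phi> i v)) \<le> 4 * l * N powr (29/16) + 8 * N\<^sup>2 / sqrt (real r)" and
    large: "(\<Sum>u | u \<in> S \<and> real r powr t < (\<Sum>i<r. (\<phi> i u)\<^sup>2). \<Sum>i<r. (\<phi> i u)\<^sup>2) \<le> N powr (3/4)"
    using low_rank_approximation[OF S N(1) t N(2) l1 l2 l3 r] by blast
  define B where "B = (\<lambda>u v. \<Sum>i<r. \<phi> i u * \<phi> i v)"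
  have "(1 - \<delta>/2) * ec S - frob S (\<lambda>u v. A u v - B u v) / (2 * \<delta>) =
      (\<Sum>v\<in>S. \<Sum>w\<in>S. (1 - \<delta>/2) * A v w - (A v w - B v w)\<^sup>2 / (2 * \<delta>))"
    by (simp add: ec_def frob_def sum_subtractf sum_distrib_left sum_divide_distrib)
  also have "\<dots> \<le> (\<Sum>v\<in>S. \<Sum>w\<in>S. A v w * B v w)"
  proof (intro sum_mono)
    fix v w
    \<comment> \<open>Weighted AM-GM; \<open>\<delta>\<close> trades the loss in \<open>ec S\<close>
      against the Frobenius error.\<close>
    have "0 \<le> (\<delta> * A v w - (A v w - B v w))\<^sup>2 / (2 * \<delta>)" using \<delta> by simp
    also have "\<dots> = \<delta>/2 * (A v w * A v w) - A v w * A v w + A v w * B v w + (A v w - B v w)\<^sup>2 / (2 * \<delta>)"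
      using \<delta> by (simp add: field_simps power2_eq_square)
    finally show "(1 - \<delta>/2) * A v w - (A v w - B v w)\<^sup>2 / (2 * \<delta>) \<le> A v w * B v w"
      by (simp add: algebra_simps)
  qed
  also have "\<dots> \<le> sqrt (real r powr t) * (p powr (5/4) * N\<^sup>2 + N * sqrt (l * N)) + 2 * N powr (7/4)"
    unfolding B_def
  proof (rule extremal_inner_product_le[OF S N(1) _ _ p ext le _ large])
    have "N powr (13/16) \<le> N powr 1" using N by (intro powr_mono) auto
    then show "l \<le> N" using l3 N by simp
    show "1 \<le> real r powr t" using r t by (intro ge_one_powr_ge_zero) auto
  qed (use N in auto)
  finally have "(1 - \<delta>/2) * ec S - frob S (\<lambda>u v. A u v - B u v) / (2 * \<delta>) \<le>
    sqrt (real r powr t) * (p powr (5/4) * N\<^sup>2 + N * sqrt (l * N)) + 2 * N powr (7/4)" .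
  moreover have "frob S (\<lambda>u v. A u v - B u v) / (2 * \<delta>) \<le>
      (4 * l * N powr (29/16) + 8 * N\<^sup>2 / sqrt (real r)) / (2 * \<delta>)"
    using fr \<delta> unfolding B_def by (intro divide_right_mono) auto
  ultimately show ?thesis using p by simp
qed

end

text \<open>With \<open>\<delta> = 1/4000\<close> and \<open>t = 1/120000\<close> in \<open>extremal_density_inequality\<close>, these are the inequalities that make all
  error terms smaller than \<open>\<delta> p N\<^sup>2\<close> when \<open>l \<le> N\<^sup>a\<close> and \<open>p \<ge> N\<^bsup>-a\<^esup>\<close> for \<open>a = 1/1000000\<close>.\<close>

definition large_enough :: "real \<Rightarrow> bool" where
  "large_enough N \<longleftrightarrow> 16 \<le> N \<and>
    2 * N powr (1/1000000) \<le> N powr (1/480000) \<and>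
    2 * ln N * (N powr (1/1000000))\<^sup>2 * N powr (1/2) \<le> N powr (3/4) \<and>
    4 * N powr (1/1000000) * N powr (29/16) \<le> (1/4000)\<^sup>2 * N powr (-1/1000000) * N\<^sup>2 \<and>
    128 * 4000 ^ 4 * (N powr (1/1000000))\<^sup>2 \<le> N powr (1/4) \<and>
    N powr (13/8) + 2 * N powr (7/4) \<le> 1/4000 * N powr (-1/1000000) * N\<^sup>2"

lemma eventually_large_enough: "eventually large_enough at_top"
  unfolding large_enough_def by (intro eventually_conj; real_asymp)

text \<open>Bernoulli's inequality gives \<open>2 \<le> (1 + 1/4000) ^ 4000\<close>, the constant is
  below \<open>2 ^ 60\<close>, and \<open>240000 = 60 * 4000\<close>. The exponent is
  \<open>t / 2\<close>, and the constant is the factor independent of \<open>p\<close> in the later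
  upper bound for the rank.\<close>

lemma root_of_constant_le: "(128 * 4000 ^ 4 :: real) powr (1/240000) \<le> 1 + 1/4000"
proof -
  have "(2::real) \<le> 1 + real 4000 * (1/4000)" by simp
  also have "\<dots> \<le> (1 + 1/4000) ^ 4000" by (rule Bernoulli_inequality) simp
  finally have "(2::real) ^ 60 \<le> ((1 + 1/4000) ^ 4000) ^ 60" by (rule power_mono) simp
  also have "\<dots> = (1 + 1/4000) ^ 240000" by (simp only: power_mult[symmetric]) simp
  finally have "128 * 4000 ^ 4 \<le> (1 + 1/4000 :: real) ^ 240000"
    by (rule order_trans[rotated]) simp
  also have "\<dots> = (1 + 1/4000) powr 240000"
    by (subst powr_realpow[symmetric]) simp_all
  finally have "(128 * 4000 ^ 4 :: real) powr (1/240000) \<le> ((1 + 1/4000) powr 240000) powr (1/240000)"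
    by (intro powr_mono2) auto
  also have "\<dots> = (1 + 1/4000) powr 1" by (simp only: powr_powr) simp
  finally show ?thesis by simp
qed

lemma Markov_card:
  fixes f :: "'b \<Rightarrow> real"
  assumes "finite S" "\<And>v. v \<in> S \<Longrightarrow> 0 \<le> f v" "0 < m"
  shows "m * (real (card S) - real (card {v \<in> S. f v \<le> m})) \<le> (\<Sum>v\<in>S. f v)"
proof -
  have "card S = card {v \<in> S. f v \<le> m} + card {v \<in> S. \<not> f v \<le> m}"
    by (subst card_Un_disjoint[symmetric]) (use assms(1) in \<open>auto intro: arg_cong[where f = card]\<close>)
  then have "m * (real (card S) - real (card {v \<in> S. f v \<le> m})) = (\<Sum>v\<in>{v \<in> S. \<not> f v \<le> m}. m)"
    by simp
  also have "\<dots> \<le> (\<Sum>v\<in>{v \<in> S. \<not> f v \<le> m}. f v)" by (rule sum_mono) simp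
  also have "\<dots> \<le> (\<Sum>v\<in>S. f v)" using assms by (intro sum_mono2) auto
  finally show ?thesis .
qed

lemma cube_sum_le:
  fixes a b c :: real
  assumes "0 \<le> a" "0 \<le> b" "0 \<le> c"
  shows "(a + b + c) ^ 3 \<le> 9 * (a ^ 3 + b ^ 3 + c ^ 3)"
proof -
  have "0 \<le> (a + b) * (a - b)\<^sup>2 + (b + c) * (b - c)\<^sup>2 + (a + c) * (a - c)\<^sup>2"
    using assms by simp
  moreover have "3 * (a * b * c) \<le> a ^ 3 + b ^ 3 + c ^ 3"
  proof -
    have "0 \<le> (a + b + c) * ((a - b)\<^sup>2 + (b - c)\<^sup>2 + (a - c)\<^sup>2)" using assms by simp
    also have "\<dots> = 2 * (a ^ 3 + b ^ 3 + c ^ 3 - 3 * (a * b * c))"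
      by (simp add: power2_eq_square power3_eq_cube algebra_simps)
    finally show ?thesis by simp
  qed
  ultimately show ?thesis by (simp add: power2_eq_square power3_eq_cube algebra_simps)
qed

context graph_with_shift
begin

text \<open>With a rank \<open>r\<close> of order \<open>p^(-2)\<close>, the main term of the upper
  bound is at most \<open>(1 + 1/4000) * p powr (1/8) * (p * N\<^sup>2)\<close>, and all errors are
  small multiples of \<open>p * N\<^sup>2\<close>. The comparison forces \<open>p powr (1/8)\<close>
  close to 1.\<close>

lemma extremal_dense:
  assumes S: "S \<subseteq> V" and N: "N = real (card S)" and large: "large_enough N"
    and l: "l \<le> N powr (1/1000000)"
    and p: "ec S = p * N\<^sup>2" "N powr (-1/1000000) \<le> p"
    and ext: "\<And>T. T \<subseteq> S \<Longrightarrow> ec T \<le> p * sqrt N * real (card T) powr (3/2)"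
  shows "99/100 \<le> p"
proof -
  define a where "a = N powr (1/1000000)"
  have N16: "16 \<le> N" and C2: "2 * a \<le> N powr (1/480000)"
    and C3: "2 * ln N * a\<^sup>2 * N powr (1/2) \<le> N powr (3/4)"
    and C4: "4 * a * N powr (29/16) \<le> (1/4000)\<^sup>2 * N powr (-1/1000000) * N\<^sup>2"
    and C5: "128 * 4000 ^ 4 * a\<^sup>2 \<le> N powr (1/4)"
    and C6: "N powr (13/8) + 2 * N powr (7/4) \<le> 1/4000 * N powr (-1/1000000) * N\<^sup>2"
    using large by (simp_all add: large_enough_def a_def)
  have l0: "0 \<le> l" using l_ge_1 by simp
  have p0: "0 < p" using p(2) N16 powr_gt_zero[of N "-1/1000000"] by linarith
  have p1: "p \<le> 1"
  proof -
    have "p * N\<^sup>2 \<le> 1 * N\<^sup>2" using ec_le_card_sq[of S] p N by simp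
    then show ?thesis using N16 by (simp only: mult_le_cancel_right) auto
  qed
  have pa: "1 / p \<le> a"
  proof -
    have "1 / p \<le> 1 / N powr (-1/1000000)" using p N16 p0 by (intro divide_left_mono) auto
    also have "\<dots> = a" by (simp add: a_def powr_minus divide_simps)
    finally show ?thesis .
  qed
  have la: "l \<le> a" using l by (simp add: a_def)
  have N_mono: "N powr x \<le> N powr y" if "x \<le> y" for x y using that N16 by (intro powr_mono) auto
  \<comment> \<open>Chosen so that \<open>8 * N\<^sup>2 / c\<close> equals
    \<open>\<delta>\<^sup>2 * (p * N\<^sup>2)\<close> with \<open>\<delta> = 1/4000\<close>; then
    \<open>r \<ge> c\<^sup>2\<close> makes the spectral tail negligible.\<close>
  define c where "c = 8 * 4000\<^sup>2 / p"
  have c0: "8 \<le> c" using p0 p1 by (simp add: c_def field_simps)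
  have c2: "2 * c\<^sup>2 = 128 * 4000 ^ 4 * (1 / p)\<^sup>2" by (simp add: c_def power_divide)
  define r where "r = nat \<lceil>c\<^sup>2\<rceil>"
  have "64 \<le> c\<^sup>2" using power_mono[OF c0, of 2] by simp
  then have r: "c\<^sup>2 \<le> real r" "real r \<le> 2 * c\<^sup>2" "2 \<le> r" unfolding r_def by linarith+
  have rN: "real r \<le> N powr (1/4)"
  proof -
    have "(1 / p)\<^sup>2 \<le> a\<^sup>2" using pa p0 by (intro power_mono) auto
    then have "2 * c\<^sup>2 \<le> 128 * 4000 ^ 4 * a\<^sup>2" unfolding c2 by (intro mult_left_mono) auto
    then show ?thesis using r C5 by linarith
  qed
  have cr: "c \<le> sqrt (real r)" using r(1) by (rule real_le_rsqrt)
  have e1: "8 * N\<^sup>2 / sqrt (real r) \<le> (1/4000)\<^sup>2 * (p * N\<^sup>2)"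
  proof -
    have "8 * N\<^sup>2 / sqrt (real r) \<le> 8 * N\<^sup>2 / c" using cr c0 r(3) by (intro divide_left_mono mult_pos_pos) auto
    also have "\<dots> = (1/4000)\<^sup>2 * (p * N\<^sup>2)" using p0 by (simp add: c_def field_simps)
    finally show ?thesis .
  qed
  have pN2: "N powr (-1/1000000) * N\<^sup>2 \<le> p * N\<^sup>2" using p(2) by (intro mult_right_mono) auto
  have e2: "4 * l * N powr (29/16) \<le> (1/4000)\<^sup>2 * (p * N\<^sup>2)"
  proof -
    have "4 * l * N powr (29/16) \<le> 4 * a * N powr (29/16)" using la by (intro mult_right_mono) auto
    also have "\<dots> \<le> (1/4000)\<^sup>2 * (N powr (-1/1000000) * N\<^sup>2)" using C4 by (simp only: mult.assoc)
    also have "\<dots> \<le> (1/4000)\<^sup>2 * (p * N\<^sup>2)" by (intro mult_left_mono pN2) simp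
    finally show ?thesis .
  qed
  have key: "(1 - (1/4000)/2) * (p * N\<^sup>2) - (4 * l * N powr (29/16) + 8 * N\<^sup>2 / sqrt (real r)) / (2 * (1/4000)) \<le>
    sqrt (real r powr (1/120000)) * (p powr (5/4) * N\<^sup>2 + N * sqrt (l * N)) + 2 * N powr (7/4)"
  proof (rule extremal_density_inequality[OF S N N16 p(1) p0 ext])
    show "2 * l \<le> N powr ((1/120000)/4)" using la C2 by simp
    show "2 * ln N * l\<^sup>2 * N powr (1/2) \<le> N powr (3/4)"
    proof -
      have "2 * ln N * l\<^sup>2 * N powr (1/2) \<le> 2 * ln N * a\<^sup>2 * N powr (1/2)"
        using la l0 N16 by (intro mult_right_mono mult_left_mono power_mono) auto
      then show ?thesis using C3 by simp
    qed
    show "l \<le> N powr (13/16)" using l N_mono[of "1/1000000" "13/16"] by linarith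
  qed (use r rN in auto)
  define \<sigma> where "\<sigma> = sqrt (real r powr (1/120000))"
  have \<sigma>0: "0 \<le> \<sigma>" by (simp add: \<sigma>_def)
  have \<sigma>: "\<sigma> = real r powr (1/240000)"
    by (simp add: \<sigma>_def powr_half_sqrt[symmetric] powr_powr)
  have \<sigma>N: "\<sigma> \<le> N powr (1/16)"
  proof -
    have "\<sigma> \<le> (N powr (1/4)) powr (1/240000)" unfolding \<sigma> using rN by (intro powr_mono2) auto
    also have "\<dots> \<le> N powr (1/16)" unfolding powr_powr by (rule N_mono) simp
    finally show ?thesis .
  qed
  have e3: "\<sigma> * (N * sqrt (l * N)) + 2 * N powr (7/4) \<le> 1/4000 * (p * N\<^sup>2)"
  proof -
    have "l \<le> N powr (1/8)" using l N_mono[of "1/1000000" "1/8"] by linarith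
    then have "l * N \<le> N powr (1/8) * N powr 1" using N16 by (simp add: mult_right_mono)
    also have "\<dots> = N powr (9/8)" by (simp only: powr_add[symmetric]) simp
    finally have "sqrt (l * N) \<le> sqrt (N powr (9/8))" by (rule real_sqrt_le_mono)
    also have "\<dots> = N powr (9/16)" by (simp add: powr_half_sqrt[symmetric] powr_powr)
    finally have "\<sigma> * (N * sqrt (l * N)) \<le> N powr (1/16) * (N powr 1 * N powr (9/16))"
      using \<sigma>N \<sigma>0 N16 l0 by (intro mult_mono) auto
    also have "\<dots> = N powr (13/8)" by (simp only: powr_add[symmetric]) simp
    finally show ?thesis using C6 pN2 by (simp add: mult.assoc)
  qed
  \<comment> \<open>The power of \<open>p\<close> that arises is \<open>-1/120000\<close>. As
    \<open>p \<le> 1\<close>, it may be weakened to \<open>-1/8\<close>, which still leaves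
    \<open>p powr (9/8)\<close> in the main term.\<close>
  have \<sigma>p: "\<sigma> \<le> (1 + 1/4000) * p powr (-1/8)"
  proof -
    have "\<sigma> \<le> (2 * c\<^sup>2) powr (1/240000)" unfolding \<sigma> using r by (intro powr_mono2) auto
    also have "2 * c\<^sup>2 = 128 * 4000 ^ 4 * p powr (-2)"
    proof -
      have "p powr (-2) = (1 / p)\<^sup>2" using p0 by (simp add: powr_minus inverse_eq_divide power_divide)
      then show ?thesis unfolding c2 by (simp only:)
    qed
    also have "(128 * 4000 ^ 4 * p powr (-2)) powr (1/240000) =
        (128 * 4000 ^ 4) powr (1/240000) * p powr (-2 * (1/240000))"
      by (subst powr_mult) (simp_all only: powr_powr)
    also have "\<dots> \<le> (1 + 1/4000) * p powr (-1/8)"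
      by (intro mult_mono root_of_constant_le powr_mono') (use p0 p1 in auto)
    finally show ?thesis .
  qed
  define y where "y = p powr (1/8)"
  have y0: "0 < y" "y \<le> 1" using p0 p1 by (auto simp: y_def powr_le1)
  have y8: "y ^ 8 = p" using p0 by (simp add: y_def powr_power)
  have "\<sigma> * p powr (5/4) \<le> (1 + 1/4000) * p powr (-1/8) * p powr (5/4)"
    using \<sigma>p by (rule mult_right_mono) simp
  also have "\<dots> = (1 + 1/4000) * (p powr (1/8) * p powr 1)"
    unfolding mult.assoc powr_add[symmetric] by simp
  also have "\<dots> = (1 + 1/4000) * y * p" using p0 by (simp add: y_def)
  finally have e4: "\<sigma> * p powr (5/4) * N\<^sup>2 \<le> (1 + 1/4000) * y * (p * N\<^sup>2)"
    using mult_right_mono[of "\<sigma> * p powr (5/4)" "(1 + 1/4000) * y * p" "N\<^sup>2"] by (simp add: mult_ac)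
  \<comment> \<open>With \<open>\<delta> = 1/4000\<close> the number \<open>5/8000\<close> is
    \<open>\<delta>/2 + 2 * \<delta>\<close>: one \<open>\<delta>\<close> for the Frobenius error
    and one for the lower-order terms.\<close>
  have "(1 - 5/8000) * (p * N\<^sup>2) \<le> (1 + 1/4000) * y * (p * N\<^sup>2)"
  proof -
    have "(4 * l * N powr (29/16) + 8 * N\<^sup>2 / sqrt (real r)) / (2 * (1/4000)) \<le> 1/4000 * (p * N\<^sup>2)"
      using e1 e2 by (simp add: power2_eq_square)
    moreover have "(1 - (1/4000)/2) * (p * N\<^sup>2) - (4 * l * N powr (29/16) + 8 * N\<^sup>2 / sqrt (real r)) / (2 * (1/4000))
      \<le> \<sigma> * p powr (5/4) * N\<^sup>2 + (\<sigma> * (N * sqrt (l * N)) + 2 * N powr (7/4))"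
      using key by (simp only: \<sigma>_def[symmetric] distrib_left mult.assoc add.assoc)
    moreover have "(1 - 5/8000) * (p * N\<^sup>2) = (1 - (1/4000)/2) * (p * N\<^sup>2) - 2 * (1/4000 * (p * N\<^sup>2))"
      by (simp add: algebra_simps)
    ultimately show ?thesis using e3 e4 by linarith
  qed
  moreover have "0 < p * N\<^sup>2" using p0 N16 by simp
  ultimately have "1 - 5/8000 \<le> (1 + 1/4000) * y" by (simp only: mult_le_cancel_right_pos)
  then have "1 + (- 1/1000) \<le> y" using y0 by simp
  then have "(1 + (- 1/1000)) ^ 8 \<le> y ^ 8" by (rule power_mono) simp
  moreover have "1 + real 8 * (- 1/1000) \<le> (1 + (- 1/1000)) ^ 8" by (rule Bernoulli_inequality) simp
  ultimately show ?thesis using y8 by simp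
qed

section \<open>Non-degrees and near-cliques\<close>

text \<open>A vertex of \<open>S\<close> counts as its own non-neighbour, because \<open>A\<close>
  vanishes on the diagonal; this makes the total exactly
  \<open>(card S)\<^sup>2 - ec S\<close>.\<close>

definition nondeg :: "'a set \<Rightarrow> 'a \<Rightarrow> real" where
  "nondeg S v = (\<Sum>w\<in>S. 1 - A v w)"

lemma nondeg_eq: "nondeg S v = real (card S) - deg S v"
  by (simp add: nondeg_def deg_def sum_subtractf)

lemma nondeg_nonneg: "0 \<le> nondeg S v"
  by (simp add: nondeg_def sum_nonneg)

lemma nondeg_mono: "S \<subseteq> S' \<Longrightarrow> finite S' \<Longrightarrow> nondeg S v \<le> nondeg S' v"
  unfolding nondeg_def by (rule sum_mono2) auto

lemma sum_nondeg: "(\<Sum>v\<in>S. nondeg S v) = (real (card S))\<^sup>2 - ec S"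
  by (simp add: nondeg_eq sum_subtractf ec_eq_sum_deg power2_eq_square)

text \<open>The Hadamard cube of the positive semidefinite kernel \<open>M - D D\<^sup>T / T\<close> is tested against the
  constant vector: a non-edge contributes about \<open>-1\<close> and an edge only the cube of a small number.\<close>

lemma sum_nondeg_le_cubic:
  assumes S: "S \<subseteq> V" and N: "N = real (card S)" "16 * l \<le> N"
    and h: "\<And>v. v \<in> S \<Longrightarrow> nondeg S v \<le> N / 16"
  shows "(\<Sum>v\<in>S. nondeg S v) \<le> 4 * l ^ 3 * N"
proof -
  have fin: "finite S" by (rule finite_subset_V[OF S])
  have N16: "16 \<le> N" using N l_ge_1 by simp
  define H where "H = (\<Sum>v\<in>S. nondeg S v)"
  have H0: "0 \<le> H" by (simp add: H_def sum_nonneg nondeg_nonneg)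
  define D where "D = (\<lambda>u. N - nondeg S u + l)"
  have D: "(\<Sum>w\<in>S. M u w * 1) = D u" if "u \<in> S" for u
  proof -
    have "(\<Sum>w\<in>S. M u w * 1) = deg S u + l"
      using fin that by (simp add: M_def deg_def sum.distrib)
    then show ?thesis by (simp add: D_def nondeg_eq N)
  qed
  define T where "T = bil S M (\<lambda>_. 1) (\<lambda>_. 1)"
  have T: "T = N\<^sup>2 - H + l * N"
  proof -
    have "T = (\<Sum>u\<in>S. D u)" unfolding T_def bil_rowsum using D by (intro sum.cong) auto
    also have "\<dots> = N\<^sup>2 - H + l * N"
      by (simp add: D_def sum.distrib sum_subtractf H_def N power2_eq_square)
    finally show ?thesis .
  qed
  define q where "q = (\<lambda>u v. D u * D v / T)"
  have X: "psd S (\<lambda>u v. M u v - q u v)"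
    using psd_diff_rank_one[OF psd_M[OF S], of "\<lambda>_. 1"]
    by (rule psd_cong[THEN iffD1, rotated]) (simp only: q_def D T_def)
  have DN: "N - nondeg S u \<le> D u" "15/16 * N \<le> N - nondeg S u" if "u \<in> S" for u
    using h[OF that] l_ge_1 by (auto simp: D_def)
  have T0: "0 < T"
  proof -
    have "H \<le> (\<Sum>v\<in>S. N / 16)" unfolding H_def using h by (rule sum_mono)
    also have "\<dots> = N\<^sup>2 / 16" by (simp add: N power2_eq_square)
    finally have "H \<le> N\<^sup>2 / 16" .
    moreover have "0 < N\<^sup>2" using N16 by simp
    moreover have "0 \<le> l * N" using l_ge_1 N16 by simp
    ultimately show ?thesis unfolding T by linarith
  qed
  define \<eta> where "\<eta> = (\<lambda>u. nondeg S u / N)"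
  have \<eta>: "0 \<le> \<eta> u" "\<eta> u \<le> 1/16" if "u \<in> S" for u
    using h[OF that] N16 nondeg_nonneg[of S u] by (auto simp: \<eta>_def field_simps)
  have lN: "l / N \<le> 1/16" "0 \<le> l / N" using N N16 l_ge_1 by (auto simp: field_simps)
  have q_low: "1 - q u v \<le> \<eta> u + \<eta> v + l / N" if u: "u \<in> S" and v: "v \<in> S" for u v
  proof -
    define e where "e = l / N"
    have "(1 - \<eta> u - \<eta> v - e) * (1 + e) \<le> (1 - \<eta> u) * (1 - \<eta> v)"
    proof -
      have "(1 - \<eta> u) * (1 - \<eta> v) - (1 - \<eta> u - \<eta> v - e) * (1 + e) = \<eta> u * \<eta> v + e * (\<eta> u + \<eta> v) + e * e"
        by (simp add: algebra_simps)
      also have "\<dots> \<ge> 0"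
        using \<eta>[OF u] \<eta>[OF v] lN(2)[folded e_def]
        by (intro add_nonneg_nonneg mult_nonneg_nonneg) auto
      finally show ?thesis by simp
    qed
    then have "N\<^sup>2 * ((1 - \<eta> u - \<eta> v - e) * (1 + e)) \<le> N\<^sup>2 * ((1 - \<eta> u) * (1 - \<eta> v))"
      by (rule mult_left_mono) simp
    also have "\<dots> = (N - nondeg S u) * (N - nondeg S v)"
      using N16 by (simp add: \<eta>_def field_simps power2_eq_square)
    also have "\<dots> \<le> D u * D v"
    proof (rule mult_mono)
      show "0 \<le> D u" using DN[OF u] N16 by linarith
      show "0 \<le> N - nondeg S v" using DN(2)[OF v] N16 by linarith
    qed (use DN(1) u v in auto)
    finally have "(1 - \<eta> u - \<eta> v - e) * (N\<^sup>2 * (1 + e)) \<le> D u * D v" by (simp add: mult_ac)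
    moreover have "N\<^sup>2 * (1 + e) = N\<^sup>2 + l * N" using N16 by (simp add: e_def field_simps power2_eq_square)
    moreover have "(1 - \<eta> u - \<eta> v - e) * T \<le> (1 - \<eta> u - \<eta> v - e) * (N\<^sup>2 + l * N)"
      using T H0 \<eta>[OF u] \<eta>[OF v] lN(1)[folded e_def] by (intro mult_left_mono) auto
    ultimately have "(1 - \<eta> u - \<eta> v - e) * T \<le> D u * D v" by simp
    then have "1 - \<eta> u - \<eta> v - e \<le> q u v" using T0 by (simp add: q_def pos_le_divide_eq)
    then show ?thesis by (simp add: e_def)
  qed
  have \<eta>3: "\<eta> u ^ 3 \<le> \<eta> u / 256" if "u \<in> S" for u
  proof -
    have "\<eta> u * (\<eta> u * \<eta> u) \<le> \<eta> u * (1/16 * (1/16))"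
      using \<eta>[OF that] by (intro mult_left_mono mult_mono) auto
    then show ?thesis by (simp add: power3_eq_cube mult.assoc)
  qed
  \<comment> \<open>An odd power keeps signs, so a non-edge contributes at most
    \<open>- (13/16)^3 < -1/2\<close>, while edges contribute only cubes of small numbers. The
    \<open>1/2\<close> in the diagonal term offsets \<open>1 - A u u = 1\<close>.\<close>
  have entry: "(M u v - q u v) * ((M u v - q u v) * (M u v - q u v)) \<le>
      9/256 * (\<eta> u + \<eta> v) + 9 * (l / N) ^ 3 - 1/2 * (1 - A u v) + (if u = v then l ^ 3 + 1/2 else 0)"
    if u: "u \<in> S" and v: "v \<in> S" for u v
  proof -
    have nn: "0 \<le> 9/256 * (\<eta> u + \<eta> v) + 9 * (l / N) ^ 3"
      using \<eta>[OF u] \<eta>[OF v] lN by simp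
    have q1: "13/16 \<le> q u v" using q_low[OF u v] \<eta>[OF u] \<eta>[OF v] lN by linarith
    have "(M u v - q u v) ^ 3 \<le>
      9/256 * (\<eta> u + \<eta> v) + 9 * (l / N) ^ 3 - 1/2 * (1 - A u v) + (if u = v then l ^ 3 + 1/2 else 0)"
    proof (cases "u = v")
      case True
      have "(M u v - q u v) ^ 3 \<le> l ^ 3"
        using q1 True by (intro power_mono_odd) (auto simp: M_def)
      then show ?thesis using nn True by simp
    next
      case False
      show ?thesis
      proof (cases "adj u v")
        case True
        have "(M u v - q u v) ^ 3 \<le> (\<eta> u + \<eta> v + l / N) ^ 3"
          using q_low[OF u v] True False by (intro power_mono_odd) (auto simp: M_def A_def)
        also have "\<dots> \<le> 9 * (\<eta> u ^ 3 + \<eta> v ^ 3 + (l / N) ^ 3)"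
          using \<eta>[OF u] \<eta>[OF v] lN by (intro cube_sum_le) auto
        also have "\<dots> \<le> 9/256 * (\<eta> u + \<eta> v) + 9 * (l / N) ^ 3"
          using \<eta>3[OF u] \<eta>3[OF v] by (simp add: distrib_left)
        finally show ?thesis using True False by (simp add: A_def)
      next
        case notadj: False
        have "(M u v - q u v) ^ 3 \<le> (- 13/16) ^ 3"
          using q1 notadj False by (intro power_mono_odd) (auto simp: M_def A_def)
        also have "\<dots> \<le> - 1/2" by (simp add: power3_eq_cube)
        finally show ?thesis using nn notadj False by (simp add: A_def)
      qed
    qed
    then show ?thesis by (simp add: power3_eq_cube mult.assoc)
  qed
  have "0 \<le> (\<Sum>u\<in>S. \<Sum>v\<in>S. (M u v - q u v) * ((M u v - q u v) * (M u v - q u v)))"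
    by (intro psd_sum_nonneg Schur_product fin X)
  also have "\<dots> \<le> (\<Sum>u\<in>S. \<Sum>v\<in>S. 9/256 * (\<eta> u + \<eta> v) + 9 * (l / N) ^ 3 - 1/2 * (1 - A u v)
      + (if u = v then l ^ 3 + 1/2 else 0))"
    by (intro sum_mono entry)
  also have "\<dots> = 9/256 * (2 * (N * (\<Sum>u\<in>S. \<eta> u))) + 9 * (l / N) ^ 3 * (N * N) - 1/2 * H + N * (l ^ 3 + 1/2)"
  proof -
    have "(\<Sum>u\<in>S. \<Sum>v\<in>S. \<eta> u + \<eta> v) = 2 * (N * (\<Sum>u\<in>S. \<eta> u))"
      by (simp add: sum.distrib N sum_distrib_left)
    moreover have "(\<Sum>u\<in>S. \<Sum>v\<in>S. 1 - A u v) = H" by (simp add: H_def nondeg_def)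
    moreover have "(\<Sum>u\<in>S. \<Sum>v\<in>S. if u = v then l ^ 3 + 1/2 else 0) = N * (l ^ 3 + 1/2)"
      using fin by (simp add: N)
    moreover have "(\<Sum>u\<in>S. \<Sum>v\<in>S. 9 * (l / N) ^ 3) = 9 * (l / N) ^ 3 * (N * N)"
      by (simp add: N)
    ultimately show ?thesis
      by (simp only: sum.distrib sum_subtractf sum_distrib_left[symmetric])
  qed
  also have "N * (\<Sum>u\<in>S. \<eta> u) = H"
    using N16 by (simp add: \<eta>_def H_def sum_divide_distrib[symmetric])
  also have "9 * (l / N) ^ 3 * (N * N) = 9 * l ^ 3 / N"
    using N16 by (simp add: power3_eq_cube field_simps)
  \<comment> \<open>The edges cost \<open>18/256 * H\<close>, less than the gain
    \<open>H / 2\<close> from the non-edges, so \<open>H\<close> is bounded by the remaining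
    terms.\<close>
  finally have main: "(1/2 - 18/256) * H \<le> 9 * l ^ 3 / N + N * (l ^ 3 + 1/2)" by (simp add: algebra_simps)
  have l3: "1 \<le> l ^ 3" using l_ge_1 by simp
  have "9 * l ^ 3 / N \<le> 9 * l ^ 3 / 16" using N16 l_ge_1 by (intro divide_left_mono) auto
  also have "\<dots> \<le> (N * l ^ 3) / 16" using mult_right_mono[of 9 N "l ^ 3"] N16 l_ge_1 by simp
  finally have "9 * l ^ 3 / N \<le> (N * l ^ 3) / 16" .
  moreover have "N * (1/2) \<le> N * (l ^ 3 / 2)" using l3 N16 by (intro mult_left_mono) auto
  ultimately have "(1/2 - 18/256) * H \<le> (25/16) * (N * l ^ 3)" using main by (simp add: distrib_left)
  moreover have "0 \<le> N * l ^ 3" using N16 l_ge_1 by simp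
  ultimately have "H \<le> 4 * (N * l ^ 3)" by simp
  then show ?thesis by (simp add: H_def mult_ac)
qed

text \<open>Two rounds of Markov's inequality. Discarding the vertices with more than
  \<open>N / 20\<close> non-neighbours leaves at least \<open>4/5 * N\<close>, where
  \<open>sum_nondeg_le_cubic\<close> applies since \<open>N / 20 \<le> N' / 16\<close>. The average
  non-degree is then at most \<open>4 * l ^ 3\<close>, and at most half of the vertices exceed twice
  that.\<close>

lemma near_clique:
  assumes S: "S \<subseteq> V" and N: "N = real (card S)" "20 * l \<le> N"
    and dense: "99/100 * N\<^sup>2 \<le> ec S"
  obtains S' where "S' \<subseteq> S" "N / 4 \<le> real (card S')" "\<And>v. v \<in> S' \<Longrightarrow> nondeg S' v \<le> 8 * l ^ 3"
proof -
  have fin: "finite S" by (rule finite_subset_V[OF S])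
  have N20: "20 \<le> N" using N l_ge_1 by simp
  define R where "R = {v \<in> S. nondeg S v \<le> N / 20}"
  define N' where "N' = real (card R)"
  have R: "R \<subseteq> S" "finite R" using fin by (auto simp: R_def)
  have "N / 20 * (N - N') \<le> N\<^sup>2 / 100"
  proof -
    have "N / 20 * (N - N') \<le> (\<Sum>v\<in>S. nondeg S v)"
      unfolding N'_def R_def N(1) using N20 N nondeg_nonneg by (intro Markov_card fin) auto
    also have "\<dots> \<le> N\<^sup>2 / 100" using dense by (simp add: sum_nondeg N(1))
    finally show ?thesis .
  qed
  then have N': "4/5 * N \<le> N'" using N20 by (simp add: power2_eq_square field_simps)
  have "(\<Sum>v\<in>R. nondeg R v) \<le> 4 * l ^ 3 * N'"
  proof (rule sum_nondeg_le_cubic)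
    fix v assume "v \<in> R"
    then have "nondeg R v \<le> N / 20" using nondeg_mono[OF R(1) fin, of v] by (simp add: R_def)
    then show "nondeg R v \<le> N' / 16" using N' by simp
  qed (use R S N N' in \<open>auto simp: N'_def\<close>)
  define S' where "S' = {v \<in> R. nondeg R v \<le> 8 * l ^ 3}"
  have l3: "0 < 8 * l ^ 3" using l_ge_1 by simp
  have "8 * l ^ 3 * (N' - real (card S')) \<le> (\<Sum>v\<in>R. nondeg R v)"
    unfolding N'_def S'_def using l3 nondeg_nonneg R by (intro Markov_card) auto
  also have "\<dots> \<le> 4 * l ^ 3 * N'" by fact
  finally have "8 * l ^ 3 * (N' - real (card S')) \<le> 8 * l ^ 3 * (N' / 2)" by simp
  then have "N' - real (card S') \<le> N' / 2" using l3 by (simp only: mult_le_cancel_left_pos)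
  then have "N / 4 \<le> real (card S')" using N' N20 by simp
  moreover have "nondeg S' v \<le> 8 * l ^ 3" if "v \<in> S'" for v
    using that nondeg_mono[of S' R v] R by (auto simp: S'_def)
  ultimately show thesis using that[of S'] R by (auto simp: S'_def)
qed

end

section \<open>Attaching vertices to a near-clique\<close>

lemma sum_if_weights:
  fixes g :: "'a \<Rightarrow> real"
  assumes "finite W" "X \<subseteq> W"
  shows "(\<Sum>w\<in>W. g w * (if w \<in> X then c else 0)) = c * (\<Sum>w\<in>X. g w)"
proof -
  have "(\<Sum>w\<in>W. g w * (if w \<in> X then c else 0)) = (\<Sum>w\<in>X. g w * (if w \<in> X then c else 0))"
    using assms by (intro sum.mono_neutral_right) auto
  then show ?thesis by (simp add: sum_distrib_left mult.commute)
qed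

context graph_with_shift
begin

text \<open>Cauchy-Schwarz for \<open>M\<close> against the unit vector at \<open>v\<close>, where
  \<open>M v v = l\<close>. It is applied to weights \<open>y\<close> whose form is small, so that
  every row must nearly annihilate them.\<close>

lemma row_test:
  assumes "v \<in> V"
  shows "(\<Sum>w\<in>V. M v w * y w)\<^sup>2 \<le> l * bil V M y y"
proof -
  let ?x = "\<lambda>u. if u = v then 1 else (0::real)"
  have "bil V M ?x y = (\<Sum>w\<in>V. M v w * y w)"
    unfolding bil_rowsum using assms finite_V
    by (simp add: if_distribR if_distrib sum.delta cong: if_cong)
  moreover have "bil V M ?x ?x = l" by (simp add: bil_unit_unit[OF finite_V assms] M_def)
  ultimately show ?thesis using psd_Cauchy_Schwarz[OF psd_M[OF order.refl], of ?x y] by simp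
qed

text \<open>The test vector is \<open>1/a\<close> on the \<open>a\<close> neighbours and \<open>-1/b\<close> on the \<open>b\<close> non-neighbours of \<open>v\<close> in \<open>S\<close>. Its entries sum to
  zero, so only the few non-edges inside \<open>S\<close> contribute to its quadratic form.\<close>

lemma few_neighbours_or_few_nonneighbours:
  assumes S: "S \<subseteq> V" and h: "\<And>v. v \<in> S \<Longrightarrow> nondeg S v \<le> 8 * l ^ 3" and v: "v \<in> V"
  shows "deg S v \<le> 18 * l ^ 4 \<or> nondeg S v \<le> 18 * l ^ 4"
proof (rule ccontr)
  assume "\<not> ?thesis"
  then have big: "18 * l ^ 4 < deg S v" "18 * l ^ 4 < nondeg S v" by auto
  have fin: "finite S" by (rule finite_subset_V[OF S])
  have l34: "0 < l" "l ^ 3 \<le> l ^ 4" "l \<le> l ^ 3" "0 < l ^ 4"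
    using l_ge_1 power_increasing[of 1 3 l] by (auto intro: power_increasing)
  have vS: "v \<notin> S" using h[of v] big l34 by fastforce
  define a b where "a = deg S v" and "b = nondeg S v"
  have ab: "0 < a" "0 < b" using big l34 by (auto simp: a_def b_def intro: le_less_trans[rotated])
  define y where "y = (\<lambda>w. if adj v w then 1 / a else - 1 / b)"
  define y' where "y' = (\<lambda>w. if w \<in> S then y w else 0)"
  have ay: "y w = A v w * (1 / a) + (1 - A v w) * (- 1 / b)" for w by (simp add: y_def A_def)
  have s1: "(\<Sum>w\<in>S. A v w * y w) = 1"
  proof -
    have "(\<Sum>w\<in>S. A v w * y w) = (\<Sum>w\<in>S. A v w * (1 / a))"
      by (intro sum.cong) (auto simp: y_def A_def)
    also have "\<dots> = a * (1 / a)" unfolding a_def deg_def by (rule sum_distrib_right[symmetric])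
    finally show ?thesis using ab by simp
  qed
  have s0: "(\<Sum>w\<in>S. y w) = 0"
  proof -
    have "(\<Sum>w\<in>S. y w) = a * (1 / a) + b * (- 1 / b)"
      unfolding ay sum.distrib a_def b_def deg_def nondeg_def by (simp only: sum_distrib_right)
    then show ?thesis using ab by simp
  qed
  have s2: "nsq S y = 1 / a + 1 / b"
  proof -
    have "nsq S y = (\<Sum>w\<in>S. A v w * (1 / a * (1 / a)) + (1 - A v w) * (1 / b * (1 / b)))"
      unfolding nsq_def by (intro sum.cong) (auto simp: y_def A_def power2_eq_square)
    also have "\<dots> = a * (1 / a * (1 / a)) + b * (1 / b * (1 / b))"
      unfolding sum.distrib a_def b_def deg_def nondeg_def by (simp only: sum_distrib_right)
    finally show ?thesis using ab by simp
  qed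
  have "(\<Sum>w\<in>V. M v w * y' w) = (\<Sum>w\<in>S. M v w * y w)"
    unfolding y'_def using finite_V S by (intro sum.mono_neutral_cong_right) auto
  also have "\<dots> = (\<Sum>w\<in>S. A v w * y w)" using vS by (intro sum.cong) (auto simp: M_def)
  finally have row: "(\<Sum>w\<in>V. M v w * y' w) = 1" using s1 by simp
  have "bil V M y' y' = bil S M y y" unfolding y'_def by (rule bil_support[OF finite_V S])
  also have "\<dots> = bil S A y y + l * nsq S y"
    unfolding M_def by (simp add: bil_add_kernel bil_scalar fin)
  also have "bil S A y y \<le> 8 * l ^ 3 * nsq S y"
  proof -
    have "bil S A y y = (\<Sum>u\<in>S. \<Sum>w\<in>S. y u * y w - (1 - A u w) * (y u * y w))"
      unfolding bil_def by (intro sum.cong refl) (simp add: algebra_simps)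
    also have "\<dots> = (\<Sum>u\<in>S. y u) * (\<Sum>w\<in>S. y w) + (\<Sum>u\<in>S. \<Sum>w\<in>S. - ((1 - A u w) * (y u * y w)))"
      by (simp add: sum_product sum_subtractf sum_negf)
    also have "\<dots> \<le> (\<Sum>u\<in>S. \<Sum>w\<in>S. (1 - A u w) * ((y u)\<^sup>2 / 2) + (1 - A u w) * ((y w)\<^sup>2 / 2))"
    proof -
      have "- ((1 - A u w) * (y u * y w)) \<le> (1 - A u w) * ((y u)\<^sup>2 / 2) + (1 - A u w) * ((y w)\<^sup>2 / 2)" for u w
      proof -
        have "0 \<le> (1 - A u w) * ((y u + y w)\<^sup>2 / 2)" by simp
        then show ?thesis by (simp add: power2_eq_square algebra_simps add_divide_distrib)
      qed
      then show ?thesis unfolding s0 mult_zero_left add_0_left by (intro sum_mono)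
    qed
    also have "\<dots> = (\<Sum>u\<in>S. nondeg S u * (y u)\<^sup>2)"
    proof -
      have 1: "(\<Sum>u\<in>S. \<Sum>w\<in>S. (1 - A u w) * ((y u)\<^sup>2 / 2)) = (\<Sum>u\<in>S. nondeg S u * ((y u)\<^sup>2 / 2))"
        by (simp only: nondeg_def sum_distrib_right)
      moreover have "(\<Sum>u\<in>S. \<Sum>w\<in>S. (1 - A u w) * ((y w)\<^sup>2 / 2)) = (\<Sum>w\<in>S. nondeg S w * ((y w)\<^sup>2 / 2))"
        by (subst sum.swap) (simp only: nondeg_def sum_distrib_right A_commute)
      ultimately show ?thesis by (simp add: sum.distrib flip: sum_divide_distrib)
    qed
    also have "\<dots> \<le> (\<Sum>u\<in>S. 8 * l ^ 3 * (y u)\<^sup>2)" using h by (intro sum_mono mult_right_mono) auto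
    finally show ?thesis by (simp add: nsq_def sum_distrib_left)
  qed
  also have "8 * l ^ 3 * nsq S y + l * nsq S y \<le> 9 * l ^ 3 * nsq S y"
    using mult_right_mono[OF l34(3) nsq_nonneg[of S y]] by linarith
  finally have "bil V M y' y' \<le> 9 * l ^ 3 * nsq S y" by simp
  then have "l * bil V M y' y' \<le> l * (9 * l ^ 3 * nsq S y)" using l34 by (intro mult_left_mono) auto
  then have "1 \<le> l * (9 * l ^ 3 * nsq S y)" using row_test[OF v, of y'] row by simp
  also have "\<dots> = 9 * l ^ 4 * (1 / a + 1 / b)" by (simp add: s2 power3_eq_cube eval_nat_numeral)
  \<comment> \<open>The threshold \<open>18 * l ^ 4\<close> is twice the factor
    \<open>9 * l ^ 4\<close>, so each of the two reciprocals contributes less than 1/2.\<close>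
  also have "\<dots> < 9 * l ^ 4 * (1 / (18 * l ^ 4) + 1 / (18 * l ^ 4))"
    using big l34 ab by (intro mult_strict_left_mono add_strict_mono divide_strict_left_mono)
      (auto simp: a_def b_def)
  also have "\<dots> = 1" using l34 by simp
  finally show False by simp
qed

text \<open>Since \<open>T\<close> sees almost all of \<open>S\<close>, the difference of the uniform weights on \<open>T\<close> and on \<open>S\<close> has quadratic form
  about \<open>l / |T|\<close>.\<close>

lemma attached_set_small:
  assumes S: "S \<subseteq> V" and N: "N = real (card S)" "300 * l ^ 5 \<le> N"
    and z: "z \<in> V" and T: "T \<subseteq> V" "\<And>u. u \<in> T \<Longrightarrow> nondeg S u \<le> 18 * l ^ 4"
    and gap: "1/2 \<le> \<bar>(\<Sum>w\<in>T. M z w) / real (card T) - (\<Sum>w\<in>S. M z w) / N\<bar>"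
  shows "real (card T) \<le> 8 * l\<^sup>2"
proof (cases "T = {}")
  case False
  define K where "K = 18 * l ^ 4"
  define t where "t = real (card T)"
  have finS: "finite S" and finT: "finite T" using S T finite_subset_V by blast+
  have t1: "1 \<le> t" using False finT by (simp add: t_def Suc_leI card_gt_0_iff)
  have l0: "0 < l" using l_ge_1 by simp
  have N0: "0 < N" using N(2) l0 by (smt (verit) zero_less_power)
  define y where "y = (\<lambda>w. (if w \<in> T then 1 / t else 0) + (if w \<in> S then - 1 / N else 0))"
  have row: "(\<Sum>w\<in>V. M u w * y w) = (\<Sum>w\<in>T. M u w) / t - (\<Sum>w\<in>S. M u w) / N" for u
    unfolding y_def distrib_left sum.distrib
    using sum_if_weights[OF finite_V S, of "M u" "- 1 / N"] sum_if_weights[OF finite_V T(1), of "M u" "1 / t"]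
    by simp
  define m where "m = (\<lambda>X Y. \<Sum>u\<in>X. \<Sum>w\<in>Y. M u w)"
  have "bil V M y y = (\<Sum>u\<in>V. ((\<Sum>w\<in>T. M u w) / t - (\<Sum>w\<in>S. M u w) / N) * y u)"
    unfolding bil_rowsum row by (simp add: mult.commute)
  also have "\<dots> = (\<Sum>u\<in>T. (\<Sum>w\<in>T. M u w) / t - (\<Sum>w\<in>S. M u w) / N) / t
      - (\<Sum>u\<in>S. (\<Sum>w\<in>T. M u w) / t - (\<Sum>w\<in>S. M u w) / N) / N"
    unfolding y_def distrib_left sum.distrib
    using sum_if_weights[OF finite_V S, of _ "- 1 / N"] sum_if_weights[OF finite_V T(1), of _ "1 / t"]
    by simp
  also have "\<dots> = m T T / t / t - m T S / N / t - (m S T / t - m S S / N) / N"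
    by (simp add: m_def sum_subtractf sum_divide_distrib diff_divide_distrib)
  also have "m S T = m T S"
    unfolding m_def by (subst sum.swap) (intro sum.cong refl M_commute)
  finally have byy: "bil V M y y = m T T / t / t - 2 * (m T S / N / t) + m S S / N / N"
    by (simp add: diff_divide_distrib mult.commute)
  have mXX: "m X X \<le> real (card X) * (real (card X) + l)" if "finite X" for X
  proof -
    have "m X X = ec X + real (card X) * l"
      unfolding m_def M_def using that by (simp add: sum.distrib ec_def)
    then show ?thesis using ec_le_card_sq[of X] by (simp add: power2_eq_square distrib_left)
  qed
  have "m T T / t / t \<le> t * (t + l) / t / t"
    using mXX[OF finT] t1 by (intro divide_right_mono) (auto simp: t_def)
  then have b1: "m T T / t / t \<le> 1 + l / t" using t1 by (simp add: add_divide_distrib)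
  have "m S S / N / N \<le> N * (N + l) / N / N"
    using mXX[OF finS] N0 by (intro divide_right_mono) (auto simp: N(1))
  then have b2: "m S S / N / N \<le> 1 + l / N" using N0 by (simp add: add_divide_distrib)
  have "(\<Sum>u\<in>T. N - K) \<le> m T S"
    unfolding m_def
  proof (rule sum_mono)
    fix u assume "u \<in> T"
    then have "N - K \<le> deg S u" using T(2)[of u] by (simp add: nondeg_eq K_def N(1))
    also have "\<dots> \<le> (\<Sum>w\<in>S. M u w)" unfolding deg_def by (rule sum_mono) (use l0 in \<open>simp add: M_def\<close>)
    finally show "N - K \<le> (\<Sum>w\<in>S. M u w)" .
  qed
  then have "t * (N - K) / N / t \<le> m T S / N / t"
    using t1 N0 by (intro divide_right_mono) (auto simp: t_def)
  then have b3: "1 - K / N \<le> m T S / N / t" using t1 N0 by (simp add: diff_divide_distrib)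
  \<comment> \<open>The averages of \<open>M\<close> over the pairs of \<open>T\<close> and
    \<open>S\<close> enter with coefficients 1, -2 and 1, so that the main terms cancel.\<close>
  have b: "bil V M y y \<le> l / t + (l + 2 * K) / N"
    using b1 b2 b3 byy by (simp add: add_divide_distrib)
  have "1/4 \<le> (\<Sum>w\<in>V. M z w * y w)\<^sup>2"
    using power_mono[OF gap, of 2] row by (simp add: t_def power2_eq_square)
  also have "\<dots> \<le> l * bil V M y y" by (rule row_test[OF z])
  also have "\<dots> \<le> l * (l / t + (l + 2 * K) / N)" using b l0 by (intro mult_left_mono) auto
  also have "\<dots> = l * l / t + l * (l + 2 * K) / N" by (simp add: distrib_left)
  \<comment> \<open>The constant 300 in the lower bound on \<open>N\<close> covers
    \<open>8 * (1 + 2 * 18) = 296\<close>.\<close>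
  also have "l * (l + 2 * K) / N \<le> 1/8"
  proof -
    have "l \<le> l ^ 4" using power_increasing[of 1 4 l] l_ge_1 by simp
    then have "8 * (l * (l + 2 * K)) \<le> 8 * (l * (37 * l ^ 4))" using l0 by (intro mult_left_mono) (auto simp: K_def)
    also have "\<dots> = 296 * l ^ 5" by (simp add: eval_nat_numeral)
    also have "\<dots> \<le> 300 * l ^ 5" using l0 by simp
    also have "\<dots> \<le> N" by fact
    finally have "8 * (l * (l + 2 * K)) \<le> N" .
    then show ?thesis using N0 by (simp add: field_simps)
  qed
  finally have "1/8 \<le> l * l / t" by linarith
  then show ?thesis using t1 by (simp add: field_simps power2_eq_square t_def)
qed simp

text \<open>\<open>C\<close> collects the vertices of \<open>W\<close> joined to nearly all of
  \<open>S\<close>; by \<open>few_neighbours_or_few_nonneighbours\<close> every other vertex of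
  \<open>W\<close> is joined to only few vertices of \<open>S\<close>. The non-neighbours in
  \<open>C\<close> of some \<open>v\<close> in \<open>C\<close>, or the neighbours in
  \<open>C\<close> of some \<open>z\<close> outside, see that vertex quite differently from
  \<open>S\<close>, so \<open>attached_set_small\<close> bounds their number.\<close>

lemma clique_like_piece:
  assumes W: "W \<subseteq> V" and S: "S \<subseteq> W" and N: "N = real (card S)" "300 * l ^ 5 \<le> N"
    and h: "\<And>v. v \<in> S \<Longrightarrow> nondeg S v \<le> 8 * l ^ 3"
  obtains C where "S \<subseteq> C" "C \<subseteq> W"
    "\<And>v. v \<in> C \<Longrightarrow> real (card {w \<in> C. w \<noteq> v \<and> \<not> adj v w}) \<le> 8 * l\<^sup>2"
    "\<And>z. z \<in> W - C \<Longrightarrow> real (card {w \<in> C. adj z w}) \<le> 8 * l\<^sup>2"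
proof -
  define K where "K = 18 * l ^ 4"
  have SV: "S \<subseteq> V" using S W by blast
  define C where "C = {v \<in> W. nondeg S v \<le> K}"
  have l1: "1 \<le> l ^ 3" "l ^ 3 \<le> l ^ 4" "l ^ 4 \<le> l ^ 5" "l \<le> l ^ 5" "1 \<le> l ^ 5"
    using l_ge_1 power_increasing[of 1 5 l] by (auto intro: power_increasing)
  have N0: "0 < N" using N(2) l1 by linarith
  have KlN: "K + l \<le> N / 2" using N(2) l1 by (simp add: K_def)
  have SC: "S \<subseteq> C"
  proof
    fix v assume v: "v \<in> S"
    then have "nondeg S v \<le> K" using h[OF v] l1 by (simp add: K_def)
    then show "v \<in> C" using v S by (auto simp: C_def)
  qed
  have finC: "finite C" using W finite_subset_V by (auto simp: C_def intro: finite_subset)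
  have rowS: "deg S v \<le> (\<Sum>w\<in>S. M v w)" "(\<Sum>w\<in>S. M v w) \<le> deg S v + l" for v
  proof -
    have "(\<Sum>w\<in>S. M v w) = deg S v + (\<Sum>w\<in>S. if v = w then l else 0)"
      by (simp add: M_def sum.distrib deg_def)
    moreover have "(\<Sum>w\<in>S. if v = w then l else 0) = (if v \<in> S then l else 0)"
      using finite_subset_V[OF SV] by simp
    ultimately show "deg S v \<le> (\<Sum>w\<in>S. M v w)" "(\<Sum>w\<in>S. M v w) \<le> deg S v + l"
      using l_ge_1 by auto
  qed
  show thesis
  proof (rule that[of C])
    show "C \<subseteq> W" by (auto simp: C_def)
    show "S \<subseteq> C" by (rule SC)
  next
    fix v assume v: "v \<in> C"
    let ?T = "{w \<in> C. w \<noteq> v \<and> \<not> adj v w}"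
    show "real (card ?T) \<le> 8 * l\<^sup>2"
    proof (rule attached_set_small[OF SV N])
      show "1/2 \<le> \<bar>(\<Sum>w\<in>?T. M v w) / real (card ?T) - (\<Sum>w\<in>S. M v w) / N\<bar>"
      proof -
        have "(\<Sum>w\<in>?T. M v w) = 0" by (intro sum.neutral) (auto simp: M_def A_def)
        moreover have "N / 2 \<le> (\<Sum>w\<in>S. M v w)"
          using rowS(1)[of v] v KlN l_ge_1 by (simp add: C_def nondeg_eq N(1))
        then have "1/2 \<le> (\<Sum>w\<in>S. M v w) / N" using N0 by (simp add: field_simps)
        ultimately show ?thesis by (simp only: div_0)
      qed
    qed (use v W in \<open>auto simp: C_def K_def\<close>)
  next
    fix z assume z: "z \<in> W - C"
    let ?T = "{w \<in> C. adj z w}"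
    show "real (card ?T) \<le> 8 * l\<^sup>2"
    \<comment> \<open>For empty \<open>?T\<close> the average over \<open>?T\<close> would be 0 by
      division by zero, and not 1.\<close>
    proof (cases "?T = {}")
      case True
      then show ?thesis by (simp only: card.empty of_nat_0) simp
    next
      case False
      show ?thesis
      proof (rule attached_set_small[OF SV N])
        show "1/2 \<le> \<bar>(\<Sum>w\<in>?T. M z w) / real (card ?T) - (\<Sum>w\<in>S. M z w) / N\<bar>"
        proof -
          have "(\<Sum>w\<in>?T. M z w) = (\<Sum>w\<in>?T. 1)"
            by (intro sum.cong) (auto simp: M_def A_def adj_irrefl)
          then have "(\<Sum>w\<in>?T. M z w) / real (card ?T) = 1" using False finC by simp
          moreover have "deg S z \<le> K"
            using few_neighbours_or_few_nonneighbours[OF SV h, of z] z W by (auto simp: C_def K_def)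
          then have "(\<Sum>w\<in>S. M z w) \<le> N / 2" using rowS(2)[of z] KlN by simp
          then have "(\<Sum>w\<in>S. M z w) / N \<le> 1/2" using N0 by (simp add: field_simps)
          ultimately show ?thesis by linarith
        qed
      qed (use z W in \<open>auto simp: C_def K_def\<close>)
    qed
  qed
qed

end

section \<open>Greedy removal\<close>

context graph_with_shift
begin

lemma ec_eq_card: "finite W \<Longrightarrow> ec W = real (card {(u, v). u \<in> W \<and> v \<in> W \<and> adj u v})"
proof -
  assume W: "finite W"
  have "ec W = (\<Sum>(u, v)\<in>W \<times> W. A u v)" by (simp add: ec_def sum.cartesian_product)
  also have "\<dots> = (\<Sum>q\<in>W \<times> W. if adj (fst q) (snd q) then 1 else 0)"
    by (intro sum.cong) (auto simp: A_def)
  also have "\<dots> = real (card {q \<in> W \<times> W. adj (fst q) (snd q)})"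
    using W by (simp add: sum.If_cases Int_def)
  also have "{q \<in> W \<times> W. adj (fst q) (snd q)} = {(u, v). u \<in> W \<and> v \<in> W \<and> adj u v}" by auto
  finally show ?thesis by simp
qed

text \<open>\<open>S\<close> maximises \<open>ec T / card T powr (3/2)\<close>. Comparison with
  \<open>W\<close> gives \<open>p * sqrt N \<ge> n powr (1/2 - 1/2000000)\<close>; since
  \<open>p \<le> 1\<close> and \<open>N \<le> n\<close>, the set is both large and not too sparse,
  as \<open>extremal_dense\<close> requires.\<close>

lemma extremal_clique_like_piece:
  fixes n :: real
  assumes n: "n = real (card V)" and l: "l \<le> n powr (1/4000000)"
    and large: "\<And>x. n powr (1/2) \<le> x \<Longrightarrow> large_enough x"
    and ln: "1200 * l ^ 5 \<le> n powr (1/2)"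
    and W: "W \<subseteq> V" and ecW: "n powr (2 - 1/2000000) < ec W"
  obtains C where "C \<subseteq> W" "n powr (1/2) / 4 \<le> real (card C)"
    "\<And>v. v \<in> C \<Longrightarrow> real (card {w \<in> C. w \<noteq> v \<and> \<not> adj v w}) \<le> 8 * l\<^sup>2"
    "\<And>z. z \<in> W - C \<Longrightarrow> real (card {w \<in> C. adj z w}) \<le> 8 * l\<^sup>2"
proof -
  have finW: "finite W" by (rule finite_subset_V[OF W])
  have "0 < ec W" using ecW powr_ge_zero[of n "2 - 1/2000000"] by linarith
  then have "W \<noteq> {}" by (auto simp: ec_def)
  then have cW: "1 \<le> real (card W)" "real (card W) \<le> n"
    using finW card_mono[OF finite_V W] by (auto simp: n Suc_le_eq card_gt_0_iff)
  have n1: "1 \<le> n" using cW by simp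
  define \<phi> where "\<phi> = (\<lambda>T. ec T / real (card T) powr (3/2))"
  define \<X> where "\<X> = {T. T \<subseteq> W \<and> T \<noteq> {}}"
  have \<X>: "finite \<X>" "W \<in> \<X>" using finW \<open>W \<noteq> {}\<close> by (auto simp: \<X>_def)
  obtain S where S: "S \<in> \<X>" "\<And>T. T \<in> \<X> \<Longrightarrow> \<phi> T \<le> \<phi> S"
    using \<X> Max_in[of "\<phi> ` \<X>"] Max_ge[of "\<phi> ` \<X>"] by (metis (no_types, lifting) empty_iff finite_imageI image_iff imageI)
  then have SW: "S \<subseteq> W" "S \<noteq> {}" by (auto simp: \<X>_def)
  then have SV: "S \<subseteq> V" using W by blast
  define N where "N = real (card S)"
  have finS: "finite S" by (rule finite_subset_V[OF SV])
  have N1: "1 \<le> N" using SW finS by (simp add: N_def Suc_le_eq card_gt_0_iff)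
  have Nn: "N \<le> n" using card_mono[OF finite_V SV] by (simp add: N_def n)
  define p where "p = ec S / N\<^sup>2"
  have p: "ec S = p * N\<^sup>2" using N1 by (simp add: p_def)
  have p0: "0 \<le> p" by (simp add: p_def ec_nonneg)
  have p1: "p \<le> 1" using ec_le_card_sq[of S] N1 by (simp add: p_def N_def[symmetric])
  have \<phi>S: "\<phi> S = p * sqrt N"
  proof -
    have "N powr 2 = N powr (3/2) * N powr (1/2)" by (simp only: powr_add[symmetric]) simp
    then have "N\<^sup>2 = N powr (3/2) * sqrt N" using N1 by (simp add: powr_half_sqrt)
    then show ?thesis using N1 by (simp add: \<phi>_def N_def[symmetric] p)
  qed
  have ext: "ec T \<le> p * sqrt N * real (card T) powr (3/2)" if "T \<subseteq> S" for T
  proof (cases "T = {}")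
    case False
    then have "\<phi> T \<le> p * sqrt N" using S(2)[of T] that SW unfolding \<phi>S by (auto simp: \<X>_def)
    moreover have "0 < real (card T)" using False that finS finite_subset by (auto simp: card_gt_0_iff)
    ultimately show ?thesis by (simp add: \<phi>_def pos_divide_le_eq)
  qed (simp add: ec_def)
  have pN: "n powr (1/2 - 1/2000000) \<le> p * sqrt N"
  proof -
    have "n powr (1/2 - 1/2000000) = n powr (2 - 1/2000000) / n powr (3/2)"
      by (simp only: powr_diff[symmetric]) simp
    also have "\<dots> \<le> ec W / real (card W) powr (3/2)"
      using ecW cW ec_nonneg by (intro frac_le powr_mono2) auto
    also have "\<dots> \<le> \<phi> S" using S(2)[OF \<X>(2)] by (simp add: \<phi>_def)
    finally show ?thesis unfolding \<phi>S .
  qed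
  have nN: "n powr (1/2) \<le> N"
  proof -
    have "p * sqrt N \<le> 1 * sqrt N" using p1 N1 by (intro mult_right_mono) auto
    then have "n powr (1/4) \<le> sqrt N"
      using pN powr_mono[of "1/4" "1/2 - 1/2000000" n] n1 by linarith
    then have "(n powr (1/4))\<^sup>2 \<le> (sqrt N)\<^sup>2" by (intro power_mono) auto
    moreover have "(n powr (1/4))\<^sup>2 = n powr (1/2)"
      by (simp add: power2_eq_square powr_add[symmetric])
    ultimately show ?thesis using N1 by simp
  qed
  have pn: "n powr (- 1/2000000) \<le> p"
  proof -
    have "n powr (1/2) * n powr (- 1/2000000) = n powr (1/2 - 1/2000000)"
      by (simp only: powr_add[symmetric]) simp
    also have "\<dots> \<le> p * sqrt N" by (rule pN)
    also have "\<dots> \<le> p * n powr (1/2)"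
      using p0 Nn n1 by (intro mult_left_mono) (auto simp: powr_half_sqrt)
    finally show ?thesis using n1 by (simp add: mult.commute)
  qed
  have "99/100 \<le> p"
  proof (rule extremal_dense[OF SV N_def large[OF nN] _ p _ ext])
    have "n powr (1/4000000) = (n powr (1/2)) powr (1/2000000)" by (simp add: powr_powr)
    also have "\<dots> \<le> N powr (1/2000000)" using nN by (intro powr_mono2) auto
    also have "\<dots> \<le> N powr (1/1000000)" using N1 by (intro powr_mono) auto
    finally show "l \<le> N powr (1/1000000)" using l by simp
    have "N powr (-1/1000000) \<le> (n powr (1/2)) powr (-1/1000000)"
      using nN n1 by (intro powr_mono2') auto
    also have "\<dots> = n powr (- 1/2000000)" by (simp add: powr_powr)
    finally show "N powr (-1/1000000) \<le> p" using pn by simp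
  qed
  then have dense: "99/100 * N\<^sup>2 \<le> ec S" unfolding p by (rule mult_right_mono) simp
  have l5: "l \<le> l ^ 5" "1 \<le> l ^ 5" using power_increasing[of 1 5 l] l_ge_1 by auto
  have "20 * l \<le> N" using l5 ln nN by linarith
  from near_clique[OF SV N_def this dense] obtain S' where
    S': "S' \<subseteq> S" "N / 4 \<le> real (card S')" and h: "\<And>v. v \<in> S' \<Longrightarrow> nondeg S' v \<le> 8 * l ^ 3" by blast
  have "300 * l ^ 5 \<le> real (card S')" using S'(2) ln nN by linarith
  have "S' \<subseteq> W" using S' SW by blast
  show thesis
  proof (rule clique_like_piece[OF W \<open>S' \<subseteq> W\<close> refl \<open>300 * l ^ 5 \<le> real (card S')\<close> h])
    fix C
    assume C: "S' \<subseteq> C" "C \<subseteq> W"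
      "\<And>v. v \<in> C \<Longrightarrow> real (card {w \<in> C. w \<noteq> v \<and> \<not> adj v w}) \<le> 8 * l\<^sup>2"
      "\<And>z. z \<in> W - C \<Longrightarrow> real (card {w \<in> C. adj z w}) \<le> 8 * l\<^sup>2"
    have "card S' \<le> card C" by (rule card_mono[OF finite_subset[OF C(2) finW] C(1)])
    then have "n powr (1/2) / 4 \<le> real (card C)" using S'(2) nN by linarith
    then show thesis by (rule that[OF C(2) _ C(3,4)])
  qed
qed

text \<open>Ordered pairs are counted, so every edge to be changed is counted twice.\<close>

definition disagreement :: "'a set set \<Rightarrow> 'a set \<Rightarrow> ('a \<times> 'a) set" where
  "disagreement P W = {(u, v). u \<in> W \<and> v \<in> W \<and> u \<noteq> v \<and> (adj u v \<noteq> (\<exists>B\<in>P. u \<in> B \<and> v \<in> B))}"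

lemma finite_disagreement: "finite W \<Longrightarrow> finite (disagreement P W)"
  by (rule finite_subset[of _ "W \<times> W"]) (auto simp: disagreement_def)

text \<open>A pair that is not already wrong in \<open>W - C\<close> is a missing edge inside
  \<open>C\<close> or an edge leaving \<open>C\<close>; the latter occurs in both orientations,
  hence the swapped copy.\<close>

lemma disagreement_insert_subset:
  assumes "C \<subseteq> W" "\<Union>P = W - C"
  shows "disagreement (insert C P) W \<subseteq> disagreement P (W - C)
    \<union> Sigma C (\<lambda>v. {w \<in> C. w \<noteq> v \<and> \<not> adj v w})
    \<union> Sigma (W - C) (\<lambda>z. {w \<in> C. adj z w})
    \<union> prod.swap ` Sigma (W - C) (\<lambda>z. {w \<in> C. adj z w})"
    (is "_ \<subseteq> ?R")
proof (rule subrelI)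
  fix u v
  assume "(u, v) \<in> disagreement (insert C P) W"
  then have uv: "u \<in> W" "v \<in> W" "u \<noteq> v" "adj u v \<noteq> (u \<in> C \<and> v \<in> C \<or> (\<exists>B\<in>P. u \<in> B \<and> v \<in> B))"
    by (simp_all add: disagreement_def)
  have out: "B \<subseteq> W - C" if "B \<in> P" for B using that assms(2) by blast
  consider "u \<in> C" "v \<in> C" | "u \<in> C" "v \<notin> C" | "u \<notin> C" "v \<in> C" | "u \<notin> C" "v \<notin> C" by blast
  then show "(u, v) \<in> ?R"
  proof cases
    case 1
    then show ?thesis using uv by blast
  next
    case 2
    then have "adj v u" using uv out adj_commute[of u v] by blast
    then have "(v, u) \<in> Sigma (W - C) (\<lambda>z. {w \<in> C. adj z w})" using 2 uv by blast
    then have "prod.swap (v, u) \<in> prod.swap ` Sigma (W - C) (\<lambda>z. {w \<in> C. adj z w})"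
      by (rule imageI)
    then show ?thesis by simp
  next
    case 3
    then have "adj u v" using uv out by blast
    then show ?thesis using 3 uv by blast
  next
    case 4
    then show ?thesis using uv by (simp add: disagreement_def)
  qed
qed

text \<open>Each removal deletes at least \<open>L\<close> vertices, so there are at most
  \<open>card W / L\<close> rounds, each costing at most \<open>16 * l\<^sup>2 * card V\<close>
  ordered pairs. When at most \<open>\<theta>\<close> ordered adjacent pairs are left, singletons
  serve as blocks.\<close>

lemma greedy_partition:
  assumes "W \<subseteq> V" and L: "0 < L"
    and piece: "\<And>W'. W' \<subseteq> V \<Longrightarrow> \<theta> < ec W' \<Longrightarrow> \<exists>C\<subseteq>W'. L \<le> real (card C)
      \<and> (\<forall>v\<in>C. real (card {w \<in> C. w \<noteq> v \<and> \<not> adj v w}) \<le> 8 * l\<^sup>2)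
      \<and> (\<forall>z\<in>W' - C. real (card {w \<in> C. adj z w}) \<le> 8 * l\<^sup>2)"
  shows "\<exists>P. partition_on W P \<and>
    real (card (disagreement P W)) \<le> \<theta> + 16 * l\<^sup>2 * real (card V) * (real (card W) / L)"
proof -
  have "finite W" by (rule finite_subset_V[OF assms(1)])
  then show ?thesis using assms(1)
  proof (induction W rule: finite_psubset_induct)
    case (psubset W)
    show ?case
    proof (cases "\<theta> < ec W")
      case False
      define P where "P = (\<lambda>x. {x}) ` W"
      have "partition_on W P" by (auto simp: partition_on_def P_def disjoint_def)
      moreover have "disagreement P W \<subseteq> {(u, v). u \<in> W \<and> v \<in> W \<and> adj u v}"
        by (auto simp: disagreement_def P_def)
      then have "card (disagreement P W) \<le> card {(u, v). u \<in> W \<and> v \<in> W \<and> adj u v}"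
      proof (rule card_mono[rotated])
        show "finite {(u, v). u \<in> W \<and> v \<in> W \<and> adj u v}"
          by (rule finite_subset[of _ "W \<times> W"]) (use psubset.hyps in auto)
      qed
      then have "real (card (disagreement P W)) \<le> ec W" using psubset.hyps by (simp add: ec_eq_card)
      moreover have "0 \<le> 16 * l\<^sup>2 * real (card V) * (real (card W) / L)" using L by simp
      ultimately show ?thesis using False by (intro exI[of _ P]) linarith
    next
      case True
      obtain C where C: "C \<subseteq> W" "L \<le> real (card C)"
        "\<And>v. v \<in> C \<Longrightarrow> real (card {w \<in> C. w \<noteq> v \<and> \<not> adj v w}) \<le> 8 * l\<^sup>2"
        "\<And>z. z \<in> W - C \<Longrightarrow> real (card {w \<in> C. adj z w}) \<le> 8 * l\<^sup>2"
        using piece[OF psubset.prems True] by blast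
      have finC: "finite C" using C psubset.hyps finite_subset by blast
      have "C \<noteq> {}" using C L by auto
      then have "W - C \<subset> W" using C by blast
      then obtain P where P: "partition_on (W - C) P"
        "real (card (disagreement P (W - C))) \<le> \<theta> + 16 * l\<^sup>2 * real (card V) * (real (card (W - C)) / L)"
        using psubset.IH[of "W - C"] psubset.prems by blast
      have UP: "\<Union>P = W - C" using P(1) by (simp add: partition_on_def)
      have "partition_on W (insert C P)"
        using P(1) C(1) \<open>C \<noteq> {}\<close> UP by (subst partition_on_insert) (auto simp: disjnt_def)
      moreover have "real (card (disagreement (insert C P) W)) \<le>
        \<theta> + 16 * l\<^sup>2 * real (card V) * (real (card W) / L)"
      proof -
        let ?X = "Sigma C (\<lambda>v. {w \<in> C. w \<noteq> v \<and> \<not> adj v w})"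
        let ?Y = "Sigma (W - C) (\<lambda>z. {w \<in> C. adj z w})"
        have fin: "finite (disagreement P (W - C))" "finite ?X" "finite ?Y"
          using finC psubset.hyps by (auto intro: finite_disagreement)
        have "card (disagreement (insert C P) W) \<le> card (disagreement P (W - C) \<union> ?X \<union> ?Y \<union> prod.swap ` ?Y)"
          using fin disagreement_insert_subset[OF C(1) UP] by (intro card_mono) auto
        also have "\<dots> \<le> card (disagreement P (W - C)) + card ?X + card ?Y + card (prod.swap ` ?Y)"
          by (meson add_le_mono card_Un_le le_refl le_trans)
        also have "\<dots> \<le> card (disagreement P (W - C)) + card ?X + 2 * card ?Y"
          using card_image_le[OF fin(3), of prod.swap] by simp
        finally have 1: "real (card (disagreement (insert C P) W)) \<le>
            real (card (disagreement P (W - C))) + real (card ?X) + 2 * real (card ?Y)" by linarith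
        have cX: "real (card ?X) \<le> 8 * l\<^sup>2 * real (card C)"
        proof -
          have "real (card ?X) = (\<Sum>v\<in>C. real (card {w \<in> C. w \<noteq> v \<and> \<not> adj v w}))"
            using finC by (simp add: card_SigmaI)
          also have "\<dots> \<le> (\<Sum>v\<in>C. 8 * l\<^sup>2)" using C(3) by (rule sum_mono)
          finally show ?thesis by (simp add: mult.commute)
        qed
        have cY: "real (card ?Y) \<le> 8 * l\<^sup>2 * real (card (W - C))"
        proof -
          have "real (card ?Y) = (\<Sum>z\<in>W - C. real (card {w \<in> C. adj z w}))"
            using finC psubset.hyps by (simp add: card_SigmaI)
          also have "\<dots> \<le> (\<Sum>z\<in>W - C. 8 * l\<^sup>2)" using C(4) by (rule sum_mono)
          finally show ?thesis by (simp add: mult.commute)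
        qed
        have cW: "real (card (W - C)) = real (card W) - real (card C)"
          using card_Diff_subset[OF finC C(1)] card_mono[OF psubset.hyps C(1)] by simp
        have "real (card ?X) + 2 * real (card ?Y) \<le> 16 * l\<^sup>2 * real (card C) + 16 * l\<^sup>2 * real (card (W - C))"
          using cX cY by simp
        also have "\<dots> = 16 * l\<^sup>2 * real (card W)" unfolding cW by (simp add: algebra_simps)
        also have "\<dots> \<le> 16 * l\<^sup>2 * real (card V)"
          using card_mono[OF finite_V psubset.prems] by (intro mult_left_mono) auto
        finally have 2: "real (card ?X) + 2 * real (card ?Y) \<le> 16 * l\<^sup>2 * real (card V)" .
        have "real (card (W - C)) / L + 1 \<le> real (card W) / L"
          using C(2) L unfolding cW by (simp add: field_simps)
        then have "16 * l\<^sup>2 * real (card V) * (real (card (W - C)) / L + 1) \<le>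
            16 * l\<^sup>2 * real (card V) * (real (card W) / L)" by (intro mult_left_mono) auto
        then show ?thesis using 1 2 P(2) by (simp add: distrib_left)
      qed
      ultimately show ?thesis by blast
    qed
  qed
qed

end

section \<open>From the eigenvalue hypothesis to closeness\<close>

text \<open>\<open>top_eigenvector\<close> for the negated adjacency matrix yields
  \<open>\<mu>\<close> such that \<open>-\<mu>\<close> is an eigenvalue of the matrix unless
  \<open>\<mu> = 0\<close>. Hence \<open>\<mu> \<le> l\<close>, and the upper bound on the negated
  form is the positivity sought.\<close>

lemma psd_of_smallest_eigenvalue:
  assumes V: "fst G = {..<n}" and l: "\<bar>smallest_eigenvalue G\<bar> \<le> l"
  shows "psd {..<n} (\<lambda>u v. of_bool ({u, v} \<in> snd G) + (if u = v then l else 0))"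
proof -
  let ?V = "{..<n}"
  define B where "B = (\<lambda>u v. - of_bool ({u, v} \<in> snd G) :: real)"
  have Bsym: "B u v = B v u" for u v by (simp add: B_def insert_commute)
  obtain \<mu> w where \<mu>: "0 \<le> \<mu>" and eig: "\<And>u. u \<in> ?V \<Longrightarrow> (\<Sum>v\<in>?V. B u v * w v) = \<mu> * w u"
    and nw: "\<mu> * nsq ?V w = \<mu>" and ray: "\<And>x. bil ?V B x x \<le> \<mu> * nsq ?V x"
    using top_eigenvector[of ?V B, OF finite_lessThan Bsym] by blast
  have "\<mu> \<le> l"
  proof (cases "\<mu> = 0")
    case False
    then have "nsq ?V w = 1" using nw by simp
    define x where "x = Matrix.vec n w"
    let ?A = "adjacency_matrix G"
    have A: "?A = Matrix.mat n n (\<lambda>(i, j). if {i, j} \<in> snd G then 1 else 0)"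
      by (simp add: adjacency_matrix_def V Let_def)
    have Ac: "?A \<in> carrier_mat n n" by (simp add: A)
    have "x \<noteq> 0\<^sub>v n"
    proof
      assume "x = 0\<^sub>v n"
      then have "w i = 0" if "i < n" for i
        using that unfolding x_def by (metis index_vec index_zero_vec(1))
      then have "nsq ?V w = 0" by (simp add: nsq_def)
      then show False using \<open>nsq ?V w = 1\<close> by simp
    qed
    moreover have "?A *\<^sub>v x = (- \<mu>) \<cdot>\<^sub>v x"
    proof (rule eq_vecI)
      fix i assume i: "i < dim_vec ((- \<mu>) \<cdot>\<^sub>v x)"
      then have i: "i < n" by (simp add: x_def)
      have "vec_index (?A *\<^sub>v x) i = (\<Sum>j\<in>?V. (if {i, j} \<in> snd G then 1 else 0) * w j)"
        using i by (simp add: A x_def scalar_prod_def lessThan_atLeast0)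
      also have "\<dots> = - (\<Sum>j\<in>?V. B i j * w j)"
        unfolding sum_negf[symmetric] by (intro sum.cong) (auto simp: B_def)
      finally show "vec_index (?A *\<^sub>v x) i = vec_index ((- \<mu>) \<cdot>\<^sub>v x) i"
        using i eig[of i] by (simp add: x_def)
    qed (simp add: A x_def)
    ultimately have "eigenvector ?A x (- \<mu>)"
      using Ac by (auto simp: eigenvector_def x_def)
    then have "- \<mu> \<in> spectrum ?A" by (auto simp: spectrum_def eigenvalue_def)
    then have "smallest_eigenvalue G \<le> - \<mu>"
      unfolding smallest_eigenvalue_def using card_finite_spectrum(1)[OF Ac] by (intro Min_le) auto
    then show ?thesis using l \<mu> by linarith
  qed (use l in simp)
  show ?thesis
  proof (rule psdI)
    fix x :: "nat \<Rightarrow> real"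
    have "bil ?V (\<lambda>u v. of_bool ({u, v} \<in> snd G) + (if u = v then l else 0)) x x
      = l * nsq ?V x - bil ?V B x x"
      by (simp add: bil_add_kernel bil_scalar B_def) (simp add: bil_def sum_negf)
    then show "0 \<le> bil ?V (\<lambda>u v. of_bool ({u, v} \<in> snd G) + (if u = v then l else 0)) x x"
      using ray[of x] mult_right_mono[OF \<open>\<mu> \<le> l\<close> nsq_nonneg[of ?V x]] by linarith
  qed (simp add: insert_commute)
qed

text \<open>The map from ordered pairs to two-element sets sends the disagreeing pairs onto all
  edges to be changed, so counting pairs only overestimates.\<close>

lemma close_of_few_disagreements:
  assumes G: "simple_graph G" "fst G = V" and P: "partition_on V P"
    and few: "real (card {(u, v). u \<in> V \<and> v \<in> V \<and> u \<noteq> v \<and>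
      (({u, v} \<in> snd G) \<noteq> (\<exists>B\<in>P. u \<in> B \<and> v \<in> B))}) \<le> \<mu> * (real (card V))\<^sup>2"
    (is "real (card ?D) \<le> _")
  shows "close_to_family \<mu> G disjoint_unions_of_cliques"
proof -
  define F where "F = (\<Union>C\<in>P. [C]\<^bsup>2\<^esup>)"
  have fin: "finite V" and E: "snd G \<subseteq> [V]\<^bsup>2\<^esup>" using G by (auto simp: simple_graph_def)
  have PV: "C \<subseteq> V" if "C \<in> P" for C using P that by (auto simp: partition_on_def)
  have FV: "F \<subseteq> [V]\<^bsup>2\<^esup>" unfolding F_def using PV by (auto simp: nsets_def)
  have F_iff: "{u, v} \<in> F \<longleftrightarrow> (\<exists>B\<in>P. u \<in> B \<and> v \<in> B)" if "u \<noteq> v" for u v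
    using that by (auto simp: F_def nsets_def)
  have "sym_diff (snd G) F \<subseteq> (\<lambda>(u, v). {u, v}) ` ?D"
  proof
    fix e assume e: "e \<in> sym_diff (snd G) F"
    then have "e \<in> [V]\<^bsup>2\<^esup>" using E FV by auto
    then obtain u v where uv: "e = {u, v}" "u \<noteq> v" "u \<in> V" "v \<in> V"
      by (auto simp: nsets_def card_2_iff)
    then have "(u, v) \<in> ?D" using e F_iff[OF uv(2)] by auto
    then show "e \<in> (\<lambda>(u, v). {u, v}) ` ?D" using uv(1) by (auto intro: rev_image_eqI)
  qed
  moreover have "finite ?D" by (rule finite_subset[of _ "V \<times> V"]) (use fin in auto)
  ultimately have "card (sym_diff (snd G) F) \<le> card ?D" by (rule surj_card_le[rotated])
  then have "real (card (sym_diff (snd G) F)) \<le> \<mu> * (real (card V))\<^sup>2" using few by linarith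
  moreover have "simple_graph (V, F)" using fin FV by (simp add: simple_graph_def)
  moreover have "(V, F) \<in> disjoint_unions_of_cliques"
    using fin P by (auto simp: disjoint_unions_of_cliques_def F_def)
  ultimately show ?thesis unfolding close_to_family_def G(2) by blast
qed

theorem corollary1p3:
  shows "\<exists>\<epsilon>::real. \<epsilon> > 0 \<and>
    (\<exists>N::nat. \<forall>n\<ge>N. \<forall>G :: nat graph.
      simple_graph G \<and> fst G = {..<n} \<and> \<bar>smallest_eigenvalue G\<bar> \<le> real n powr \<epsilon> \<longrightarrow>
      close_to_family (real n powr (- \<epsilon>)) G disjoint_unions_of_cliques)"
proof -
  \<comment> \<open>A quarter of the exponent \<open>1/1000000\<close> in
    \<open>large_enough\<close>: one factor 2 arises because extremal sets have at least
    \<open>n powr (1/2)\<close> vertices, the other from the residual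
    \<open>n powr (2 - 2 * \<epsilon>)\<close>, which must lie below
    \<open>n powr (2 - \<epsilon>)\<close>.\<close>
  define \<epsilon> :: real where "\<epsilon> = 1/4000000"
  obtain X where X: "\<And>x. X \<le> x \<Longrightarrow> large_enough x"
    using eventually_large_enough unfolding eventually_at_top_linorder by blast
  \<comment> \<open>The last condition compares the residual plus the cost of the removals, of order
    \<open>n powr (3/2 + 2 * \<epsilon>)\<close>, with the permitted number of changes.\<close>
  have "\<forall>\<^sub>F n in sequentially. X \<le> real n powr (1/2) \<and> 1 \<le> real n
      \<and> 1200 * (real n powr (1/4000000)) ^ 5 \<le> real n powr (1/2)
      \<and> real n powr (2 - 1/2000000) + 16 * (real n powr (1/4000000))\<^sup>2 * real n * (real n / (real n powr (1/2) / 4))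
        \<le> real n powr (- (1/4000000)) * (real n)\<^sup>2"
  proof (intro eventually_conj)
    have "filterlim (\<lambda>n. real n powr (1/2)) at_top sequentially" by real_asymp
    then show "\<forall>\<^sub>F n in sequentially. X \<le> real n powr (1/2)" by (simp add: filterlim_at_top)
  qed real_asymp+
  then obtain N where N: "\<And>n. N \<le> n \<Longrightarrow> X \<le> real n powr (1/2) \<and> 1 \<le> real n
      \<and> 1200 * (real n powr \<epsilon>) ^ 5 \<le> real n powr (1/2)
      \<and> real n powr (2 - 1/2000000) + 16 * (real n powr \<epsilon>)\<^sup>2 * real n * (real n / (real n powr (1/2) / 4))
        \<le> real n powr (- \<epsilon>) * (real n)\<^sup>2"
    unfolding eventually_sequentially \<epsilon>_def by blast
  have "close_to_family (real n powr (- \<epsilon>)) G disjoint_unions_of_cliques"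
    if n: "N \<le> n" and G: "simple_graph G" "fst G = {..<n}" "\<bar>smallest_eigenvalue G\<bar> \<le> real n powr \<epsilon>"
    for n G
  proof -
    define l where "l = real n powr \<epsilon>"
    have n1: "1 \<le> real n" using N[OF n] by simp
    interpret graph_with_shift "{..<n}" "\<lambda>u v. {u, v} \<in> snd G" l
    proof
      show "{u, u} \<notin> snd G" for u using G(1) by (auto simp: simple_graph_def nsets_def)
      show "1 \<le> l" unfolding l_def using n1 by (intro ge_one_powr_ge_zero) (auto simp: \<epsilon>_def)
      show "psd {..<n} (\<lambda>u v. of_bool ({u, v} \<in> snd G) + (if u = v then l else 0))"
        by (rule psd_of_smallest_eigenvalue[OF G(2)]) (use G(3) in \<open>simp add: l_def\<close>)
    qed (auto simp: insert_commute)
    have "\<exists>P. partition_on {..<n} P \<and> real (card (disagreement P {..<n})) \<le>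
        real n powr (2 - 1/2000000) + 16 * l\<^sup>2 * real (card {..<n}) * (real (card {..<n}) / (real n powr (1/2) / 4))"
    proof (rule greedy_partition[OF order.refl])
      show "0 < real n powr (1/2) / 4" using n1 by simp
      fix W
      assume W: "W \<subseteq> {..<n}" "real n powr (2 - 1/2000000) < ec W"
      show "\<exists>C\<subseteq>W. real n powr (1/2) / 4 \<le> real (card C)
        \<and> (\<forall>v\<in>C. real (card {w \<in> C. w \<noteq> v \<and> {v, w} \<notin> snd G}) \<le> 8 * l\<^sup>2)
        \<and> (\<forall>z\<in>W - C. real (card {w \<in> C. {z, w} \<in> snd G}) \<le> 8 * l\<^sup>2)"
      proof (rule extremal_clique_like_piece[OF _ _ _ _ W(1), of "real n"])
        show "large_enough x" if "real n powr (1/2) \<le> x" for x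
          using N[OF n] that by (intro X) simp
      qed (use N[OF n] W(2) in \<open>auto simp: l_def \<epsilon>_def\<close>)
    qed
    then obtain P where P: "partition_on {..<n} P"
      "real (card (disagreement P {..<n})) \<le>
        real n powr (2 - 1/2000000) + 16 * l\<^sup>2 * real n * (real n / (real n powr (1/2) / 4))"
      by auto
    show ?thesis
      by (rule close_of_few_disagreements[OF G(1,2) P(1)])
         (use P(2) N[OF n] in \<open>simp add: disagreement_def l_def\<close>)
  qed
  moreover have "0 < \<epsilon>" by (simp add: \<epsilon>_def)
  ultimately show ?thesis by blast
qed

end
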